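(* Let $N\ge2$, $R>0$, and assume: $(g_1)$ $g:\mathbb{R}\to\mathbb{R}$ is locally Lipschitz continuous; $(g_2)$ there exist $\delta>0$, $\gamma>2$ and $0<C_1\le C_2$ such that $C_1|s|^\gamma\le g(s)s\le C_2|s|^\gamma$ for every $s\in(-\delta,\delta)$; $(q)$ $q:[0,R]\to\mathbb{R}$ is continuous and $q_0:=\min_{r\in[0,R]}q(r)>0$. For $\lambda,\mu\ge0$ consider the problem $$ \begin{cases} -\left(r^{N-1}\dfrac{u'}{\sqrt{1-(u')^2}}\right)'=r^{N-1}\left(\lambda u+\mu q(r)g(u)\right),& r\in(0,R),\\ u'(0)=0,\quad u(R)=0. \end{cases}\tag{P} $$ Then there exists a family $\{\mu_j^\star\}_{j=1}^{+\infty}$ of functions $\mu_j^\star:[0,+\infty)\to[0,+\infty)$ satisfying, for every $j\ge1$, (i) $\mu_j^\star(\lambda)=0$ if $\lambda>\lambda_j^{\mathrm{rad}}$, (ii) $\mu_j^\star(\lambda)\le\mu_{j+1}^\star(\lambda)$ for all $\lambda\ge0$, such that problem (P) has at least $2j-k$ solutions when $$ \lambda\in[\lambda_k^{\mathrm{rad}},\lambda_{k+1}^{\mathrm{rad}})\quad\text{and}\quad\mu>\mu_j^\star(\lambda),\qquad\text{for some }j\ge\max\{1,k\}, $$ where $k\ge0$ is an integer. Precisely, these solutions can be labeled as $\{u_{\lambda,\mu,\ell}^{(s)}\}_{\ell=k+1}^{j}$, $\{u_{\lambda,\mu,\ell}^{(l)}\}_{\ell=1}^{j}$ in such a way that - $0<u_{\lambda,\mu,k+1}^{(s)}(0)<\dots<u_{\lambda,\mu,j}^{(s)}(0)<u_{\lambda,\mu,j}^{(l)}(0)<\dots<u_{\lambda,\mu,1}^{(l)}(0)$,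 - $u_{\lambda,\mu,\ell}^{(s)}$ has exactly $\ell-1$ zeros on $(0,R)$, for every $\ell=k+1,\dots,j$, - $u_{\lambda,\mu,\ell}^{(l)}$ has exactly $\ell-1$ zeros on $(0,R)$, for every $\ell=1,\dots,j$. If, moreover, $g(s)s>0$ for every $s\ne0$ with $|s|\le R$, then all these solutions are strictly decreasing in the interval from $0$ to the first zero, and have exactly one local extremum between any two consecutive zeros.
   Context: For $k\ge1$, $\lambda_k^{\mathrm{rad}}$ denotes the $k$-th radial eigenvalue of the Dirichlet Laplacian $-\Delta$ in the ball $\mathcal{B}_R(0)\subset\mathbb{R}^N$ (i.e. the $k$-th eigenvalue, in increasing order, having a radial eigenfunction), and by convention $\lambda_0^{\mathrm{rad}}=0$. Solutions of (P) are classical: $u\in C^1([0,R])$, $|u'|<1$ on $[0,R]$, $r^{N-1}u'/\sqrt{1-(u')^2}$ is differentiable on $(0,R)$ and the equation and boundary conditions hold. In the last sentence of the claim zeros are taken in $[0,R]$ (so the endpoint $r=R$ is a zero). When $j=k$ the family $\{u_{\lambda,\mu,\ell}^{(s)}\}$ is empty. *)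

theory Defs
  imports "HOL-Analysis.Analysis"
begin

definition partial :: "'n::finite \<Rightarrow> (real^'n \<Rightarrow> real) \<Rightarrow> real^'n \<Rightarrow> real" where
  "partial i f x = deriv (\<lambda>t. f (x + t *\<^sub>R axis i 1)) 0"

definition C1_on :: "(real^'n::finite) set \<Rightarrow> (real^'n \<Rightarrow> real) \<Rightarrow> bool" where
  "C1_on S f \<longleftrightarrow> continuous_on S f \<and>
     (\<forall>i. (\<forall>x\<in>S. (\<lambda>t. f (x + t *\<^sub>R axis i 1)) differentiable (at 0)) \<and>
          continuous_on S (partial i f))"

definition C2_on :: "(real^'n::finite) set \<Rightarrow> (real^'n \<Rightarrow> real) \<Rightarrow> bool" where
  "C2_on S f \<longleftrightarrow> C1_on S f \<and> (\<forall>i. C1_on S (partial i f))"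

definition laplacian :: "(real^'n::finite \<Rightarrow> real) \<Rightarrow> real^'n \<Rightarrow> real" where
  "laplacian f x = (\<Sum>i\<in>UNIV. partial i (partial i f) x)"

text \<open>Classical eigenfunctions of the Dirichlet Laplacian in the ball of radius \<open>R\<close>.
  Values of \<open>u\<close> outside the closed ball are irrelevant.\<close>

definition dirichlet_eigenfunction :: "real \<Rightarrow> real \<Rightarrow> (real^'n::finite \<Rightarrow> real) \<Rightarrow> bool" where
  "dirichlet_eigenfunction R m u \<longleftrightarrow>
     continuous_on (cball 0 R) u \<and> C2_on (ball 0 R) u \<and>
     (\<forall>x\<in>ball 0 R. - laplacian u x = m * u x) \<and>
     (\<forall>x\<in>sphere 0 R. u x = 0) \<and>
     (\<exists>x\<in>ball 0 R. u x \<noteq> 0)"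

definition radial_on :: "(real^'n::finite) set \<Rightarrow> (real^'n \<Rightarrow> real) \<Rightarrow> bool" where
  "radial_on S u \<longleftrightarrow> (\<forall>x\<in>S. \<forall>y\<in>S. norm x = norm y \<longrightarrow> u x = u y)"

text \<open>The type argument carries the dimension \<open>N = CARD('n)\<close>.\<close>

definition radial_eigenvalue :: "'n::finite itself \<Rightarrow> real \<Rightarrow> real \<Rightarrow> bool" where
  "radial_eigenvalue T R m \<longleftrightarrow>
     (\<exists>u :: real^'n \<Rightarrow> real. dirichlet_eigenfunction R m u \<and> radial_on (cball 0 R) u)"

text \<open>The \<open>k\<close>-th radial eigenvalue in increasing order: the one with exactly \<open>k\<close> radial
  eigenvalues less than or equal to it (finiteness is automatic, since \<open>card\<close> of an infinite set
  is \<open>0 \<noteq> k\<close>). Radial eigenfunctions are unique up to a factor, so there are no multiplicities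
  to count. The value \<open>0\<close> for \<open>k = 0\<close> is a convention.\<close>

definition lambda_rad :: "'n::finite itself \<Rightarrow> real \<Rightarrow> nat \<Rightarrow> real" where
  "lambda_rad T R k =
     (if k = 0 then 0
      else (THE m. radial_eigenvalue T R m \<and> card {m'. radial_eigenvalue T R m' \<and> m' \<le> m} = k))"

text \<open>Here \<open>u'\<close> is the derivative of \<open>u\<close> on \<open>[0,R]\<close>, one-sided at the endpoints.\<close>

definition is_solution ::
    "nat \<Rightarrow> real \<Rightarrow> (real \<Rightarrow> real) \<Rightarrow> (real \<Rightarrow> real) \<Rightarrow> real \<Rightarrow> real \<Rightarrow> (real \<Rightarrow> real) \<Rightarrow> bool" where
  "is_solution N R q g lam mu u \<longleftrightarrow>
     (\<exists>u'. (\<forall>r\<in>{0..R}. (u has_real_derivative u' r) (at r within {0..R})) \<and>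
           continuous_on {0..R} u' \<and>
           (\<forall>r\<in>{0..R}. \<bar>u' r\<bar> < 1) \<and>
           (\<forall>r\<in>{0<..<R}.
              ((\<lambda>s. s ^ (N - 1) * (u' s / sqrt (1 - (u' s)\<^sup>2)))
                 has_real_derivative - (r ^ (N - 1) * (lam * u r + mu * q r * g (u r)))) (at r)) \<and>
           u' 0 = 0 \<and> u R = 0)"

definition zeros_on :: "real set \<Rightarrow> (real \<Rightarrow> real) \<Rightarrow> real set" where
  "zeros_on S u = {r\<in>S. u r = 0}"

text \<open>The finiteness clause matters for \<open>n = 0\<close>.\<close>

definition has_exactly_zeros_on :: "nat \<Rightarrow> real set \<Rightarrow> (real \<Rightarrow> real) \<Rightarrow> bool" where
  "has_exactly_zeros_on n S u \<longleftrightarrow> finite (zeros_on S u) \<and> card (zeros_on S u) = n"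

definition local_extremum_at :: "(real \<Rightarrow> real) \<Rightarrow> real \<Rightarrow> bool" where
  "local_extremum_at u r \<longleftrightarrow>
     (\<forall>\<^sub>F s in at r. u s \<le> u r) \<or> (\<forall>\<^sub>F s in at r. u r \<le> u s)"

definition consecutive_zeros :: "real \<Rightarrow> (real \<Rightarrow> real) \<Rightarrow> real \<Rightarrow> real \<Rightarrow> bool" where
  "consecutive_zeros R u a b \<longleftrightarrow>
     a \<in> zeros_on {0..R} u \<and> b \<in> zeros_on {0..R} u \<and> a < b \<and> zeros_on {a<..<b} u = {}"

text \<open>The zeros in \<open>[0,R]\<close> are finitely many for every \<open>u\<close> this is applied to, and \<open>R\<close> is one
  of them, so \<open>Min\<close> is the first zero.\<close>

definition regular_profile :: "real \<Rightarrow> (real \<Rightarrow> real) \<Rightarrow> bool" where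
  "regular_profile R u \<longleftrightarrow>
     strict_antimono_on {0..Min (zeros_on {0..R} u)} u \<and>
     (\<forall>a b. consecutive_zeros R u a b \<longrightarrow> (\<exists>!r. r \<in> {a<..<b} \<and> local_extremum_at u r))"

end

theory Submission
  imports Defs
begin

text \<open>
The proof is by shooting. A radial profile is determined by its height \<open>d = u 0\<close>; writing
\<open>u = d * U d\<close>, the normalised profiles \<open>U d\<close> form a family that is continuous in \<open>d\<close> on the
closed interval from \<open>0\<close> to \<open>R\<close>, because \<open>g\<close> vanishes faster than linearly at \<open>0\<close>: at \<open>d = 0\<close> it
ends in the solution of the linear radial equation with parameter \<open>lam\<close>. A Picard iteration on
functions of the pair \<open>(d, r)\<close> gives existence and joint continuity together
(\<open>solution_family\<close>).

All zeros of \<open>U d\<close> are simple (\<open>nondegenerate\<close>). Hence, under a small change of \<open>d\<close>, zeros inside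
\<open>(0, R)\<close> survive and no zero is created in \<open>[0, R]\<close>: the first count is lower, the second upper
semicontinuous. When the number of interior zeros passes from below \<open>l\<close> to at least \<open>l\<close>, there is
a height with fewer than \<open>l\<close> zeros inside but at least \<open>l\<close> in the closed interval; there \<open>U d\<close> has
exactly \<open>l - 1\<close> interior zeros and vanishes at \<open>R\<close>, so it is a solution (\<open>nodal_parameters\<close>).

It remains to know three heights. At \<open>d = 0\<close> the zeros in \<open>[0, R]\<close> correspond to the radial
eigenvalues that are at most \<open>lam\<close>, so there are at most \<open>k\<close> of them. At \<open>d = R\<close> there are none,
since a profile of slope less than \<open>1\<close> cannot descend from \<open>R\<close> to \<open>0\<close> within \<open>[0, R]\<close>. In
between one needs a height with \<open>j\<close> interior zeros; below it lie the small solutions with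
\<open>k, ..., j - 1\<close> nodes and above it the large ones with \<open>j - 1, ..., 0\<close> nodes. If \<open>lam\<close> exceeds the
\<open>j\<close>-th eigenvalue, a small height will do, whatever \<open>mu\<close> is
(\<open>many_nodes_above_eigenvalue\<close>), which is why the threshold vanishes there. Otherwise large
\<open>mu\<close> forces the oscillations (\<open>large_mu_oscillates\<close>). There is no monotone energy, as \<open>q\<close> is only
continuous; instead, since speeds are below \<open>1\<close>, the momentum gained or lost during an excursion
lies between \<open>mu\<close> times two positive functions of its amplitude, which bounds the amplitude of each excursion
by that of the preceding one, from above and from below, uniformly in \<open>mu\<close> (\<open>hump\<close>).

The eigenvalues are explicit. The regular solution of the linear radial equation is
\<open>r \<mapsto> rad N (lam * r\<^sup>2)\<close> with an entire function \<open>rad N\<close>, so that the radial eigenvalues are the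
zeros of \<open>rad N\<close> divided by \<open>R\<^sup>2\<close> (\<open>radial_eigenvalue_iff\<close>), and counting zeros of the linear
profile is the same as counting eigenvalues. A Riccati argument shows that they are infinitely
many (\<open>rad_zeros_unbounded\<close>).

When \<open>g\<close> has the sign of its argument, the momentum \<open>r ^ (N - 1) * u' / sqrt (1 - u'\<^sup>2)\<close> is
strictly monotone wherever \<open>u\<close> has constant sign, which leaves room for only one critical point
between consecutive zeros (\<open>profile_regular\<close>).
\<close>

section \<open>Elementary real analysis\<close>

lemma has_real_derivative_transfer:
  assumes "(f has_real_derivative D) (at x)" "\<forall>\<^sub>F y in nhds x. f y = g y"
  shows "(g has_real_derivative D) (at x)"
  using DERIV_cong_ev[OF refl assms(2) refl, of D] assms(1) by simp

lemma DERIV_square: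
  fixes f :: "real \<Rightarrow> real"
  assumes "(f has_real_derivative D) (at x)"
  shows "((\<lambda>x. (f x)\<^sup>2) has_real_derivative 2 * f x * D) (at x)"
  using DERIV_power[OF assms, of 2] by (simp add: mult_ac)

lemma mvt_within:
  fixes f f' :: "real \<Rightarrow> real"
  assumes der: "\<And>r. r \<in> {a..b} \<Longrightarrow> (f has_real_derivative f' r) (at r within {a..b})"
    and st: "a \<le> s" "s < t" "t \<le> b"
  obtains x where "s < x" "x < t" "f t - f s = (t - s) * f' x"
proof -
  have at: "(f has_real_derivative f' r) (at r)" if "s < r" "r < t" for r
    using der[of r] that st by (simp add: at_within_Icc_at)
  have "continuous_on {a..b} f"
    using der by (intro continuous_on_eq_continuous_within[THEN iffD2]) (blast intro: DERIV_continuous)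
  then have c: "continuous_on {s..t} f" by (rule continuous_on_subset) (use st in auto)
  obtain l x where x: "s < x" "x < t" "(f has_real_derivative l) (at x)" "f t - f s = (t - s) * l"
    using MVT[OF st(2) c] at real_differentiable_def by blast
  then have "l = f' x" using at DERIV_unique by blast
  with x show ?thesis using that by blast
qed

lemma nondecreasing_of_deriv_nonneg:
  fixes f :: "real \<Rightarrow> real"
  assumes "a \<le> b" and c: "continuous_on {a..b} f"
    and d: "\<And>x. a < x \<Longrightarrow> x < b \<Longrightarrow> (f has_real_derivative f' x) (at x)"
    and nn: "\<And>x. a < x \<Longrightarrow> x < b \<Longrightarrow> 0 \<le> f' x"
  shows "f a \<le> f b"
proof (cases "a = b")
  case False
  then have ab: "a < b" using assms(1) by simp
  obtain l z where z: "a < z" "z < b" "(f has_real_derivative l) (at z)" "f b - f a = (b - a) * l"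
    using MVT[OF ab c] d real_differentiable_def by blast
  have "l = f' z" using DERIV_unique[OF z(3) d[OF z(1,2)]] .
  then have "0 \<le> (b - a) * l" using nn[OF z(1,2)] ab by simp
  then show ?thesis using z(4) by simp
qed simp

lemma gronwall_zero:
  fixes E E' :: "real \<Rightarrow> real"
  assumes "a \<le> b" and c: "continuous_on {a..b} E"
    and d: "\<And>r. a < r \<Longrightarrow> r < b \<Longrightarrow> (E has_real_derivative E' r) (at r)"
    and le: "\<And>r. a < r \<Longrightarrow> r < b \<Longrightarrow> E' r \<le> K * E r"
    and E0: "E a \<le> 0"
  shows "E b \<le> 0"
proof -
  have "- (exp (- K * a) * E a) \<le> - (exp (- K * b) * E b)"
  proof (rule nondecreasing_of_deriv_nonneg[OF assms(1)])
    show "continuous_on {a..b} (\<lambda>r. - (exp (- K * r) * E r))"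
      by (intro continuous_intros c)
    fix x assume x: "a < x" "x < b"
    show "((\<lambda>r. - (exp (- K * r) * E r)) has_real_derivative exp (- K * x) * (K * E x - E' x)) (at x)"
      using d[OF x] by (auto intro!: derivative_eq_intros simp: algebra_simps)
    show "0 \<le> exp (- K * x) * (K * E x - E' x)"
      using le[OF x] by (intro mult_nonneg_nonneg) auto
  qed
  then have "exp (- K * b) * E b \<le> exp (- K * a) * E a" by simp
  also have "\<dots> \<le> 0" using E0 by (simp add: mult_le_0_iff)
  finally show ?thesis by (simp add: mult_le_0_iff)
qed

lemma gronwall_zero_backward:
  fixes E E' :: "real \<Rightarrow> real"
  assumes "a \<le> b" and c: "continuous_on {a..b} E"
    and d: "\<And>r. a < r \<Longrightarrow> r < b \<Longrightarrow> (E has_real_derivative E' r) (at r)"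
    and le: "\<And>r. a < r \<Longrightarrow> r < b \<Longrightarrow> - (K * E r) \<le> E' r"
    and E0: "E b \<le> 0"
  shows "E a \<le> 0"
proof -
  have "exp (K * a) * E a \<le> exp (K * b) * E b"
  proof (rule nondecreasing_of_deriv_nonneg[OF assms(1)])
    show "continuous_on {a..b} (\<lambda>r. exp (K * r) * E r)"
      by (intro continuous_intros c)
    fix x assume x: "a < x" "x < b"
    show "((\<lambda>r. exp (K * r) * E r) has_real_derivative exp (K * x) * (K * E x + E' x)) (at x)"
      using d[OF x] by (auto intro!: derivative_eq_intros simp: algebra_simps)
    show "0 \<le> exp (K * x) * (K * E x + E' x)"
      using le[OF x] by (intro mult_nonneg_nonneg) auto
  qed
  also have "\<dots> \<le> 0" using E0 by (simp add: mult_le_0_iff)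
  finally show ?thesis by (simp add: mult_le_0_iff)
qed

text \<open>
By the mean value theorem some derivative between the two ends vanishes; a strictly decreasing
function with the sign of the derivative can vanish only there.
\<close>

lemma hump_maximum:
  fixes u u' v :: "real \<Rightarrow> real"
  assumes ab: "a < b" and c: "continuous_on {a..b} u" and ends: "u a = u b"
    and d: "\<And>r. a < r \<Longrightarrow> r < b \<Longrightarrow> (u has_real_derivative u' r) (at r)"
    and pos: "\<And>r. a < r \<Longrightarrow> r < b \<Longrightarrow> 0 < u' r \<longleftrightarrow> 0 < v r"
    and zero: "\<And>r. a < r \<Longrightarrow> r < b \<Longrightarrow> u' r = 0 \<longleftrightarrow> v r = 0"
    and v: "\<And>r s. a < r \<Longrightarrow> r < s \<Longrightarrow> s < b \<Longrightarrow> v s < v r"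
  obtains x where "a < x" "x < b" "\<And>r. a < r \<Longrightarrow> r < b \<Longrightarrow> u r \<le> u x"
    "\<And>r. a < r \<Longrightarrow> r < b \<Longrightarrow> u' r = 0 \<longleftrightarrow> r = x"
proof -
  obtain l x where x: "a < x" "x < b" "(u has_real_derivative l) (at x)" "u b - u a = (b - a) * l"
    using MVT[OF ab c] d real_differentiable_def by blast
  have "l = 0" using x(4) ends ab by simp
  then have "u' x = 0" using DERIV_unique[OF x(3) d[OF x(1,2)]] by simp
  then have vx: "v x = 0" using zero x by blast
  have only: "u' r = 0 \<longleftrightarrow> r = x" if "a < r" "r < b" for r
    using zero[OF that] vx v[of r x] v[of x r] that x by (cases r x rule: linorder_cases) auto
  have "u r \<le> u x" if r: "a < r" "r < b" for r
  proof (cases "r \<le> x")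
    case True
    show ?thesis
    proof (rule nondecreasing_of_deriv_nonneg[OF True])
      show "continuous_on {r..x} u" by (rule continuous_on_subset[OF c]) (use r x in auto)
      fix s assume s: "r < s" "s < x"
      then show "(u has_real_derivative u' s) (at s)" using d r x by auto
      have "0 < v s" using v[of s x] s r x vx by auto
      then show "0 \<le> u' s" using pos[of s] s r x by auto
    qed
  next
    case False
    then have "x \<le> r" by simp
    have "- u x \<le> - u r"
    proof (rule nondecreasing_of_deriv_nonneg[OF \<open>x \<le> r\<close>])
      show "continuous_on {x..r} (\<lambda>r. - u r)"
        by (intro continuous_intros continuous_on_subset[OF c]) (use r x in auto)
      fix s assume s: "x < s" "s < r"
      then show "((\<lambda>r. - u r) has_real_derivative - u' s) (at s)" using d r x by (intro DERIV_minus) auto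
      have "v s < 0" using v[of x s] s r x vx by auto
      then show "0 \<le> - u' s" using pos[of s] s r x by auto
    qed
    then show ?thesis by simp
  qed
  then show ?thesis using that x only by blast
qed

lemma local_extremum_deriv_zero:
  assumes "local_extremum_at u r" "(u has_real_derivative D) (at r)"
  shows "D = 0"
proof -
  consider "\<forall>\<^sub>F s in at r. u s \<le> u r" | "\<forall>\<^sub>F s in at r. u r \<le> u s"
    using assms(1) unfolding local_extremum_at_def by blast
  then show ?thesis
  proof cases
    case 1
    then obtain d where d: "d > 0" "\<And>s. s \<noteq> r \<Longrightarrow> dist s r < d \<Longrightarrow> u s \<le> u r" unfolding eventually_at by auto
    have "\<forall>s. \<bar>r - s\<bar> < d \<longrightarrow> u s \<le> u r"
    proof (intro allI impI)
      fix s assume "\<bar>r - s\<bar> < d"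
      then show "u s \<le> u r" using d(2)[of s] by (cases "s = r") (auto simp: dist_real_def)
    qed
    then show ?thesis by (rule DERIV_local_max[OF assms(2) d(1)])
  next
    case 2
    then obtain d where d: "d > 0" "\<And>s. s \<noteq> r \<Longrightarrow> dist s r < d \<Longrightarrow> u r \<le> u s" unfolding eventually_at by auto
    have "\<forall>s. \<bar>r - s\<bar> < d \<longrightarrow> u r \<le> u s"
    proof (intro allI impI)
      fix s assume "\<bar>r - s\<bar> < d"
      then show "u r \<le> u s" using d(2)[of s] by (cases "s = r") (auto simp: dist_real_def)
    qed
    then show ?thesis by (rule DERIV_local_min[OF assms(2) d(1)])
  qed
qed

lemma constant_sign_between_zeros:
  fixes u :: "real \<Rightarrow> real"
  assumes c: "continuous_on {a..b} u" and nz: "\<And>r. a < r \<Longrightarrow> r < b \<Longrightarrow> u r \<noteq> 0"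
  shows "(\<forall>r. a < r \<longrightarrow> r < b \<longrightarrow> 0 < u r) \<or> (\<forall>r. a < r \<longrightarrow> r < b \<longrightarrow> u r < 0)"
proof (rule ccontr)
  assume "\<not> ?thesis"
  then obtain r s where r: "a < r" "r < b" "u r < 0" and s: "a < s" "s < b" "0 < u s"
    using nz by (metis linorder_less_linear)
  have "\<exists>x. a < x \<and> x < b \<and> u x = 0"
  proof (cases "r \<le> s")
    case True
    have "continuous_on {r..s} u" by (rule continuous_on_subset[OF c]) (use r s in auto)
    then obtain x where "r \<le> x" "x \<le> s" "u x = 0" using IVT'[of u r 0 s] True r s by auto
    then show ?thesis using r s by (intro exI[of _ x]) auto
  next
    case False
    have "continuous_on {s..r} u" by (rule continuous_on_subset[OF c]) (use r s in auto)
    then obtain x where "s \<le> x" "x \<le> r" "u x = 0" using IVT2'[of u r 0 s] False r s by auto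
    then show ?thesis using r s by (intro exI[of _ x]) auto
  qed
  then show False using nz by blast
qed

lemma locally_lipschitz_imp_lipschitz_on_compact:
  fixes g :: "real \<Rightarrow> real"
  assumes "\<forall>x. \<exists>e>0. \<exists>L. L-lipschitz_on (ball x e) g" and "compact S"
  shows "\<exists>L. L-lipschitz_on S g"
proof -
  have ll: "local_lipschitz {0::real} UNIV (\<lambda>_. g)"
  proof (rule local_lipschitzI)
    fix t x :: real
    obtain e L where e: "e > 0" "L-lipschitz_on (ball x e) g" using assms(1) by blast
    have "L-lipschitz_on (cball x (e / 2) \<inter> UNIV) g"
      by (rule lipschitz_on_subset[OF e(2)]) (use e(1) in auto)
    then show "\<exists>u>0. \<exists>L. \<forall>t\<in>cball t u \<inter> {0}. L-lipschitz_on (cball x u \<inter> UNIV) g"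
      using e(1) by (intro exI[of _ "e / 2"]) auto
  qed
  have ll': "local_lipschitz {0::real} S (\<lambda>_. g)"
    by (rule local_lipschitz_subset[OF ll]) auto
  obtain L where "\<And>t. t \<in> {0::real} \<Longrightarrow> L-lipschitz_on S g"
    by (rule local_lipschitz_compact_implies_lipschitz[OF ll' assms(2)]) auto
  then show ?thesis by blast
qed

lemma finite_separated:
  fixes F :: "real set"
  assumes "finite F"
  shows "\<exists>e>0. \<forall>x\<in>F. \<forall>y\<in>F. x \<noteq> y \<longrightarrow> e \<le> \<bar>x - y\<bar>"
proof -
  let ?D = "insert 1 ((\<lambda>(x, y). \<bar>x - y\<bar>) ` {p \<in> F \<times> F. fst p \<noteq> snd p})"
  have fin: "finite ?D" using assms by auto
  have "Min ?D > 0" by (subst Min_gr_iff) (use fin in auto)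
  moreover have "Min ?D \<le> \<bar>x - y\<bar>" if "x \<in> F" "y \<in> F" "x \<noteq> y" for x y
    by (rule Min_le[OF fin]) (use that in force)
  ultimately show ?thesis by blast
qed

section \<open>The slope map of the mean curvature operator\<close>

text \<open>
\<open>slope 1\<close> is the inverse of the map \<open>s \<mapsto> s / sqrt (1 - s\<^sup>2)\<close>, so it recovers the derivative of a
profile from its flux. The parameter \<open>d\<close> rescales: \<open>d * slope d y = slope 1 (d * y)\<close>, and
\<open>slope 0\<close> is the identity, which belongs to the linear problem.
\<close>

definition slope :: "real \<Rightarrow> real \<Rightarrow> real" where
  "slope d y = y / sqrt (1 + (d * y)\<^sup>2)"

lemma one_plus_square_pos: "0 < 1 + (x::real)\<^sup>2"
  by (simp add: add_pos_nonneg)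

lemma slope_0 [simp]: "slope d 0 = 0"
  by (simp add: slope_def)

lemma slope_eq_0_iff [simp]: "slope d y = 0 \<longleftrightarrow> y = 0"
  using one_plus_square_pos[of "d * y"] by (auto simp: slope_def simp del: power_mult_distrib)

text \<open>
The derivative is \<open>1 / ((1 + (d * y)\<^sup>2) * sqrt (1 + (d * y)\<^sup>2))\<close>, hence the bound is uniform in \<open>d\<close>.
\<close>

lemma slope_lipschitz: "\<bar>slope d y - slope d z\<bar> \<le> \<bar>y - z\<bar>"
proof -
  have "norm (slope d y - slope d z) \<le> 1 * norm (y - z)"
  proof (rule field_differentiable_bound[where S = UNIV])
    fix x :: real
    let ?w = "1 + (d * x)\<^sup>2"
    have w: "0 < ?w" by (rule one_plus_square_pos)
    have w1: "1 \<le> ?w" by simp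
    have s: "sqrt ?w > 0" "sqrt ?w ^ 2 = ?w" using w by auto
    have "(slope d has_field_derivative
        (sqrt ?w - x * ((2 * (d * x) * d) / (2 * sqrt ?w))) / (sqrt ?w * sqrt ?w)) (at x)"
      unfolding slope_def[abs_def] using w
      by (auto intro!: derivative_eq_intros simp: field_simps power2_eq_square)
    moreover have "(sqrt ?w - x * ((2 * (d * x) * d) / (2 * sqrt ?w))) / (sqrt ?w * sqrt ?w)
        = 1 / (?w * sqrt ?w)"
    proof -
      have "sqrt ?w - x * ((2 * (d * x) * d) / (2 * sqrt ?w)) = 1 / sqrt ?w"
        using s by (simp add: field_simps power2_eq_square)
      then show ?thesis using w by simp
    qed
    ultimately show "(slope d has_field_derivative 1 / (?w * sqrt ?w)) (at x within UNIV)"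
      by simp
    have "1 \<le> ?w * sqrt ?w" using w w1 mult_mono[of 1 ?w 1 "sqrt ?w"] by simp
    then show "norm (1 / (?w * sqrt ?w)) \<le> 1" by (simp add: divide_le_eq)
  qed auto
  then show ?thesis by simp
qed

lemma abs_slope_le: "\<bar>slope d y\<bar> \<le> \<bar>y\<bar>"
  using slope_lipschitz[of d y 0] by simp

lemma continuous_on_slope [continuous_intros]:
  assumes "continuous_on S f" "continuous_on S h"
  shows "continuous_on S (\<lambda>x. slope (f x) (h x))"
  unfolding slope_def
  by (intro continuous_intros assms) (metis less_irrefl one_plus_square_pos real_sqrt_gt_0_iff)

lemma slope_minus [simp]: "slope d (- y) = - slope d y"
  by (simp add: slope_def)

lemma abs_slope_one_less: "\<bar>slope 1 y\<bar> < 1"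
proof -
  have "\<bar>y\<bar> < sqrt (1 + y\<^sup>2)" by (rule real_less_rsqrt) simp
  moreover have "0 < 1 + y\<^sup>2" by (rule one_plus_square_pos)
  ultimately show ?thesis by (simp add: slope_def divide_less_eq)
qed

lemma slope_nonneg: "0 \<le> y \<Longrightarrow> 0 \<le> slope d y"
  by (simp add: slope_def)

lemma slope_one_ge_half:
  assumes "1 \<le> y" shows "1 / 2 \<le> slope 1 y"
proof -
  have "sqrt (1 + y\<^sup>2) \<le> 2 * y"
    using assms mult_mono[of 1 y 1 y] by (intro real_le_lsqrt) (auto simp: power2_eq_square)
  moreover have "0 < sqrt (1 + y\<^sup>2)" by (simp add: add_pos_nonneg)
  ultimately show ?thesis by (simp add: slope_def field_simps)
qed

section \<open>A singular initial value problem\<close>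

text \<open>
Integrals up to a variable end point are rewritten over the unit interval: then continuity in the
end point, down to \<open>0\<close>, is continuity of a parameter integral.
\<close>

lemma integral_rescale_to_unit:
  fixes f :: "real \<Rightarrow> real"
  assumes "continuous_on UNIV f" "0 \<le> s"
  shows "s * integral {0..1} (\<lambda>x. f (s * x)) = integral {0..s} f"
proof (cases "s = 0")
  case False
  then have s: "s > 0" using assms by simp
  have fi: "(f has_integral integral {0..s} f) {0..s}"
    by (intro integrable_integral integrable_continuous_interval continuous_on_subset[OF assms(1)]) auto
  from has_integral_stretch_real[OF this, of s]
  have "((\<lambda>x. f (s * x)) has_integral (1 / \<bar>s\<bar>) *\<^sub>R integral {0..s} f) ((\<lambda>x. x / s) ` {0..s})"
    using s by simp
  moreover have "(\<lambda>x. x / s) ` {0..s} = {0..1}"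
    using s by (auto simp: image_iff intro!: bexI[of _ "s * _"])
  ultimately have "integral {0..1} (\<lambda>x. f (s * x)) = (1 / s) * integral {0..s} f"
    using s by (simp add: integral_unique)
  then show ?thesis using s by simp
qed simp

lemma exp_mean_bound:
  fixes \<kappa> s :: real
  assumes "0 < \<kappa>" "0 \<le> s"
  shows "s * integral {0..1} (\<lambda>x. exp (\<kappa> * (s * x))) \<le> exp (\<kappa> * s) / \<kappa>"
proof -
  have "s * integral {0..1} (\<lambda>x. exp (\<kappa> * (s * x))) = integral {0..s} (\<lambda>x. exp (\<kappa> * x))"
    using assms by (intro integral_rescale_to_unit[where f = "\<lambda>x. exp (\<kappa> * x)"] continuous_intros) auto
  also have "\<dots> = exp (\<kappa> * s) / \<kappa> - exp (\<kappa> * 0) / \<kappa>"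
    using assms
    by (intro integral_unique fundamental_theorem_of_calculus)
       (auto intro!: derivative_eq_intros simp: has_real_derivative_iff_has_vector_derivative[symmetric])
  finally show ?thesis using assms by simp
qed

lemma abs_integral_le_integral:
  fixes f f' :: "real \<Rightarrow> real"
  assumes "f integrable_on S" "f' integrable_on S" "\<And>x. x \<in> S \<Longrightarrow> \<bar>f x\<bar> \<le> f' x"
  shows "\<bar>integral S f\<bar> \<le> integral S f'"
  using Henstock_Kurzweil_Integration.integral_norm_bound_integral[of f S f'] assms by simp

lemma continuous_on_mean:
  fixes f :: "'a::metric_space \<Rightarrow> real \<Rightarrow> real"
  assumes "continuous_on UNIV (\<lambda>(x, t). f x t)"
  shows "continuous_on UNIV (\<lambda>x. integral {0..1} (f x))"
proof -
  have "continuous_on UNIV (\<lambda>x. integral (cbox 0 1) (f x))"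
    by (rule integral_continuous_on_param) (rule continuous_on_subset[OF assms], simp)
  then show ?thesis by simp
qed

text \<open>
The system is \<open>U' = slope d Y\<close>, \<open>(r ^ (N - 1) * Y)' = - r ^ (N - 1) * h d r U\<close> with \<open>U 0 = 1\<close> and
\<open>Y 0 = 0\<close>. The coefficient degenerates at \<open>r = 0\<close>, but the integrated system does not. The unknown
is treated as a function of \<open>(d, r)\<close>, so that its continuity in the parameter is part of
the fixed point.
\<close>

locale singular_ivp =
  fixes N :: nat and R K :: real and h :: "real \<Rightarrow> real \<Rightarrow> real \<Rightarrow> real"
  assumes R_pos: "0 < R" and K_nonneg: "0 \<le> K"
    and h_cont: "continuous_on UNIV (\<lambda>p. h (fst p) (fst (snd p)) (snd (snd p)))"
    and h_lip: "\<bar>h d s x - h d s y\<bar> \<le> K * \<bar>x - y\<bar>"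
begin

lemma continuous_on_h:
  assumes "continuous_on S a" "continuous_on S b" "continuous_on S c"
  shows "continuous_on S (\<lambda>z. h (a z) (b z) (c z))"
  using continuous_on_compose2[OF h_cont, of S "\<lambda>z. (a z, b z, c z)"] assms
  by (simp add: continuous_on_Pair)

text \<open>
Exponential weight for which the Picard map contracts: each of its two integrations gains a
factor \<open>1 / rate\<close>.
\<close>

definition rate :: real where "rate = sqrt (2 * K + 1)"

lemma rate_pos: "0 < rate" and rate_large: "K / (rate * rate) \<le> 1 / 2"
  using K_nonneg by (auto simp: rate_def field_simps)

text \<open>
This is \<open>Y r = - r ^ (1 - N) * (integral of s ^ (N - 1) * h d s (f s) over [0, r])\<close> after the
substitution \<open>s = r * x\<close>, which removes the negative power of \<open>r\<close>.
\<close>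

definition velocity :: "(real \<times> real \<Rightarrow> real) \<Rightarrow> real \<times> real \<Rightarrow> real" where
  "velocity f p = - snd p * integral {0..1} (\<lambda>x. x ^ (N - 1) * h (fst p) (snd p * x) (f (fst p, snd p * x)))"

definition position :: "(real \<times> real \<Rightarrow> real) \<Rightarrow> real \<times> real \<Rightarrow> real" where
  "position f p = 1 + snd p * integral {0..1} (\<lambda>x. slope (fst p) (velocity f (fst p, snd p * x)))"

text \<open>
Clipping to the square turns continuous functions on the plane into bounded ones, so that the
complete metric space of bounded continuous functions can be used.
\<close>

definition clip :: "real \<times> real \<Rightarrow> real \<times> real" where
  "clip p = (max 0 (min R (fst p)), max 0 (min R (snd p)))"

definition weighted :: "((real \<times> real) \<Rightarrow>\<^sub>C real) \<Rightarrow> real \<times> real \<Rightarrow> real" where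
  "weighted \<Phi> p = exp (rate * snd p) * apply_bcontfun \<Phi> p"

definition picard :: "((real \<times> real) \<Rightarrow>\<^sub>C real) \<Rightarrow> ((real \<times> real) \<Rightarrow>\<^sub>C real)" where
  "picard \<Phi> = Bcontfun (\<lambda>p. exp (- rate * snd (clip p)) *
     position (weighted \<Phi>) (clip p))"

lemma velocity_cont:
  assumes "continuous_on UNIV f"
  shows "continuous_on UNIV (velocity f)"
proof -
  have 1: "continuous_on UNIV (\<lambda>z. f (fst (fst z), snd (fst z) * snd z))"
    by (rule continuous_on_compose2[OF assms]) (auto intro!: continuous_intros)
  have 2: "continuous_on UNIV (\<lambda>z. h (fst (fst z)) (snd (fst z) * snd z) (f (fst (fst z), snd (fst z) * snd z)))"
    by (intro continuous_on_h continuous_intros 1)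
  show ?thesis unfolding velocity_def[abs_def]
    by (intro continuous_intros continuous_on_mean) (auto simp: case_prod_unfold intro!: continuous_intros 2)
qed

lemma position_cont:
  assumes "continuous_on UNIV f"
  shows "continuous_on UNIV (position f)"
proof -
  have 1: "continuous_on UNIV (\<lambda>z. velocity f (fst (fst z), snd (fst z) * snd z))"
    by (rule continuous_on_compose2[OF velocity_cont[OF assms]]) (auto intro!: continuous_intros)
  show ?thesis unfolding position_def[abs_def]
    by (intro continuous_intros continuous_on_mean) (auto simp: case_prod_unfold intro!: continuous_intros 1)
qed

lemma clip_cont: "continuous_on S clip"
  unfolding clip_def[abs_def] by (intro continuous_intros)

lemma clip_range: "range clip \<subseteq> {0..R} \<times> {0..R}"
  using R_pos by (auto simp: clip_def)

lemma clip_id: "d \<in> {0..R} \<Longrightarrow> r \<in> {0..R} \<Longrightarrow> clip (d, r) = (d, r)"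
  by (auto simp: clip_def)

lemma picard_bcontfun:
  assumes "continuous_on UNIV f"
  shows "(\<lambda>p. exp (- rate * snd (clip p)) * position f (clip p)) \<in> bcontfun"
proof -
  let ?P = "\<lambda>p. exp (- rate * snd p) * position f p"
  have c: "continuous_on S ?P" for S
    by (intro continuous_intros continuous_on_subset[OF position_cont[OF assms]]) auto
  have "compact (?P ` ({0..R} \<times> {0..R}))"
    by (intro compact_continuous_image c compact_Times compact_Icc)
  then have "bounded (?P ` ({0..R} \<times> {0..R}))" by (rule compact_imp_bounded)
  then have b: "bounded (range (\<lambda>p. ?P (clip p)))"
    by (rule bounded_subset) (use clip_range in auto)
  have "continuous_on UNIV (\<lambda>p. ?P (clip p))"
    by (rule continuous_on_compose2[OF c[of UNIV] clip_cont]) auto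
  with b show ?thesis by (simp add: bcontfun_def)
qed

lemma weighted_cont: "continuous_on UNIV (weighted \<Phi>)"
  unfolding weighted_def[abs_def] by (intro continuous_intros continuous_on_apply_bcontfun)

lemma apply_step: "apply_bcontfun (picard \<Phi>) p = exp (- rate * snd (clip p)) *
     position (weighted \<Phi>) (clip p)"
  unfolding picard_def by (subst Bcontfun_inverse[OF picard_bcontfun[OF weighted_cont]]) simp

lemma velocity_weighted_lip:
  assumes s: "0 \<le> s"
  shows "\<bar>velocity (weighted \<Phi>) (d, s)
        - velocity (weighted \<Psi>) (d, s)\<bar>
      \<le> K / rate * dist \<Phi> \<Psi> * exp (rate * s)"
proof -
  let ?f = "\<lambda>\<Phi> x. x ^ (N - 1) * h d (s * x) (exp (rate * (s * x)) * apply_bcontfun \<Phi> (d, s * x))"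
  have c: "continuous_on S (?f \<Phi>)" for S \<Phi>
  proof -
    have "continuous_on UNIV (\<lambda>x. h d (s * x) (exp (rate * (s * x)) * apply_bcontfun \<Phi> (d, s * x)))"
      by (intro continuous_on_h continuous_intros continuous_on_compose2[OF continuous_on_apply_bcontfun[of UNIV \<Phi>]]) auto
    then show ?thesis by (intro continuous_intros) (rule continuous_on_subset, auto)
  qed
  have i: "?f \<Phi> integrable_on {0..1}" for \<Phi>
    by (intro integrable_continuous_interval c)
  have pt: "\<bar>?f \<Phi> x - ?f \<Psi> x\<bar> \<le> K * dist \<Phi> \<Psi> * exp (rate * (s * x))" if x: "x \<in> {0..1}" for x
  proof -
    have "\<bar>?f \<Phi> x - ?f \<Psi> x\<bar> = x ^ (N - 1) * \<bar>h d (s * x) (exp (rate * (s * x)) * apply_bcontfun \<Phi> (d, s * x))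
         - h d (s * x) (exp (rate * (s * x)) * apply_bcontfun \<Psi> (d, s * x))\<bar>"
      using x by (simp add: right_diff_distrib[symmetric] abs_mult)
    also have "\<dots> \<le> 1 * \<bar>h d (s * x) (exp (rate * (s * x)) * apply_bcontfun \<Phi> (d, s * x))
         - h d (s * x) (exp (rate * (s * x)) * apply_bcontfun \<Psi> (d, s * x))\<bar>"
      using x by (intro mult_right_mono power_le_one) auto
    also have "\<dots> \<le> K * \<bar>exp (rate * (s * x)) * apply_bcontfun \<Phi> (d, s * x) - exp (rate * (s * x)) * apply_bcontfun \<Psi> (d, s * x)\<bar>"
      using h_lip by simp
    also have "\<dots> = K * (exp (rate * (s * x)) * dist (apply_bcontfun \<Phi> (d, s * x)) (apply_bcontfun \<Psi> (d, s * x)))"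
      by (simp add: dist_real_def right_diff_distrib[symmetric] abs_mult)
    also have "\<dots> \<le> K * (exp (rate * (s * x)) * dist \<Phi> \<Psi>)"
      using K_nonneg by (intro mult_left_mono dist_bounded) auto
    finally show ?thesis by (simp add: mult_ac)
  qed
  have "\<bar>velocity (weighted \<Phi>) (d, s)
        - velocity (weighted \<Psi>) (d, s)\<bar>
      = \<bar>s * (integral {0..1} (?f \<Phi>) - integral {0..1} (?f \<Psi>))\<bar>"
    by (simp add: velocity_def weighted_def algebra_simps abs_minus_commute)
  also have "\<dots> = s * \<bar>integral {0..1} (\<lambda>x. ?f \<Phi> x - ?f \<Psi> x)\<bar>"
    using s i by (simp add: abs_mult integral_diff)
  also have "\<dots> \<le> s * integral {0..1} (\<lambda>x. K * dist \<Phi> \<Psi> * exp (rate * (s * x)))"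
    by (rule mult_left_mono[OF abs_integral_le_integral[OF integrable_diff[OF i i] _ pt] s])
      (auto intro!: integrable_continuous_interval continuous_intros)
  also have "\<dots> = K * dist \<Phi> \<Psi> * (s * integral {0..1} (\<lambda>x. exp (rate * (s * x))))"
    by simp
  also have "\<dots> \<le> K * dist \<Phi> \<Psi> * (exp (rate * s) / rate)"
    using K_nonneg by (intro mult_left_mono exp_mean_bound rate_pos s) auto
  finally show ?thesis by simp
qed

lemma position_weighted_lip:
  assumes r: "0 \<le> r"
  shows "\<bar>position (weighted \<Phi>) (d, r)
        - position (weighted \<Psi>) (d, r)\<bar>
      \<le> 1 / 2 * dist \<Phi> \<Psi> * exp (rate * r)"
proof -
  let ?m = "\<lambda>\<Phi> x. velocity (weighted \<Phi>) (d, r * x)"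
  let ?f = "\<lambda>\<Phi> x. slope d (?m \<Phi> x)"
  have c: "continuous_on S (?f \<Phi>)" for S \<Phi>
    by (intro continuous_intros continuous_on_compose2[OF velocity_cont[OF weighted_cont]]) auto
  have i: "?f \<Phi> integrable_on {0..1}" for \<Phi>
    by (intro integrable_continuous_interval c)
  have pt: "\<bar>?f \<Phi> x - ?f \<Psi> x\<bar> \<le> K / rate * dist \<Phi> \<Psi> * exp (rate * (r * x))" if x: "x \<in> {0..1}" for x
    using slope_lipschitz[of d "?m \<Phi> x" "?m \<Psi> x"] velocity_weighted_lip[of "r * x" \<Phi> d \<Psi>] r x by simp
  have "\<bar>position (weighted \<Phi>) (d, r)
        - position (weighted \<Psi>) (d, r)\<bar>
      = \<bar>r * (integral {0..1} (?f \<Phi>) - integral {0..1} (?f \<Psi>))\<bar>"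
    by (simp add: position_def algebra_simps)
  also have "\<dots> = r * \<bar>integral {0..1} (\<lambda>x. ?f \<Phi> x - ?f \<Psi> x)\<bar>"
    using r i by (simp add: abs_mult integral_diff)
  also have "\<dots> \<le> r * integral {0..1} (\<lambda>x. K / rate * dist \<Phi> \<Psi> * exp (rate * (r * x)))"
    using rate_pos
    by (intro mult_left_mono[OF abs_integral_le_integral[OF integrable_diff[OF i i] _ pt] r])
      (auto intro!: integrable_continuous_interval continuous_intros)
  also have "\<dots> = K / rate * dist \<Phi> \<Psi> * (r * integral {0..1} (\<lambda>x. exp (rate * (r * x))))"
    by simp
  also have "\<dots> \<le> K / rate * dist \<Phi> \<Psi> * (exp (rate * r) / rate)"
    using K_nonneg rate_pos by (intro mult_left_mono exp_mean_bound r) auto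
  also have "\<dots> = K / (rate * rate) * (dist \<Phi> \<Psi> * exp (rate * r))" by simp
  also have "\<dots> \<le> 1 / 2 * (dist \<Phi> \<Psi> * exp (rate * r))"
    by (intro mult_right_mono rate_large) auto
  finally show ?thesis by simp
qed

lemma picard_contraction: "dist (picard \<Phi>) (picard \<Psi>) \<le> 1 / 2 * dist \<Phi> \<Psi>"
proof (rule dist_bound)
  fix p
  obtain d r where p: "clip p = (d, r)" by (cases "clip p")
  then have r: "0 \<le> r" using clip_range by (metis (no_types) atLeastAtMost_iff mem_Sigma_iff rangeI subsetD)
  let ?P = "\<lambda>\<Phi>. position (weighted \<Phi>) (d, r)"
  have "dist (apply_bcontfun (picard \<Phi>) p) (apply_bcontfun (picard \<Psi>) p) = exp (- rate * r) * \<bar>?P \<Phi> - ?P \<Psi>\<bar>"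
    by (simp add: apply_step p dist_real_def right_diff_distrib[symmetric] abs_mult)
  also have "\<dots> \<le> exp (- rate * r) * (1 / 2 * dist \<Phi> \<Psi> * exp (rate * r))"
    by (intro mult_left_mono position_weighted_lip r) auto
  also have "\<dots> = 1 / 2 * dist \<Phi> \<Psi>" by (simp add: exp_minus)
  finally show "dist (apply_bcontfun (picard \<Phi>) p) (apply_bcontfun (picard \<Psi>) p) \<le> 1 / 2 * dist \<Phi> \<Psi>" .
qed

text \<open>
The fixed point of the contraction, with the weight taken off. Scaling the integrals back to
\<open>[0, r]\<close> makes the fundamental theorem of calculus applicable.
\<close>

theorem solution_family:
  obtains U Y where
    "continuous_on ({0..R} \<times> {0..R}) (\<lambda>p. U (fst p) (snd p))"
    "continuous_on ({0..R} \<times> {0..R}) (\<lambda>p. Y (fst p) (snd p))"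
    "\<And>d. d \<in> {0..R} \<Longrightarrow> U d 0 = 1"
    "\<And>d. d \<in> {0..R} \<Longrightarrow> Y d 0 = 0"
    "\<And>d r. d \<in> {0..R} \<Longrightarrow> r \<in> {0..R} \<Longrightarrow>
       (U d has_real_derivative slope d (Y d r)) (at r within {0..R})"
    "\<And>d r. d \<in> {0..R} \<Longrightarrow> r \<in> {0..R} \<Longrightarrow>
       ((\<lambda>s. s ^ (N - 1) * Y d s) has_real_derivative - (r ^ (N - 1) * h d r (U d r))) (at r within {0..R})"
proof -
  have "\<exists>!\<Phi>. picard \<Phi> = \<Phi>"
    by (rule banach_fix_type[where c = "1 / 2"]) (use picard_contraction in auto)
  then obtain \<Phi> where fixp: "picard \<Phi> = \<Phi>" by auto
  define f where "f = weighted \<Phi>"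
  have fc: "continuous_on UNIV f" unfolding f_def by (rule weighted_cont)
  have feq: "f (d, r) = position f (d, r)" if "d \<in> {0..R}" "r \<in> {0..R}" for d r
  proof -
    have "apply_bcontfun \<Phi> (d, r) = exp (- rate * r) * position f (d, r)"
      using apply_step[of \<Phi> "(d, r)"] that by (simp add: fixp clip_id f_def)
    then show ?thesis by (simp add: f_def weighted_def exp_minus)
  qed
  define U where "U = (\<lambda>d r. f (d, r))"
  define Y where "Y = (\<lambda>d r. velocity f (d, r))"
  have Yc: "continuous_on UNIV (Y d)" and Uc: "continuous_on UNIV (U d)" for d
    unfolding Y_def U_def
    by (intro continuous_on_compose2[OF velocity_cont[OF fc]] continuous_on_compose2[OF fc] continuous_intros; simp)+
  have hc: "continuous_on UNIV (\<lambda>x. h d x (U d x))" for d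
    by (intro continuous_on_h continuous_intros Uc)
  have Ueq: "U d r = 1 + integral {0..r} (\<lambda>s. slope d (Y d s))" if "d \<in> {0..R}" "r \<in> {0..R}" for d r
  proof -
    have "integral {0..r} (\<lambda>s. slope d (Y d s)) = r * integral {0..1} (\<lambda>x. slope d (Y d (r * x)))"
      using that by (intro integral_rescale_to_unit[symmetric] continuous_intros Yc) auto
    then show ?thesis using feq[OF that] by (simp add: U_def Y_def position_def)
  qed
  have Veq: "r ^ (N - 1) * Y d r = - integral {0..r} (\<lambda>s. s ^ (N - 1) * h d s (U d s))" if "r \<in> {0..R}" for d r
  proof -
    have "integral {0..r} (\<lambda>s. s ^ (N - 1) * h d s (U d s))
        = r * integral {0..1} (\<lambda>x. (r * x) ^ (N - 1) * h d (r * x) (U d (r * x)))"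
      using that hc by (intro integral_rescale_to_unit[symmetric] continuous_intros) auto
    also have "\<dots> = r ^ (N - 1) * (r * integral {0..1} (\<lambda>x. x ^ (N - 1) * h d (r * x) (U d (r * x))))"
      by (simp add: power_mult_distrib mult.assoc)
    finally show ?thesis by (simp add: Y_def velocity_def U_def)
  qed
  show ?thesis
  proof (rule that[of U Y])
    show "continuous_on ({0..R} \<times> {0..R}) (\<lambda>p. U (fst p) (snd p))"
      using continuous_on_subset[OF fc] by (simp add: U_def)
    show "continuous_on ({0..R} \<times> {0..R}) (\<lambda>p. Y (fst p) (snd p))"
      using continuous_on_subset[OF velocity_cont[OF fc]] by (simp add: Y_def)
    fix d assume d: "d \<in> {0..R}"
    show "U d 0 = 1" using Ueq[of d 0] d R_pos by simp
    show "Y d 0 = 0" by (simp add: Y_def velocity_def)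
    fix r assume r: "r \<in> {0..R}"
    have "((\<lambda>x. 1 + integral {0..x} (\<lambda>s. slope d (Y d s))) has_real_derivative slope d (Y d r)) (at r within {0..R})"
      using r by (auto intro!: derivative_eq_intros integral_has_real_derivative continuous_intros continuous_on_subset[OF Yc])
    then show "(U d has_real_derivative slope d (Y d r)) (at r within {0..R})"
      by (rule has_field_derivative_transform_within[OF _ zero_less_one r]) (use Ueq d in auto)
    have "((\<lambda>x. - integral {0..x} (\<lambda>s. s ^ (N - 1) * h d s (U d s))) has_real_derivative - (r ^ (N - 1) * h d r (U d r))) (at r within {0..R})"
      using r by (intro DERIV_minus integral_has_real_derivative continuous_intros continuous_on_subset[OF hc]) auto
    then show "((\<lambda>s. s ^ (N - 1) * Y d s) has_real_derivative - (r ^ (N - 1) * h d r (U d r))) (at r within {0..R})"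
      by (rule has_field_derivative_transform_within[OF _ zero_less_one r]) (use Veq in auto)
  qed
qed

end

section \<open>Counting simple zeros along a family of functions\<close>

text \<open>
Here \<open>a\<close> plays the number of zeros inside the interval and \<open>b\<close> the number that also counts the
right end point. Take for \<open>c l\<close> the infimum of the parameters with \<open>l \<le> a d\<close>. If \<open>l \<le> a (c l)\<close>,
lower semicontinuity of \<open>a\<close> would allow smaller parameters; if \<open>b (c l) < l\<close>, upper
semicontinuity of \<open>b\<close> would exclude parameters close to the infimum. So \<open>a (c l) < l \<le> b (c l)\<close>.
\<close>

lemma crossing_parameters:
  fixes a b :: "real \<Rightarrow> nat"
  assumes "p < m"
    and lsc: "\<And>d0. d0 \<in> {p..m} \<Longrightarrow> \<exists>e>0. \<forall>d\<in>{p..m}. \<bar>d - d0\<bar> < e \<longrightarrow> a d0 \<le> a d"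
    and usc: "\<And>d0. d0 \<in> {p..m} \<Longrightarrow> \<exists>e>0. \<forall>d\<in>{p..m}. \<bar>d - d0\<bar> < e \<longrightarrow> b d \<le> b d0"
    and ab: "\<And>d. d \<in> {p..m} \<Longrightarrow> a d \<le> b d" and ba: "\<And>d. d \<in> {p..m} \<Longrightarrow> b d \<le> a d + 1"
    and start: "b p \<le> k" and stop: "j \<le> a m"
  shows "\<exists>c. (\<forall>l\<in>{k+1..j}. p < c l \<and> c l < m \<and> a (c l) = l - 1 \<and> b (c l) = l)
           \<and> strict_mono_on {k+1..j} c"
proof -
  define S where "S l = {d \<in> {p..m}. l \<le> a d}" for l
  define c where "c l = Inf (S l)" for l
  have bdd: "bdd_below (S l)" for l by (auto simp: S_def intro!: bdd_belowI[of _ p])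
  have key: "p < c l \<and> c l < m \<and> a (c l) < l \<and> l \<le> b (c l)" if l: "l \<in> {k+1..j}" for l
  proof -
    have mS: "m \<in> S l" using l stop \<open>p < m\<close> by (simp add: S_def)
    have "c l \<le> m" unfolding c_def by (rule cInf_lower[OF mS bdd])
    moreover have "p \<le> c l" unfolding c_def
    proof (rule cInf_greatest)
      show "S l \<noteq> {}" using mS by blast
    qed (simp add: S_def)
    ultimately have c_in: "c l \<in> {p..m}" by simp
    have 1: "a (c l) < l"
    proof (rule ccontr)
      assume "\<not> a (c l) < l"
      then have "l \<le> a (c l)" by simp
      have "c l \<noteq> p" using ab[of p] start l \<open>p < m\<close> \<open>l \<le> a (c l)\<close> by auto
      obtain e where e: "e > 0" "\<And>d. d \<in> {p..m} \<Longrightarrow> \<bar>d - c l\<bar> < e \<Longrightarrow> a (c l) \<le> a d"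
        using lsc[OF c_in] by blast
      define d where "d = max p (c l - e / 2)"
      have d: "d \<in> {p..m}" "\<bar>d - c l\<bar> < e" "d < c l"
        using c_in \<open>c l \<noteq> p\<close> e(1) by (auto simp: d_def)
      then have "d \<in> S l" using e(2)[OF d(1,2)] \<open>l \<le> a (c l)\<close> by (simp add: S_def)
      then have "c l \<le> d" unfolding c_def by (rule cInf_lower[OF _ bdd])
      with d(3) show False by simp
    qed
    have 2: "l \<le> b (c l)"
    proof (rule ccontr)
      assume neg: "\<not> l \<le> b (c l)"
      obtain e where e: "e > 0" "\<And>d. d \<in> {p..m} \<Longrightarrow> \<bar>d - c l\<bar> < e \<Longrightarrow> b d \<le> b (c l)"
        using usc[OF c_in] by blast
      obtain d where d: "d \<in> S l" "d < c l + e"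
        using cInf_lessD[of "S l" "c l + e"] mS e(1) by (auto simp: c_def)
      have "c l \<le> d" unfolding c_def by (rule cInf_lower[OF d(1) bdd])
      then have "b d \<le> b (c l)" using e(2)[of d] d by (auto simp: S_def)
      with ab[of d] d(1) neg show False by (simp add: S_def)
    qed
    have "c l \<noteq> p" using 2 start l by auto
    moreover have "c l \<noteq> m" using 1 stop l by auto
    ultimately show ?thesis using 1 2 c_in by auto
  qed
  have eqs: "a (c l) = l - 1 \<and> b (c l) = l" if l: "l \<in> {k+1..j}" for l
    using key[OF l] ba[of "c l"] by auto
  moreover have "strict_mono_on {k+1..j} c"
  proof (rule strict_mono_onI)
    fix l l' assume l: "l \<in> {k+1..j}" "l' \<in> {k+1..j}" "l < l'"
    have "S l' \<noteq> {}" using l(2) stop \<open>p < m\<close> by (auto simp: S_def intro!: exI[of _ m])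
    moreover have "S l' \<subseteq> S l" using l by (auto simp: S_def)
    ultimately have "c l \<le> c l'" unfolding c_def by (rule cInf_superset_mono[OF _ bdd])
    moreover have "c l \<noteq> c l'" using eqs[OF l(1)] eqs[OF l(2)] l(3) by auto
    ultimately show "c l < c l'" by simp
  qed
  ultimately show ?thesis using key by blast
qed

text \<open>
The same for a count that decreases to the right, by the reflection \<open>d \<mapsto> - d\<close>.
\<close>

lemma crossing_parameters_down:
  fixes a b :: "real \<Rightarrow> nat"
  assumes "m < q"
    and lsc: "\<And>d0. d0 \<in> {m..q} \<Longrightarrow> \<exists>e>0. \<forall>d\<in>{m..q}. \<bar>d - d0\<bar> < e \<longrightarrow> a d0 \<le> a d"
    and usc: "\<And>d0. d0 \<in> {m..q} \<Longrightarrow> \<exists>e>0. \<forall>d\<in>{m..q}. \<bar>d - d0\<bar> < e \<longrightarrow> b d \<le> b d0"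
    and ab: "\<And>d. d \<in> {m..q} \<Longrightarrow> a d \<le> b d" and ba: "\<And>d. d \<in> {m..q} \<Longrightarrow> b d \<le> a d + 1"
    and start: "b q \<le> k" and stop: "j \<le> a m"
  shows "\<exists>c. (\<forall>l\<in>{k+1..j}. m < c l \<and> c l < q \<and> a (c l) = l - 1 \<and> b (c l) = l)
           \<and> strict_antimono_on {k+1..j} c"
proof -
  have mirror: "\<exists>e>0. \<forall>d\<in>{-q..-m}. \<bar>d - d0\<bar> < e \<longrightarrow> P (- d0) (- d)"
    if "\<exists>e>0. \<forall>d\<in>{m..q}. \<bar>d - (- d0)\<bar> < e \<longrightarrow> P (- d0) d" for P :: "real \<Rightarrow> real \<Rightarrow> bool" and d0
  proof -
    from that obtain e where e: "e > 0" "\<forall>d\<in>{m..q}. \<bar>d - (- d0)\<bar> < e \<longrightarrow> P (- d0) d"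
      by (elim exE conjE)
    show ?thesis
    proof (intro exI[of _ e] conjI ballI impI e(1))
      fix d assume d: "d \<in> {-q..-m}" "\<bar>d - d0\<bar> < e"
      have "- d \<in> {m..q}" "\<bar>- d - (- d0)\<bar> < e" using d by auto
      then show "P (- d0) (- d)" using e(2) by blast
    qed
  qed
  have "\<exists>c. (\<forall>l\<in>{k+1..j}. - q < c l \<and> c l < - m \<and> a (- c l) = l - 1 \<and> b (- c l) = l)
           \<and> strict_mono_on {k+1..j} c"
  proof (rule crossing_parameters[where a = "\<lambda>d. a (- d)" and b = "\<lambda>d. b (- d)"])
    fix d0 assume "d0 \<in> {-q..-m}"
    then have d0: "- d0 \<in> {m..q}" by auto
    show "\<exists>e>0. \<forall>d\<in>{-q..-m}. \<bar>d - d0\<bar> < e \<longrightarrow> a (- d0) \<le> a (- d)"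
      by (rule mirror[where P = "\<lambda>x y. a x \<le> a y", OF lsc[OF d0]])
    show "\<exists>e>0. \<forall>d\<in>{-q..-m}. \<bar>d - d0\<bar> < e \<longrightarrow> b (- d) \<le> b (- d0)"
      by (rule mirror[where P = "\<lambda>x y. b y \<le> b x", OF usc[OF d0]])
  next
    fix d assume "d \<in> {-q..-m}"
    then have d: "- d \<in> {m..q}" by auto
    show "a (- d) \<le> b (- d)" by (rule ab[OF d])
    show "b (- d) \<le> a (- d) + 1" by (rule ba[OF d])
  next
    show "- q < - m" using \<open>m < q\<close> by simp
    show "b (- (- q)) \<le> k" using start by simp
    show "j \<le> a (- (- m))" using stop by simp
  qed
  then obtain c where c: "\<forall>l\<in>{k+1..j}. - q < c l \<and> c l < - m \<and> a (- c l) = l - 1 \<and> b (- c l) = l"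
    and mono: "strict_mono_on {k+1..j} c" by (elim exE conjE)
  have "strict_antimono_on {k+1..j} (\<lambda>l. - c l)"
  proof (rule monotone_onI)
    fix x y assume "x \<in> {k+1..j}" "y \<in> {k+1..j}" "x < y"
    then have "c x < c y" by (rule strict_mono_onD[OF mono])
    then show "- c x > - c y" by simp
  qed
  moreover have "\<forall>l\<in>{k+1..j}. m < - c l \<and> - c l < q \<and> a (- c l) = l - 1 \<and> b (- c l) = l"
    using c by force
  ultimately show ?thesis by (intro exI[where x = "\<lambda>l. - c l"] conjI)
qed

locale simple_zero_family =
  fixes D :: "real set" and R :: real and U W :: "real \<Rightarrow> real \<Rightarrow> real"
  assumes R_pos: "0 < R"
    and U_cont: "continuous_on (D \<times> {0..R}) (\<lambda>p. U (fst p) (snd p))"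
    and W_cont: "continuous_on (D \<times> {0..R}) (\<lambda>p. W (fst p) (snd p))"
    and U_deriv: "d \<in> D \<Longrightarrow> r \<in> {0..R} \<Longrightarrow> (U d has_real_derivative W d r) (at r within {0..R})"
    and simple: "d \<in> D \<Longrightarrow> r \<in> {0..R} \<Longrightarrow> U d r = 0 \<Longrightarrow> W d r \<noteq> 0"
    and start: "d \<in> D \<Longrightarrow> U d 0 \<noteq> 0"
begin

definition inner_zeros :: "real \<Rightarrow> real set" where "inner_zeros d = {r \<in> {0<..<R}. U d r = 0}"
definition zeros :: "real \<Rightarrow> real set" where "zeros d = {r \<in> {0..R}. U d r = 0}"

lemma U_deriv_interior:
  assumes "d \<in> D" "0 < r" "r < R"
  shows "(U d has_real_derivative W d r) (at r)"
  using U_deriv[of d r] assms by (simp add: at_within_Icc_at)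

lemma nonvanishing_box:
  assumes G: "continuous_on (D \<times> {0..R}) (\<lambda>p. G (fst p) (snd p))"
    and d0: "d0 \<in> D" and r0: "r0 \<in> {0..R}" and nz: "G d0 r0 \<noteq> (0::real)"
  shows "\<exists>e>0. \<forall>d\<in>D. \<forall>r\<in>{0..R}. \<bar>d - d0\<bar> < e \<longrightarrow> \<bar>r - r0\<bar> < e \<longrightarrow> 0 < G d r * G d0 r0"
proof -
  obtain e where e: "e > 0" "\<And>p. p \<in> D \<times> {0..R} \<Longrightarrow> dist p (d0, r0) < e \<Longrightarrow>
      dist (G (fst p) (snd p)) (G d0 r0) < \<bar>G d0 r0\<bar>"
    using G[unfolded continuous_on_iff, rule_format, of "(d0, r0)" "\<bar>G d0 r0\<bar>"] d0 r0 nz by auto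
  show ?thesis
  proof (intro exI[of _ "e / 2"] conjI ballI impI)
    fix d r assume *: "d \<in> D" "r \<in> {0..R}" "\<bar>d - d0\<bar> < e / 2" "\<bar>r - r0\<bar> < e / 2"
    have "dist (d, r) (d0, r0) \<le> \<bar>d - d0\<bar> + \<bar>r - r0\<bar>"
      by (simp add: dist_prod_def dist_real_def sqrt_sum_squares_le_sum_abs)
    then have "dist (G d r) (G d0 r0) < \<bar>G d0 r0\<bar>" using e(2)[of "(d, r)"] * by auto
    then show "0 < G d r * G d0 r0" using nz
      by (auto simp: dist_real_def zero_less_mult_iff)
  qed (use e(1) in auto)
qed

text \<open>
Two zeros of the same function close to \<open>r0\<close> would enclose a zero of its derivative \<open>W\<close>, but
\<open>W\<close> is bounded away from \<open>0\<close> near a simple zero.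
\<close>

lemma zeros_locally_unique:
  assumes d0: "d0 \<in> D" and r0: "r0 \<in> {0..R}"
  shows "\<exists>e>0. \<forall>d\<in>D. \<bar>d - d0\<bar> < e \<longrightarrow>
     (\<forall>x\<in>zeros d. \<forall>y\<in>zeros d. \<bar>x - r0\<bar> < e \<longrightarrow> \<bar>y - r0\<bar> < e \<longrightarrow> x = y \<and> U d0 r0 = 0)"
proof (cases "U d0 r0 = 0")
  case False
  from nonvanishing_box[OF U_cont d0 r0 False] show ?thesis
    by (force simp: zeros_def)
next
  case True
  obtain e where e: "e > 0" "\<And>d r. d \<in> D \<Longrightarrow> r \<in> {0..R} \<Longrightarrow> \<bar>d - d0\<bar> < e \<Longrightarrow> \<bar>r - r0\<bar> < e \<Longrightarrow> 0 < W d r * W d0 r0"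
    using nonvanishing_box[OF W_cont d0 r0 simple[OF d0 r0 True]] by blast
  have no: False if *: "d \<in> D" "\<bar>d - d0\<bar> < e" "x \<in> zeros d" "y \<in> zeros d" "\<bar>x - r0\<bar> < e" "\<bar>y - r0\<bar> < e" "x < y" for d x y
  proof -
    have xy: "0 \<le> x" "y \<le> R" "U d x = 0" "U d y = 0" using * by (auto simp: zeros_def)
    obtain z where z: "x < z" "z < y" "U d y - U d x = (y - x) * W d z"
      using mvt_within[OF U_deriv[OF *(1)], of x y] xy *(7) by metis
    then have "W d z = 0" using xy *(7) by simp
    moreover have "0 < W d z * W d0 r0" using * xy z by (intro e(2)) auto
    ultimately show False by simp
  qed
  show ?thesis
  proof (intro exI[of _ e] conjI e(1) ballI impI True)
    fix d x y
    assume "d \<in> D" "\<bar>d - d0\<bar> < e" "x \<in> zeros d" "y \<in> zeros d" "\<bar>x - r0\<bar> < e" "\<bar>y - r0\<bar> < e"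
    then show "x = y" using no[of d x y] no[of d y x] by (cases x y rule: linorder_cases) blast+
  qed
qed

text \<open>
Cover the interval by finitely many neighbourhoods from the preceding lemma, with centres \<open>C\<close>.
For \<open>d\<close> near \<open>d0\<close> a neighbourhood contains at most one zero, and only if its centre is a zero
for \<open>d0\<close>; so the zeros for \<open>d\<close> inject into those centres. The intersection with the finite set
\<open>C\<close> is kept because, for \<open>d = d0\<close>, it yields that there are finitely many zeros at all.
\<close>

lemma zeros_usc_aux:
  assumes d0: "d0 \<in> D"
  shows "\<exists>C e. finite C \<and> 0 < e \<and> (\<forall>d\<in>D. \<bar>d - d0\<bar> < e \<longrightarrow>
     finite (zeros d) \<and> card (zeros d) \<le> card (C \<inter> zeros d0))"
proof -
  obtain e where e: "\<And>r. r \<in> {0..R} \<Longrightarrow> 0 < e r"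
    "\<And>r d x y. r \<in> {0..R} \<Longrightarrow> d \<in> D \<Longrightarrow> \<bar>d - d0\<bar> < e r \<Longrightarrow> x \<in> zeros d \<Longrightarrow> y \<in> zeros d \<Longrightarrow>
        \<bar>x - r\<bar> < e r \<Longrightarrow> \<bar>y - r\<bar> < e r \<Longrightarrow> x = y \<and> U d0 r = 0"
    using zeros_locally_unique[OF d0] by metis
  obtain C where C: "C \<subseteq> {0..R}" "finite C" "{0..R} \<subseteq> (\<Union>r\<in>C. ball r (e r))"
    by (rule compactE_image[of "{0..R}" "{0..R}" "\<lambda>r. ball r (e r)"]) (use e(1) in force)+
  have "C \<noteq> {}" using C(3) R_pos by auto
  define m where "m = Min (e ` C)"
  have m: "0 < m" unfolding m_def using C e(1) \<open>C \<noteq> {}\<close> by (subst Min_gr_iff) auto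
  have mle: "m \<le> e r" if "r \<in> C" for r unfolding m_def using C that by auto
  have "finite (zeros d) \<and> card (zeros d) \<le> card (C \<inter> zeros d0)" if d: "d \<in> D" "\<bar>d - d0\<bar> < m" for d
  proof -
    have "\<exists>r\<in>C. \<bar>x - r\<bar> < e r" if "x \<in> zeros d" for x
    proof -
      have "x \<in> {0..R}" using that by (simp add: zeros_def)
      then have "x \<in> (\<Union>r\<in>C. ball r (e r))" using C(3) by blast
      then show ?thesis by (auto simp: dist_real_def abs_minus_commute)
    qed
    then obtain f where f: "\<And>x. x \<in> zeros d \<Longrightarrow> f x \<in> C \<and> \<bar>x - f x\<bar> < e (f x)" by metis
    have near: "f x \<in> {0..R} \<and> \<bar>d - d0\<bar> < e (f x)" if "x \<in> zeros d" for x
      using f[OF that] d(2) mle[of "f x"] C(1) by (meson less_le_trans subsetD)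
    have inj: "inj_on f (zeros d)"
    proof (rule inj_onI)
      fix x y assume xy: "x \<in> zeros d" "y \<in> zeros d" "f x = f y"
      have "\<bar>y - f x\<bar> < e (f x)" using f[OF xy(2)] xy(3) by simp
      then show "x = y" using e(2)[OF _ d(1) _ xy(1,2)] near[OF xy(1)] f[OF xy(1)] by blast
    qed
    have sub: "f ` zeros d \<subseteq> C \<inter> zeros d0"
    proof (rule image_subsetI)
      fix x assume x: "x \<in> zeros d"
      have "U d0 (f x) = 0" using e(2)[OF _ d(1) _ x x] near[OF x] f[OF x] by blast
      then show "f x \<in> C \<inter> zeros d0" using near[OF x] f[OF x] by (simp add: zeros_def)
    qed
    show ?thesis
      using inj_on_finite[OF inj sub] card_inj_on_le[OF inj sub] C(2) by auto
  qed
  with C(2) m show ?thesis by blast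
qed

lemma finite_zeros: "d \<in> D \<Longrightarrow> finite (zeros d)"
  using zeros_usc_aux[of d] by (metis abs_zero diff_self)

lemma inner_zeros_subset: "inner_zeros d \<subseteq> zeros d"
  by (auto simp: inner_zeros_def zeros_def)

lemma finite_inner_zeros: "d \<in> D \<Longrightarrow> finite (inner_zeros d)"
  using finite_zeros inner_zeros_subset finite_subset by blast

lemma zeros_usc:
  assumes d0: "d0 \<in> D"
  shows "\<exists>e>0. \<forall>d\<in>D. \<bar>d - d0\<bar> < e \<longrightarrow> card (zeros d) \<le> card (zeros d0)"
proof -
  obtain C e where "finite C" "0 < e" and *: "\<And>d. d \<in> D \<Longrightarrow> \<bar>d - d0\<bar> < e \<Longrightarrow> card (zeros d) \<le> card (C \<inter> zeros d0)"
    using zeros_usc_aux[OF d0] by blast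
  moreover have "card (C \<inter> zeros d0) \<le> card (zeros d0)"
    by (rule card_mono[OF finite_zeros[OF d0]]) auto
  ultimately show ?thesis by (meson order_trans)
qed

text \<open>
A simple zero is a change of sign, and signs at two fixed points persist.
\<close>

lemma inner_zero_persists:
  assumes d0: "d0 \<in> D" and z: "z \<in> inner_zeros d0" and "0 < s"
  shows "\<exists>e>0. \<forall>d\<in>D. \<bar>d - d0\<bar> < e \<longrightarrow> (\<exists>x\<in>inner_zeros d. \<bar>x - z\<bar> < s)"
proof -
  have zz: "0 < z" "z < R" "U d0 z = 0" using z by (auto simp: inner_zeros_def)
  have W: "W d0 z \<noteq> 0" using simple[OF d0, of z] zz by auto
  have der: "(U d0 has_real_derivative W d0 z) (at z)" by (rule U_deriv_interior[OF d0 zz(1,2)])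
  obtain w where w: "w > 0" "\<And>h. 0 < h \<Longrightarrow> h < w \<Longrightarrow> U d0 (z - h) * U d0 (z + h) < 0"
  proof (cases "W d0 z > 0")
    case True
    obtain w1 w2 where "w1 > 0" "\<And>h. 0 < h \<Longrightarrow> h < w1 \<Longrightarrow> U d0 z < U d0 (z + h)"
      "w2 > 0" "\<And>h. 0 < h \<Longrightarrow> h < w2 \<Longrightarrow> U d0 (z - h) < U d0 z"
      using DERIV_pos_inc_right[OF der True] DERIV_pos_inc_left[OF der True] by metis
    then show ?thesis using zz(3) by (intro that[of "min w1 w2"]) (auto simp: mult_less_0_iff)
  next
    case False
    then have neg: "W d0 z < 0" using W by simp
    obtain w1 w2 where "w1 > 0" "\<And>h. 0 < h \<Longrightarrow> h < w1 \<Longrightarrow> U d0 z > U d0 (z + h)"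
      "w2 > 0" "\<And>h. 0 < h \<Longrightarrow> h < w2 \<Longrightarrow> U d0 (z - h) > U d0 z"
      using DERIV_neg_dec_right[OF der neg] DERIV_neg_dec_left[OF der neg] by metis
    then show ?thesis using zz(3) by (intro that[of "min w1 w2"]) (auto simp: mult_less_0_iff)
  qed
  define t where "t = min (min w s) (min z (R - z))"
  have t: "0 < t" "t \<le> w" "t \<le> s" "t \<le> z" "t \<le> R - z"
    unfolding t_def using w(1) \<open>0 < s\<close> zz by simp_all
  define h where "h = t / 2"
  have h: "0 < h" "h < w" "h < s" "h < z" "z + h < R"
    unfolding h_def using t by linarith+
  have opp: "U d0 (z - h) * U d0 (z + h) < 0" using w(2) h by blast
  have nz: "U d0 (z - h) \<noteq> 0" "U d0 (z + h) \<noteq> 0" using opp by auto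
  have in1: "z - h \<in> {0..R}" "z + h \<in> {0..R}" using h zz by auto
  obtain e1 where e1: "e1 > 0" "\<And>d. d \<in> D \<Longrightarrow> \<bar>d - d0\<bar> < e1 \<Longrightarrow> 0 < U d (z - h) * U d0 (z - h)"
    using nonvanishing_box[OF U_cont d0 in1(1) nz(1)] in1(1) by (metis abs_zero diff_self)
  obtain e2 where e2: "e2 > 0" "\<And>d. d \<in> D \<Longrightarrow> \<bar>d - d0\<bar> < e2 \<Longrightarrow> 0 < U d (z + h) * U d0 (z + h)"
    using nonvanishing_box[OF U_cont d0 in1(2) nz(2)] in1(2) by (metis abs_zero diff_self)
  have "\<exists>x\<in>inner_zeros d. \<bar>x - z\<bar> < s" if d: "d \<in> D" "\<bar>d - d0\<bar> < min e1 e2" for d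
  proof -
    have sg: "U d (z - h) * U d (z + h) < 0"
      using e1(2)[of d] e2(2)[of d] d opp by (auto simp: mult_less_0_iff zero_less_mult_iff)
    have cont: "continuous_on {z - h..z + h} (U d)"
    proof (intro continuous_at_imp_continuous_on ballI DERIV_isCont)
      fix x assume "x \<in> {z - h..z + h}"
      then show "(U d has_real_derivative W d x) (at x)"
        using h by (intro U_deriv_interior[OF d(1)]) auto
    qed
    have "\<exists>x. z - h \<le> x \<and> x \<le> z + h \<and> U d x = 0"
    proof (cases "U d (z - h) < 0")
      case True
      then have "0 < U d (z + h)" using sg by (auto simp: mult_less_0_iff)
      then show ?thesis using True cont h by (intro IVT') auto
    next
      case False
      then have "0 < U d (z - h)" "U d (z + h) < 0" using sg by (auto simp: mult_less_0_iff)
      then show ?thesis using cont h by (intro IVT2') auto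
    qed
    then obtain x where "z - h \<le> x" "x \<le> z + h" "U d x = 0" by blast
    then show ?thesis using h by (intro bexI[of _ x]) (auto simp: inner_zeros_def)
  qed
  then show ?thesis using e1(1) e2(1) by (metis min_less_iff_conj)
qed

lemma inner_zeros_lsc:
  assumes d0: "d0 \<in> D"
  shows "\<exists>e>0. \<forall>d\<in>D. \<bar>d - d0\<bar> < e \<longrightarrow> card (inner_zeros d0) \<le> card (inner_zeros d)"
proof -
  let ?Z = "inner_zeros d0"
  obtain s where s: "s > 0" "\<And>x y. x \<in> ?Z \<Longrightarrow> y \<in> ?Z \<Longrightarrow> x \<noteq> y \<Longrightarrow> s \<le> \<bar>x - y\<bar>"
    using finite_separated[OF finite_inner_zeros[OF d0]] by blast
  obtain e where e: "\<And>z. z \<in> ?Z \<Longrightarrow> e z > 0"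
    "\<And>z d. z \<in> ?Z \<Longrightarrow> d \<in> D \<Longrightarrow> \<bar>d - d0\<bar> < e z \<Longrightarrow> \<exists>x\<in>inner_zeros d. \<bar>x - z\<bar> < s / 2"
    using inner_zero_persists[OF d0, of _ "s / 2"] s(1) by (metis half_gt_zero)
  define m where "m = Min (insert 1 (e ` ?Z))"
  have m: "0 < m" unfolding m_def using finite_inner_zeros[OF d0] e(1) by (subst Min_gr_iff) auto
  have mle: "m \<le> e z" if "z \<in> ?Z" for z unfolding m_def using finite_inner_zeros[OF d0] that by auto
  have "card ?Z \<le> card (inner_zeros d)" if d: "d \<in> D" "\<bar>d - d0\<bar> < m" for d
  proof -
    have "\<exists>x\<in>inner_zeros d. \<bar>x - z\<bar> < s / 2" if "z \<in> ?Z" for z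
      using e(2)[OF that d(1)] mle[OF that] d(2) by linarith
    then obtain f where f: "\<And>z. z \<in> ?Z \<Longrightarrow> f z \<in> inner_zeros d \<and> \<bar>f z - z\<bar> < s / 2" by metis
    have "inj_on f ?Z"
    proof (rule inj_onI, rule ccontr)
      fix x y assume xy: "x \<in> ?Z" "y \<in> ?Z" "f x = f y" "x \<noteq> y"
      show False using f[OF xy(1)] f[OF xy(2)] s(2)[OF xy(1,2,4)] xy(3) by linarith
    qed
    then show ?thesis
      by (rule card_inj_on_le) (use f finite_inner_zeros[OF d(1)] in auto)
  qed
  with m show ?thesis by blast
qed

lemma zeros_eq:
  assumes "d \<in> D"
  shows "zeros d = (if U d R = 0 then insert R (inner_zeros d) else inner_zeros d)"
proof -
  have "r \<noteq> 0" if "U d r = 0" for r using start[OF assms] that by metis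
  then have "r \<in> zeros d \<longleftrightarrow> r \<in> inner_zeros d \<or> (r = R \<and> U d R = 0)" for r
    using R_pos by (cases "r = R") (auto simp: zeros_def inner_zeros_def less_le)
  then show ?thesis by auto
qed

lemma card_zeros:
  assumes "d \<in> D"
  shows "card (zeros d) = card (inner_zeros d) + (if U d R = 0 then 1 else 0)"
  using zeros_eq[OF assms] finite_inner_zeros[OF assms] by (auto simp: inner_zeros_def)

text \<open>
At a parameter where \<open>l - 1\<close> zeros lie inside and \<open>l\<close> zeros in the closed interval, the
additional zero can only be the right end point.
\<close>

theorem nodal_parameters:
  assumes D: "D = {p..q}" and m: "p < m" "m < q"
    and few: "card (zeros p) \<le> k" and none: "zeros q = {}" and many: "j \<le> card (inner_zeros m)"
  obtains cs cl where
    "\<And>l. l \<in> {k+1..j} \<Longrightarrow> p < cs l \<and> cs l < m \<and> card (inner_zeros (cs l)) = l - 1 \<and> U (cs l) R = 0"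
    "\<And>l. l \<in> {1..j} \<Longrightarrow> m < cl l \<and> cl l < q \<and> card (inner_zeros (cl l)) = l - 1 \<and> U (cl l) R = 0"
    "strict_mono_on {k+1..j} cs" "strict_antimono_on {1..j} cl"
proof -
  have ab: "card (inner_zeros d) \<le> card (zeros d)" "card (zeros d) \<le> card (inner_zeros d) + 1"
    if "d \<in> D" for d using card_zeros[OF that] by auto
  have low: "{p..m} \<subseteq> D" and high: "{m..q} \<subseteq> D" using D m by auto
  have lsc: "\<exists>e>0. \<forall>d\<in>A. \<bar>d - d0\<bar> < e \<longrightarrow> card (inner_zeros d0) \<le> card (inner_zeros d)"
    if "A \<subseteq> D" "d0 \<in> A" for A d0
    using inner_zeros_lsc[of d0] that by (meson subsetD)
  have usc: "\<exists>e>0. \<forall>d\<in>A. \<bar>d - d0\<bar> < e \<longrightarrow> card (zeros d) \<le> card (zeros d0)"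
    if "A \<subseteq> D" "d0 \<in> A" for A d0
    using zeros_usc[of d0] that by (meson subsetD)
  have "\<exists>c. (\<forall>l\<in>{k+1..j}. p < c l \<and> c l < m \<and> card (inner_zeros (c l)) = l - 1 \<and> card (zeros (c l)) = l)
      \<and> strict_mono_on {k+1..j} c"
    by (rule crossing_parameters[OF m(1) lsc[OF low] usc[OF low] ab(1)[OF subsetD[OF low]]
          ab(2)[OF subsetD[OF low]] few many])
  then obtain cs where cs: "\<forall>l\<in>{k+1..j}. p < cs l \<and> cs l < m \<and> card (inner_zeros (cs l)) = l - 1 \<and> card (zeros (cs l)) = l"
     "strict_mono_on {k+1..j} cs"
    by blast
  have none': "card (zeros q) \<le> 0" using none by simp
  have "\<exists>c. (\<forall>l\<in>{0+1..j}. m < c l \<and> c l < q \<and> card (inner_zeros (c l)) = l - 1 \<and> card (zeros (c l)) = l)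
      \<and> strict_antimono_on {0+1..j} c"
    by (rule crossing_parameters_down[OF m(2) lsc[OF high] usc[OF high] ab(1)[OF subsetD[OF high]]
          ab(2)[OF subsetD[OF high]] none' many])
  then obtain cl where "\<forall>l\<in>{0+1..j}. m < cl l \<and> cl l < q \<and> card (inner_zeros (cl l)) = l - 1 \<and> card (zeros (cl l)) = l"
     "strict_antimono_on {0+1..j} cl"
    by blast
  then have cl: "\<forall>l\<in>{1..j}. m < cl l \<and> cl l < q \<and> card (inner_zeros (cl l)) = l - 1 \<and> card (zeros (cl l)) = l"
     "strict_antimono_on {1..j} cl" by simp_all
  have R0: "U d R = 0" if "d \<in> D" "l \<ge> 1" "card (inner_zeros d) = l - 1" "card (zeros d) = l" for d l
    using card_zeros[OF that(1)] that by (auto split: if_splits)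
  show ?thesis
  proof (rule that[OF _ _ cs(2) cl(2)])
    fix l assume l: "l \<in> {k+1..j}"
    then show "p < cs l \<and> cs l < m \<and> card (inner_zeros (cs l)) = l - 1 \<and> U (cs l) R = 0"
      using cs(1) R0[of "cs l" l] D m by fastforce
  next
    fix l assume l: "l \<in> {1..j}"
    then show "m < cl l \<and> cl l < q \<and> card (inner_zeros (cl l)) = l - 1 \<and> U (cl l) R = 0"
      using cl(1) R0[of "cl l" l] D m by fastforce
  qed
qed

end

section \<open>Oscillation under strong forcing\<close>

text \<open>
For large \<open>mu\<close> the forcing is comparable to \<open>mu\<close> times a function of the position. All bounds
below hold with constants that do not depend on \<open>mu\<close>; in the application \<open>n = N - 1\<close>.
\<close>

locale oscillation =
  fixes n :: nat and b c :: real and low :: "real \<Rightarrow> real"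
  assumes n_pos: "1 \<le> n" and b_pos: "0 < b" and c_pos: "0 < c"
    and low_mono: "0 \<le> x \<Longrightarrow> x \<le> y \<Longrightarrow> low x \<le> low y"
    and low_pos: "0 < x \<Longrightarrow> 0 < low x"
begin

text \<open>
Position \<open>u\<close>, momentum \<open>v\<close> and forcing \<open>p\<close>. The conditions are invariant under a simultaneous
change of sign of the three, so that only excursions to the positive side need to be studied.
\<close>

definition flow :: "real \<Rightarrow> (real \<Rightarrow> real) \<Rightarrow> (real \<Rightarrow> real) \<Rightarrow> (real \<Rightarrow> real) \<Rightarrow> bool" where
  "flow mu u v p \<longleftrightarrow> (\<forall>r\<in>{0..b}.
     (u has_real_derivative slope 1 (v r / r ^ n)) (at r within {0..b}) \<and>
     (v has_real_derivative - (r ^ n * p r)) (at r within {0..b}) \<and>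
     (0 < u r \<longrightarrow> mu * low (u r) \<le> p r \<and> p r \<le> c * mu * u r) \<and>
     (u r < 0 \<longrightarrow> mu * low (- u r) \<le> - p r \<and> - p r \<le> - (c * mu * u r)))"

text \<open>
State at the beginning of a positive excursion. Position and momentum, the latter in units of
\<open>s ^ n * mu\<close>, are at most \<open>\<eta>\<close>, which limits the height of the excursion; one of them is not
negligible, as measured by \<open>\<kappa>\<close>, which keeps the excursion from degenerating as \<open>mu\<close> grows.
\<close>

definition entry :: "real \<Rightarrow> real \<Rightarrow> real \<Rightarrow> (real \<Rightarrow> real) \<Rightarrow> (real \<Rightarrow> real) \<Rightarrow> real \<Rightarrow> bool" where
  "entry mu \<eta> \<kappa> u v s \<longleftrightarrow> 0 \<le> u s \<and> u s \<le> \<eta> \<and> 0 \<le> v s \<and> v s \<le> \<eta> * s ^ n * mu \<and>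
     (\<kappa> \<le> u s \<or> \<kappa> * mu \<le> v s)"

text \<open>
The bounds on the momentum at the return \<open>e\<close> say that the reflected state is again an \<open>entry\<close>,
with constants \<open>\<eta>'\<close> and \<open>\<kappa>'\<close>.
\<close>

definition returns :: "real \<Rightarrow> real \<Rightarrow> real \<Rightarrow> real \<Rightarrow> real \<Rightarrow> real \<Rightarrow> bool" where
  "returns T \<eta> \<kappa> \<eta>' \<kappa>' mu \<longleftrightarrow> (\<forall>u v p s. flow mu u v p \<and> 0 \<le> s \<and> s + T \<le> b \<and> entry mu \<eta> \<kappa> u v s \<longrightarrow>
     (\<exists>e. s < e \<and> e \<le> s + T \<and> u e = 0 \<and> \<kappa>' * mu \<le> - v e \<and> - v e \<le> \<eta>' * e ^ n * mu))"

definition oscillates :: "real \<Rightarrow> real \<Rightarrow> real \<Rightarrow> nat \<Rightarrow> real \<Rightarrow> bool" where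
  "oscillates T \<eta> \<kappa> j mu \<longleftrightarrow> (\<forall>u v p s. flow mu u v p \<and> 0 \<le> s \<and> s + T \<le> b \<and> entry mu \<eta> \<kappa> u v s \<longrightarrow>
     (\<exists>Z \<subseteq> {s<..<s + T}. finite Z \<and> card Z = j \<and> (\<forall>z\<in>Z. u z = 0)))"

lemma flow_minus:
  assumes "flow mu u v p"
  shows "flow mu (\<lambda>r. - u r) (\<lambda>r. - v r) (\<lambda>r. - p r)"
  unfolding flow_def
proof
  fix r assume r: "r \<in> {0..b}"
  have *: "(u has_real_derivative slope 1 (v r / r ^ n)) (at r within {0..b})"
     "(v has_real_derivative - (r ^ n * p r)) (at r within {0..b})"
     "0 < u r \<longrightarrow> mu * low (u r) \<le> p r \<and> p r \<le> c * mu * u r"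
     "u r < 0 \<longrightarrow> mu * low (- u r) \<le> - p r \<and> - p r \<le> - (c * mu * u r)"
    using assms r unfolding flow_def by blast+
  show "((\<lambda>r. - u r) has_real_derivative slope 1 (- v r / r ^ n)) (at r within {0..b}) \<and>
     ((\<lambda>r. - v r) has_real_derivative - (r ^ n * - p r)) (at r within {0..b}) \<and>
     (0 < - u r \<longrightarrow> mu * low (- u r) \<le> - p r \<and> - p r \<le> c * mu * - u r) \<and>
     (- u r < 0 \<longrightarrow> mu * low (- (- u r)) \<le> - (- p r) \<and> - (- p r) \<le> - (c * mu * - u r))"
    using DERIV_minus[OF *(1)] DERIV_minus[OF *(2)] *(3,4) by simp
qed

context
  fixes mu :: real and u v p :: "real \<Rightarrow> real"
  assumes fl: "flow mu u v p" and mu_pos: "0 < mu"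
begin

lemma u_der: "r \<in> {0..b} \<Longrightarrow> (u has_real_derivative slope 1 (v r / r ^ n)) (at r within {0..b})"
  and v_der: "r \<in> {0..b} \<Longrightarrow> (v has_real_derivative - (r ^ n * p r)) (at r within {0..b})"
  and p_bounds: "r \<in> {0..b} \<Longrightarrow> 0 < u r \<Longrightarrow> mu * low (u r) \<le> p r \<and> p r \<le> c * mu * u r"
  using fl unfolding flow_def by blast+

lemma u_cont: "continuous_on {0..b} u" and v_cont: "continuous_on {0..b} v"
  using u_der v_der
  by (intro continuous_on_eq_continuous_within[THEN iffD2]; blast intro: DERIV_continuous)+

lemma u_speed:
  assumes "0 \<le> s" "s \<le> t" "t \<le> b"
  shows "\<bar>u t - u s\<bar> \<le> t - s"
proof (cases "s = t")
  case False
  then obtain x where "u t - u s = (t - s) * slope 1 (v x / x ^ n)"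
    using mvt_within[OF u_der, of s t] assms by (metis less_le)
  then have "\<bar>u t - u s\<bar> = (t - s) * \<bar>slope 1 (v x / x ^ n)\<bar>" using assms by (simp add: abs_mult)
  also have "\<dots> \<le> (t - s) * 1"
    using assms abs_slope_one_less[of "v x / x ^ n"] by (intro mult_left_mono) auto
  finally show ?thesis by simp
qed simp

lemma u_incr:
  assumes "0 \<le> s" "s \<le> t" "t \<le> b" "\<And>r. s < r \<Longrightarrow> r < t \<Longrightarrow> 0 \<le> v r"
  shows "u s \<le> u t"
proof (cases "s = t")
  case False
  then obtain x where x: "s < x" "x < t" "u t - u s = (t - s) * slope 1 (v x / x ^ n)"
    using mvt_within[OF u_der, of s t] assms by (metis less_le)
  then have "0 \<le> slope 1 (v x / x ^ n)" using assms by (intro slope_nonneg) auto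
  then have "0 \<le> u t - u s" using x(3) assms by simp
  then show ?thesis by simp
qed simp

lemma u_decr:
  assumes "0 \<le> s" "s \<le> t" "t \<le> b" "\<And>r. s < r \<Longrightarrow> r < t \<Longrightarrow> v r \<le> 0"
  shows "u t \<le> u s"
proof (cases "s = t")
  case False
  then obtain x where x: "s < x" "x < t" "u t - u s = (t - s) * slope 1 (v x / x ^ n)"
    using mvt_within[OF u_der, of s t] assms by (metis less_le)
  then have "0 \<le> slope 1 (- v x / x ^ n)"
    using assms by (intro slope_nonneg divide_nonneg_nonneg) auto
  then have "slope 1 (v x / x ^ n) \<le> 0" by simp
  then have "u t - u s \<le> 0" using x(3) assms by (simp add: mult_nonneg_nonpos)
  then show ?thesis by simp
qed simp

lemma u_fast_decr:
  assumes "0 \<le> s" "s < t" "t \<le> b" "\<And>r. s < r \<Longrightarrow> r < t \<Longrightarrow> v r \<le> - (r ^ n)"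
  shows "u t \<le> u s - (t - s) / 2"
proof -
  obtain x where x: "s < x" "x < t" "u t - u s = (t - s) * slope 1 (v x / x ^ n)"
    using mvt_within[OF u_der, of s t] assms by metis
  have "0 < x ^ n" using x assms by simp
  then have "1 \<le> - v x / x ^ n" using assms(4)[OF x(1,2)] by (simp add: field_simps)
  then have "1 / 2 \<le> slope 1 (- v x / x ^ n)" by (rule slope_one_ge_half)
  then have "slope 1 (v x / x ^ n) \<le> - (1 / 2)" by simp
  then have "(t - s) * slope 1 (v x / x ^ n) \<le> (t - s) * (- (1 / 2))"
    using assms by (intro mult_left_mono) auto
  then show ?thesis using x(3) by simp
qed

lemma v_drop_ge:
  assumes "0 \<le> s" "s \<le> t" "t \<le> b" "0 < a" "\<And>r. s < r \<Longrightarrow> r < t \<Longrightarrow> a \<le> u r"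
  shows "mu * low a * s ^ n * (t - s) \<le> v s - v t"
proof (cases "s = t")
  case False
  then obtain x where x: "s < x" "x < t" "v t - v s = (t - s) * - (x ^ n * p x)"
    using mvt_within[OF v_der, of s t] assms by (metis less_le)
  have a: "a \<le> u x" using x assms(5) by blast
  have "mu * low a \<le> mu * low (u x)" using a assms(4) mu_pos low_mono by simp
  also have "\<dots> \<le> p x" using p_bounds[of x] x assms a by auto
  finally have "mu * low a \<le> p x" .
  then have "s ^ n * (mu * low a) \<le> x ^ n * p x"
    using x assms mu_pos low_pos[OF assms(4)] by (intro mult_mono power_mono) auto
  then have "(t - s) * (s ^ n * (mu * low a)) \<le> (t - s) * (x ^ n * p x)"
    using assms by (intro mult_left_mono) auto
  then show ?thesis using x(3) by (simp add: mult_ac)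
qed simp

lemma v_drop_le:
  assumes "0 \<le> s" "s \<le> t" "t \<le> b" "0 \<le> a" "\<And>r. s < r \<Longrightarrow> r < t \<Longrightarrow> 0 < u r \<and> u r \<le> a"
  shows "v s - v t \<le> t ^ n * (c * mu * a) * (t - s)"
proof (cases "s = t")
  case False
  then obtain x where x: "s < x" "x < t" "v t - v s = (t - s) * - (x ^ n * p x)"
    using mvt_within[OF v_der, of s t] assms by (metis less_le)
  have a: "0 < u x" "u x \<le> a" using x assms(5) by blast+
  have "p x \<le> c * mu * u x" using p_bounds[of x] x assms a by auto
  also have "\<dots> \<le> c * mu * a" using a c_pos mu_pos by simp
  finally have "p x \<le> c * mu * a" .
  then have "x ^ n * p x \<le> x ^ n * (c * mu * a)" using x assms by (intro mult_left_mono) auto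
  also have "\<dots> \<le> t ^ n * (c * mu * a)"
    using x assms c_pos mu_pos by (intro mult_right_mono power_mono) auto
  finally have "(t - s) * (x ^ n * p x) \<le> (t - s) * (t ^ n * (c * mu * a))"
    using assms by (intro mult_left_mono) auto
  then show ?thesis using x(3) by (simp add: mult_ac)
qed simp

lemma v_strict_decr:
  assumes "0 \<le> s" "s < t" "t \<le> b" "\<And>r. s < r \<Longrightarrow> r < t \<Longrightarrow> 0 < u r"
  shows "v t < v s"
proof -
  obtain x where x: "s < x" "x < t" "v t - v s = (t - s) * - (x ^ n * p x)"
    using mvt_within[OF v_der, of s t] assms by metis
  have "0 < mu * low (u x)" using assms(4)[OF x(1,2)] low_pos mu_pos by simp
  also have "\<dots> \<le> p x" using p_bounds[of x] x assms by auto
  finally have "0 < (t - s) * (x ^ n * p x)" using x assms by simp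
  then show ?thesis using x(3) by simp
qed

lemma positive_exit:
  assumes s: "0 \<le> s" "s < t" "t \<le> b" and start: "0 < u s \<or> (u s = 0 \<and> 0 < v s \<and> 0 < s)"
  obtains e where "s < e" "e \<le> t" "\<And>r. s < r \<Longrightarrow> r < e \<Longrightarrow> 0 < u r" "0 \<le> u e" "u e = 0 \<or> e = t"
proof -
  have "\<exists>w>s. w \<le> t \<and> (\<forall>r. s < r \<longrightarrow> r \<le> w \<longrightarrow> 0 < u r)"
  proof (cases "0 < u s")
    case True
    define w where "w = min t (s + u s / 2)"
    have "0 < u r" if "s < r" "r \<le> w" for r
      using u_speed[of s r] that s True by (auto simp: w_def)
    then show ?thesis using True s by (intro exI[of _ w]) (auto simp: w_def)
  next
    case False
    then have st: "u s = 0" "0 < v s" "0 < s" using start by auto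
    have "0 < v s / s ^ n" using st by simp
    then have "0 < slope 1 (v s / s ^ n)" using slope_nonneg[of "v s / s ^ n" 1] by (metis less_le slope_eq_0_iff)
    moreover have "(u has_real_derivative slope 1 (v s / s ^ n)) (at s)"
      using u_der[of s] st s by (simp add: at_within_Icc_at)
    ultimately obtain w where w: "w > 0" "\<And>h. 0 < h \<Longrightarrow> h < w \<Longrightarrow> u s < u (s + h)"
      using DERIV_pos_inc_right by metis
    define x where "x = min t (s + w / 2)"
    have "0 < u r" if "s < r" "r \<le> x" for r
      using w(2)[of "r - s"] that st w(1) by (auto simp: x_def)
    then show ?thesis using w(1) s by (intro exI[of _ x]) (auto simp: x_def)
  qed
  then obtain w where w: "s < w" "w \<le> t" "\<And>r. s < r \<Longrightarrow> r \<le> w \<Longrightarrow> 0 < u r" by blast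
  show ?thesis
  proof (cases "\<exists>r\<in>{w..t}. u r \<le> 0")
    case False
    have "0 < u r" if "s < r" "r \<le> t" for r
      using w(3)[of r] False that by (cases "r \<le> w") (auto simp: not_le)
    then show ?thesis using s by (intro that[of t]) (auto intro: less_imp_le)
  next
    case True
    have c: "continuous_on {w..t} u" by (rule continuous_on_subset[OF u_cont]) (use w s in auto)
    define S where "S = {r \<in> {w..t}. u r \<le> 0}"
    have "closed S" unfolding S_def
      using continuous_closed_preimage[OF c, of "{..0}"] by (simp add: vimage_def Int_def)
    moreover have "S \<noteq> {}" using True by (auto simp: S_def)
    moreover have bdd: "bdd_below S" by (auto simp: S_def intro!: bdd_belowI[of _ w])
    ultimately have inS: "Inf S \<in> S" by (intro closed_contains_Inf)
    have pos: "0 < u r" if "s < r" "r < Inf S" for r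
    proof (cases "r \<le> w")
      case False
      show ?thesis
      proof (rule ccontr)
        assume "\<not> 0 < u r"
        then have "r \<in> S" using False that inS by (auto simp: S_def)
        then have "Inf S \<le> r" by (rule cInf_lower[OF _ bdd])
        with that show False by simp
      qed
    qed (use w(3) that in simp)
    have le: "u (Inf S) \<le> 0" "w \<le> Inf S" "Inf S \<le> t" using inS by (auto simp: S_def)
    have "\<not> u (Inf S) < 0"
    proof
      assume neg: "u (Inf S) < 0"
      have "continuous_on {w..Inf S} u" by (rule continuous_on_subset[OF c]) (use le in auto)
      then obtain x where x: "w \<le> x" "x \<le> Inf S" "u x = 0"
        using IVT2'[of u "Inf S" 0 w] neg w(3)[of w] w(1) le by auto
      then have "x \<in> S" using le by (auto simp: S_def)
      then have "Inf S \<le> x" by (rule cInf_lower[OF _ bdd])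
      then have "x = Inf S" using x by simp
      with x neg show False by simp
    qed
    then show ?thesis using le w pos by (intro that[of "Inf S"]) auto
  qed
qed

end

text \<open>
One excursion. Let \<open>m\<close> be the time of its highest point.

Upper bound on the height: if \<open>u\<close> reaches \<open>A\<close>, then, unless it started above \<open>A / 2\<close>, it has
been above \<open>A / 2\<close> for the time \<open>A / 2\<close> before, as the speed is below \<open>1\<close>, and this consumes momentum of order \<open>mu * low (A / 2) * A\<close>, more
than the initial momentum \<open>\<eta> * s ^ n * mu\<close> if \<open>\<eta>\<close> is small. Because \<open>r ^ n\<close> increases, the factor
\<open>s ^ n\<close> cancels. Lower bound: the initial momentum \<open>\<kappa> * mu\<close> has to be consumed by a forcing at most
\<open>c * mu\<close> times the height. The momentum gained on the way down obeys the corresponding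
bounds, and this gives \<open>\<kappa>'\<close> and \<open>\<eta>'\<close>.

Time: as long as the momentum exceeds \<open>r ^ n\<close> in absolute value, the speed is at least \<open>1 / 2\<close>, so
those phases last at most twice the height; in the remaining phase the position is
bounded below and the forcing of order \<open>mu\<close> carries the momentum through \<open>0\<close> quickly.
\<close>

theorem hump:
  assumes T: "0 < T" and eta': "0 < \<eta>'"
  shows "\<exists>\<eta>>0. \<forall>\<kappa>>0. \<exists>\<kappa>'>0. \<exists>M\<ge>1. \<forall>mu>M. returns T \<eta> \<kappa> \<eta>' \<kappa>' mu"
proof -
  define A where "A = min (T / 32) (\<eta>' / (c * T))"
  have A: "0 < A" "A \<le> T / 32" "c * A * T \<le> \<eta>'"
  proof -
    show "0 < A" using T eta' c_pos by (simp add: A_def)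
    show "A \<le> T / 32" unfolding A_def by (rule min.cobounded1)
    have "A \<le> \<eta>' / (c * T)" unfolding A_def by (rule min.cobounded2)
    moreover have "0 < c * T" using T c_pos by simp
    ultimately have "A * (c * T) \<le> \<eta>'" by (simp only: pos_le_divide_eq)
    then show "c * A * T \<le> \<eta>'" by (simp only: mult_ac)
  qed
  define \<eta> where "\<eta> = min (A / 2) (low (A / 2) * A / 4)"
  have lowA: "0 < low (A / 2)" using A low_pos by simp
  have eta: "0 < \<eta>" "\<eta> \<le> A / 2" "\<eta> < low (A / 2) * (A / 2)"
  proof -
    have "0 < low (A / 2) * A" using A lowA by simp
    moreover have "\<eta> \<le> low (A / 2) * A / 4" unfolding \<eta>_def by (rule min.cobounded2)
    ultimately show "\<eta> < low (A / 2) * (A / 2)" by linarith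
    show "0 < \<eta>" unfolding \<eta>_def using \<open>0 < low (A / 2) * A\<close> A(1) by simp
    show "\<eta> \<le> A / 2" unfolding \<eta>_def by (rule min.cobounded1)
  qed
  have main: "\<exists>\<kappa>'>0. \<exists>M\<ge>1. \<forall>mu>M. returns T \<eta> \<kappa> \<eta>' \<kappa>' mu"
    if kap: "0 < \<kappa>" for \<kappa>
  proof -
    have bn: "0 < b ^ n" using b_pos by simp
    \<comment> \<open>Lower bound for the height of the excursion.\<close>
    define \<kappa>1 where "\<kappa>1 = min \<kappa> (\<kappa> / (2 * (b ^ n * c * b)))"
    have k1: "0 < \<kappa>1" "\<kappa>1 \<le> \<kappa>" "\<kappa>1 * (b ^ n * c * b) \<le> \<kappa> / 2"
    proof -
      show "0 < \<kappa>1" "\<kappa>1 \<le> \<kappa>" using kap bn b_pos c_pos by (simp_all add: \<kappa>1_def)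
      have "\<kappa>1 \<le> \<kappa> / (2 * (b ^ n * c * b))" unfolding \<kappa>1_def by (rule min.cobounded2)
      moreover have "0 < 2 * (b ^ n * c * b)" using bn b_pos c_pos by simp
      ultimately have "\<kappa>1 * (2 * (b ^ n * c * b)) \<le> \<kappa>" by (simp only: pos_le_divide_eq)
      then show "\<kappa>1 * (b ^ n * c * b) \<le> \<kappa> / 2" by simp
    qed
    have low1: "0 < low \<kappa>1" "0 < low (\<kappa>1 / 2)" using k1 low_pos by simp_all
    \<comment> \<open>Least momentum gained while the position falls from \<open>\<kappa>1\<close> to \<open>\<kappa>1 / 2\<close>, in units of \<open>mu\<close>.\<close>
    define \<kappa>' where "\<kappa>' = low (\<kappa>1 / 2) * (\<kappa>1 / 4) ^ n * (\<kappa>1 / 4)"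
    have k': "0 < \<kappa>'" using low1 k1 by (simp add: \<kappa>'_def)
    \<comment> \<open>At least this momentum, in units of \<open>mu\<close>, is lost in a quarter of the time at positions above \<open>\<kappa>1\<close>.\<close>
    define \<rho> where "\<rho> = low \<kappa>1 * (T / 4) ^ n * (T / 4)"
    have rho: "0 < \<rho>" using low1 T by (simp add: \<rho>_def)
    \<comment> \<open>For \<open>mu > M\<close> the momenta \<open>\<kappa> * mu / 2\<close>, \<open>\<rho> * mu\<close> and \<open>\<kappa>' * mu\<close> exceed \<open>b ^ n\<close>.\<close>
    define M where "M = Max {1, 2 * b ^ n / \<kappa>, b ^ n / \<rho>, b ^ n / \<kappa>'}"
    have M: "1 \<le> M" "2 * b ^ n / \<kappa> \<le> M" "b ^ n / \<rho> \<le> M" "b ^ n / \<kappa>' \<le> M"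
      unfolding M_def by simp_all
    have "\<exists>e. s < e \<and> e \<le> s + T \<and> u e = 0 \<and> \<kappa>' * mu \<le> - v e \<and> - v e \<le> \<eta>' * e ^ n * mu"
      if mu: "M < mu" and fl: "flow mu u v p" and s: "0 \<le> s" "s + T \<le> b"
        and us: "0 \<le> u s" "u s \<le> \<eta>" and vs: "0 \<le> v s" "v s \<le> \<eta> * s ^ n * mu"
        and entry: "\<kappa> \<le> u s \<or> \<kappa> * mu \<le> v s" for mu u v p s
    proof -
      have mu0: "0 < mu" using mu M by simp
      have mus: "2 * b ^ n < \<kappa> * mu" "b ^ n < \<rho> * mu" "b ^ n < \<kappa>' * mu"
        using le_less_trans[OF M(2) mu] le_less_trans[OF M(3) mu] le_less_trans[OF M(4) mu] kap rho k'
        by (simp_all add: pos_divide_less_eq mult.commute)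
      have s_pos: "0 < s" if "\<not> 0 < u s"
      proof (rule ccontr)
        assume "\<not> 0 < s"
        then have "v s \<le> 0" using s vs n_pos by (simp add: power_0_left)
        moreover have "0 < \<kappa> * mu" using kap mu0 by simp
        ultimately show False using that entry kap by linarith
      qed
      have start: "0 < u s \<or> (u s = 0 \<and> 0 < v s \<and> 0 < s)"
      proof (cases "0 < u s")
        case False
        have "0 < \<kappa> * mu" using kap mu0 by simp
        then have "0 < v s" using False entry kap by linarith
        then show ?thesis using s_pos False us by simp
      qed simp
      obtain e where e: "s < e" "e \<le> s + T" "\<And>r. s < r \<Longrightarrow> r < e \<Longrightarrow> 0 < u r" "0 \<le> u e" "u e = 0 \<or> e = s + T"
        using positive_exit[OF fl mu0 s(1) _ s(2) start] T by auto
      have eb: "e \<le> b" using e s by simp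
      have vdec: "v y < v x" if "s \<le> x" "x < y" "y \<le> e" for x y
        by (rule v_strict_decr[OF fl mu0]) (use that s eb e in auto)
      have rising: "u x \<le> u y" if "s \<le> x" "x \<le> y" "y \<le> t" "t \<le> e" "0 \<le> v t" for x y t
      proof (rule u_incr[OF fl mu0])
        fix r assume "x < r" "r < y"
        then show "0 \<le> v r" using vdec[of r t] that by (cases "r = t") auto
      qed (use that s eb in auto)
      have amplitude: "u t \<le> A" if t: "s < t" "t \<le> e" "0 \<le> v t" for t
      proof (rule ccontr)
        assume neg: "\<not> u t \<le> A"
        have vlt: "v t < v s" using vdec t by simp
        have "0 < s"
        proof (rule ccontr)
          assume "\<not> 0 < s"
          then have "v s \<le> 0" using s vs n_pos by (simp add: power_0_left)
          with vlt t show False by simp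
        qed
        show False
        proof (cases "s \<le> t - A / 2")
          case True
          have "mu * low (A / 2) * (t - A / 2) ^ n * (t - (t - A / 2)) \<le> v (t - A / 2) - v t"
          proof (rule v_drop_ge[OF fl mu0])
            fix r assume r: "t - A / 2 < r" "r < t"
            then show "A / 2 \<le> u r" using u_speed[OF fl mu0, of r t] True s t eb neg by auto
          qed (use True s A t eb in auto)
          also have "v (t - A / 2) \<le> v s" using vdec[of s "t - A / 2"] True t A by (cases "s = t - A / 2") auto
          finally have "mu * low (A / 2) * (t - A / 2) ^ n * (A / 2) \<le> v s" using t by simp
          moreover have "mu * low (A / 2) * s ^ n * (A / 2) \<le> mu * low (A / 2) * (t - A / 2) ^ n * (A / 2)"
            using True s A mu0 lowA by (intro mult_right_mono mult_left_mono power_mono) auto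
          ultimately have "low (A / 2) * (A / 2) * (s ^ n * mu) \<le> \<eta> * (s ^ n * mu)"
            using vs by (simp add: mult_ac)
          then have "low (A / 2) * (A / 2) \<le> \<eta>"
            using \<open>0 < s\<close> mu0 by (metis mult_le_cancel_right_pos mult_pos_pos zero_less_power)
          with eta show False by simp
        next
          case False
          then show False using u_speed[OF fl mu0, of s t] s t eb neg us eta by auto
        qed
      qed
      \<comment> \<open>The rise ends within half of the time: otherwise \<open>v\<close> is moderate somewhere in the first
        quarter, because \<open>u\<close> grows by at most \<open>A\<close>, and the second quarter makes it negative.\<close>
      define t where "t = min e (s + T / 2)"
      have t: "s < t" "t \<le> e" "t \<le> s + T / 2" using e T by (auto simp: t_def)
      have vt: "v t < 0"
      proof (rule ccontr)
        assume "\<not> v t < 0"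
        then have v0: "0 \<le> v t" by simp
        have "0 < u ((s + t) / 2)" using e(3) t by auto
        also have "\<dots> \<le> u t" using rising[of "(s + t) / 2" t t] t v0 by auto
        finally have "0 < u t" .
        then have "t \<noteq> e \<or> e = s + T" using e(5) by auto
        then have teq: "t = s + T / 2" using T by (auto simp: t_def min_def split: if_splits)
        have uA: "u t \<le> A" by (rule amplitude[OF t(1,2) v0])
        define r1 where "r1 = s + T / 4"
        have r1: "s < r1" "r1 < t" "r1 - s = T / 4" "t - r1 = T / 4" "T / 4 \<le> r1" using T teq s by (auto simp: r1_def)
        obtain x where x: "s < x" "x < r1" "u r1 - u s = (r1 - s) * slope 1 (v x / x ^ n)"
          using mvt_within[OF u_der[OF fl mu0], of s r1] s r1 t eb by (metis less_le_trans less_imp_le)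
        have "u r1 \<le> u t" using rising[of r1 t t] r1 t v0 by simp
        moreover have "u r1 - u s = (T / 4) * slope 1 (v x / x ^ n)" by (simp only: x(3) r1(3))
        ultimately have "(T / 4) * slope 1 (v x / x ^ n) \<le> (T / 4) * (1 / 8)" using uA us A by linarith
        moreover have "0 < T / 4" using T by simp
        ultimately have sl: "slope 1 (v x / x ^ n) \<le> 1 / 8" by (metis mult_le_cancel_left_pos)
        have "v x / x ^ n < 1"
        proof (rule ccontr)
          assume "\<not> v x / x ^ n < 1"
          then have "1 / 2 \<le> slope 1 (v x / x ^ n)" by (intro slope_one_ge_half) simp
          with sl show False by simp
        qed
        then have "v x < x ^ n" using x s by (simp add: field_simps)
        also have "\<dots> \<le> b ^ n" using x s r1 t eb by (intro power_mono) auto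
        finally have vx: "v x < b ^ n" .
        have vr1: "v r1 < b ^ n" using vdec[of x r1] x r1 t vx by simp
        have ur1: "\<kappa>1 \<le> u r1"
          using entry
        proof
          assume "\<kappa> \<le> u s"
          then show ?thesis using rising[of s r1 t] r1 t v0 k1 by simp
        next
          assume kv: "\<kappa> * mu \<le> v s"
          have "v s - v r1 \<le> r1 ^ n * (c * mu * u r1) * (r1 - s)"
          proof (rule v_drop_le[OF fl mu0])
            show "0 \<le> u r1" using e(3)[of r1] r1 t by auto
            fix r assume "s < r" "r < r1"
            then show "0 < u r \<and> u r \<le> u r1" using e(3)[of r] rising[of r r1 t] r1 t v0 by auto
          qed (use s r1 t eb in auto)
          also have "\<dots> \<le> b ^ n * (c * mu * u r1) * b"
            using e(3)[of r1] r1 t s eb c_pos mu0 T by (intro mult_mono power_mono) auto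
          finally have "\<kappa> * mu / 2 < b ^ n * (c * mu * u r1) * b"
            using kv vr1 mus(1) by linarith
          then have "\<kappa> / 2 * mu < u r1 * (b ^ n * c * b) * mu" by (simp add: mult_ac)
          then have "\<kappa> / 2 < u r1 * (b ^ n * c * b)" using mu0 by (metis mult_less_cancel_right_pos)
          then have "\<kappa>1 * (b ^ n * c * b) < u r1 * (b ^ n * c * b)" using k1(3) by linarith
          moreover have "0 < b ^ n * c * b" using bn c_pos b_pos by simp
          ultimately show ?thesis by (metis less_imp_le mult_less_cancel_right_pos)
        qed
        have "mu * low \<kappa>1 * r1 ^ n * (t - r1) \<le> v r1 - v t"
        proof (rule v_drop_ge[OF fl mu0])
          fix r assume "r1 < r" "r < t"
          then show "\<kappa>1 \<le> u r" using rising[of r1 r t] r1 t v0 ur1 by auto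
        qed (use k1 s r1 t eb in auto)
        moreover have "mu * low \<kappa>1 * (T / 4) ^ n * (T / 4) \<le> mu * low \<kappa>1 * r1 ^ n * (t - r1)"
          using r1 mu0 low1 T by (intro mult_mono mult_left_mono power_mono) auto
        ultimately have "\<rho> * mu \<le> v r1 - v t" by (simp add: \<rho>_def mult_ac)
        then show False using vr1 v0 mus(2) by linarith
      qed
      have cont: "continuous_on {s..t} v" by (rule continuous_on_subset[OF v_cont[OF fl mu0]]) (use s t eb in auto)
      obtain m where m: "s \<le> m" "m \<le> t" "v m = 0"
        using IVT2'[of v t 0 s] vt vs t cont by auto
      have mt: "m < t" using m vt by (cases "m = t") auto
      have um: "\<kappa>1 \<le> u m"
        using entry
      proof
        assume "\<kappa> \<le> u s"
        then show ?thesis using rising[of s m m] m t k1 by simp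
      next
        assume kv: "\<kappa> * mu \<le> v s"
        have "v s - v m \<le> m ^ n * (c * mu * u m) * (m - s)"
        proof (rule v_drop_le[OF fl mu0])
          show "0 \<le> u m" using rising[of s m m] us m t by simp
          fix r assume "s < r" "r < m"
          then show "0 < u r \<and> u r \<le> u m" using e(3)[of r] rising[of r m m] m t by auto
        qed (use s m t eb in auto)
        also have "\<dots> \<le> b ^ n * (c * mu * u m) * b"
          using rising[of s m m] us m t s eb c_pos mu0 b_pos by (intro mult_mono power_mono) auto
        finally have "\<kappa> * mu \<le> u m * (b ^ n * c * b) * mu"
          using kv m by (simp add: mult_ac)
        then have "\<kappa> \<le> u m * (b ^ n * c * b)" using mu0 by (metis mult_le_cancel_right_pos)
        then have "\<kappa>1 * (b ^ n * c * b) \<le> u m * (b ^ n * c * b)" using k1(3) kap by linarith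
        moreover have "0 < b ^ n * c * b" using bn c_pos b_pos by simp
        ultimately show ?thesis by (metis mult_le_cancel_right_pos)
      qed
      have umA: "u m \<le> A"
      proof (cases "m = s")
        case True then show ?thesis using us eta A by simp
      next
        case False then show ?thesis using amplitude[of m] m t by simp
      qed
      have falling: "u y \<le> u x" if "m \<le> x" "x \<le> y" "y \<le> e" for x y
      proof (rule u_decr[OF fl mu0])
        fix r assume "x < r" "r < y"
        then show "v r \<le> 0" using vdec[of m r] that m by auto
      qed (use that s m eb in auto)
      \<comment> \<open>The fall: once \<open>u\<close> has lost \<open>\<kappa>1 / 2\<close>, the speed stays at least \<open>1 / 2\<close> until the return.\<close>
      define m2 where "m2 = m + \<kappa>1 / 2"
      have m2: "m < m2" "m2 - m = \<kappa>1 / 2" "m2 \<le> s + T / 2 + T / 64" using k1 um umA A m t by (auto simp: m2_def)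
      have m2e: "m2 < e"
      proof (rule ccontr)
        assume neg: "\<not> m2 < e"
        then have "e \<noteq> s + T" using m2 T by auto
        then have "u e = 0" using e(5) by simp
        moreover have "u m - (e - m) \<le> u e" using u_speed[OF fl mu0, of m e] m mt t s eb by auto
        moreover have "e - m \<le> \<kappa>1 / 2" using neg m2 by simp
        ultimately show False using um k1 by simp
      qed
      have vm2: "\<kappa>' * mu \<le> - v m2"
      proof -
        define m1 where "m1 = m + \<kappa>1 / 4"
        have m1: "m < m1" "m1 < m2" "m2 - m1 = \<kappa>1 / 4" "\<kappa>1 / 4 \<le> m1" using k1 m s by (auto simp: m1_def m2_def)
        have "mu * low (\<kappa>1 / 2) * m1 ^ n * (m2 - m1) \<le> v m1 - v m2"
        proof (rule v_drop_ge[OF fl mu0])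
          fix r assume r: "m1 < r" "r < m2"
          have "u m - (r - m) \<le> u r" using u_speed[OF fl mu0, of m r] r m m1 m2 m2e s eb by auto
          then show "\<kappa>1 / 2 \<le> u r" using r m2 um by linarith
        qed (use k1 s m m1 m2e eb in auto)
        moreover have "mu * low (\<kappa>1 / 2) * (\<kappa>1 / 4) ^ n * (\<kappa>1 / 4) \<le> mu * low (\<kappa>1 / 2) * m1 ^ n * (m2 - m1)"
          using m1 mu0 low1 k1 by (intro mult_mono mult_left_mono power_mono) auto
        moreover have "v m1 < 0" using vdec[of m m1] m m1 m2e by simp
        ultimately show ?thesis by (simp add: \<kappa>'_def mult_ac)
      qed
      have ve: "\<kappa>' * mu \<le> - v e" using vm2 vdec[of m2 e] m2e m m2 by simp
      have ue: "u e = 0"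
      proof (rule ccontr)
        assume "u e \<noteq> 0"
        then have eT: "e = s + T" using e(5) by simp
        have "u e \<le> u m2 - (e - m2) / 2"
        proof (rule u_fast_decr[OF fl mu0])
          fix r assume r: "m2 < r" "r < e"
          have "r ^ n \<le> b ^ n" using r eb m m2 s by (intro power_mono) auto
          moreover have "v r < v m2" using vdec[of m2 r] r m m2 by simp
          ultimately show "v r \<le> - (r ^ n)" using vm2 mus(3) by linarith
        qed (use s m m2 m2e eb in auto)
        moreover have "u m2 \<le> A" using falling[of m m2] m2 m2e umA by simp
        ultimately have "(e - m2) / 2 \<le> A" using e(4) by linarith
        moreover have "T / 4 \<le> e - m2" using eT m2 T by simp
        ultimately have "T / 8 \<le> A" by simp
        then show False using A(2) T by simp
      qed
      have "v m - v e \<le> e ^ n * (c * mu * A) * (e - m)"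
      proof (rule v_drop_le[OF fl mu0])
        fix r assume r: "m < r" "r < e"
        then show "0 < u r \<and> u r \<le> A" using e(3)[of r] falling[of m r] m umA by auto
      qed (use s m mt t eb A in auto)
      also have "\<dots> \<le> e ^ n * (c * mu * A) * T"
        using s m mt t e c_pos mu0 A by (intro mult_left_mono) auto
      also have "\<dots> = c * A * T * (e ^ n * mu)" by (simp add: mult_ac)
      also have "\<dots> \<le> \<eta>' * (e ^ n * mu)" using A(3) s e mu0 by (intro mult_right_mono) auto
      finally have "- v e \<le> \<eta>' * e ^ n * mu" using m by (simp add: mult_ac)
      with ve ue e show ?thesis by blast
    qed
    then have "\<forall>mu>M. returns T \<eta> \<kappa> \<eta>' \<kappa>' mu"
      unfolding returns_def entry_def by meson
    with k' M(1) show ?thesis by blast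
  qed
  from eta(1) main show ?thesis by blast
qed

text \<open>
Excursions alternate in sign. The bound \<open>\<eta>\<close> is chosen backwards, starting from the last
excursion, and \<open>\<kappa>\<close> and \<open>M\<close> forwards; hence the order of quantifiers. The first excursion may use
a quarter of the time and the others half of it, which keeps the zeros inside the open interval.
\<close>

theorem many_zeros:
  "0 < T \<Longrightarrow> \<exists>\<eta>>0. \<forall>\<kappa>>0. \<exists>M\<ge>1. \<forall>mu>M. oscillates T \<eta> \<kappa> j mu"
proof (induction j arbitrary: T)
  case 0
  have "oscillates T \<eta> \<kappa> 0 mu" for \<eta> \<kappa> mu
    unfolding oscillates_def by (intro allI impI exI[where x = "{}"]) simp
  then show ?case by (meson zero_less_one order_refl)
next
  case (Suc j)
  have "0 < T / 2" "0 < T / 4" using Suc.prems by simp_all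
  from Suc.IH[OF this(1)] obtain \<eta>1 where \<eta>1: "0 < \<eta>1" and
    IH: "\<forall>\<kappa>>0. \<exists>M\<ge>1. \<forall>mu>M. oscillates (T / 2) \<eta>1 \<kappa> j mu"
    by (elim exE conjE)
  from hump[OF \<open>0 < T / 4\<close> \<eta>1] obtain \<eta> where \<eta>: "0 < \<eta>" and
    H: "\<forall>\<kappa>>0. \<exists>\<kappa>'>0. \<exists>M\<ge>1. \<forall>mu>M. returns (T / 4) \<eta> \<kappa> \<eta>1 \<kappa>' mu"
    by (elim exE conjE)
  have "\<exists>M\<ge>1. \<forall>mu>M. oscillates T \<eta> \<kappa> (Suc j) mu" if \<kappa>: "0 < \<kappa>" for \<kappa>
  proof -
    from H[rule_format, OF \<kappa>] obtain \<kappa>' M1 where \<kappa>': "0 < \<kappa>'" and M1: "1 \<le> M1" and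
      H1: "\<forall>mu>M1. returns (T / 4) \<eta> \<kappa> \<eta>1 \<kappa>' mu"
      by (elim exE conjE)
    from IH[rule_format, OF \<kappa>'] obtain M2 where M2: "1 \<le> M2" and
      H2: "\<forall>mu>M2. oscillates (T / 2) \<eta>1 \<kappa>' j mu"
      by (elim exE conjE)
    have "oscillates T \<eta> \<kappa> (Suc j) mu" if mu: "max M1 M2 < mu" for mu
      unfolding oscillates_def
    proof (intro allI impI)
      fix u v p s assume a: "flow mu u v p \<and> 0 \<le> s \<and> s + T \<le> b \<and> entry mu \<eta> \<kappa> u v s"
      have b': "s + T / 4 \<le> b" "M1 < mu" "M2 < mu" using mu a Suc.prems by auto
      have "flow mu u v p \<and> 0 \<le> s \<and> s + T / 4 \<le> b \<and> entry mu \<eta> \<kappa> u v s" using a b'(1) by simp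
      from H1[unfolded returns_def, rule_format, OF b'(2) this]
      obtain e where e: "s < e" "e \<le> s + T / 4" "u e = 0" "\<kappa>' * mu \<le> - v e" "- v e \<le> \<eta>1 * e ^ n * mu"
        by (elim exE conjE)
      have "0 < \<kappa>' * mu" using \<kappa>' M1 b' by simp
      then have "entry mu \<eta>1 \<kappa>' (\<lambda>r. - u r) (\<lambda>r. - v r) e"
        unfolding entry_def using e \<eta>1 by auto
      moreover have "0 \<le> e" "e + T / 2 \<le> b" using a e Suc.prems by auto
      moreover have "flow mu (\<lambda>r. - u r) (\<lambda>r. - v r) (\<lambda>r. - p r)" using a by (intro flow_minus) simp
      ultimately have "flow mu (\<lambda>r. - u r) (\<lambda>r. - v r) (\<lambda>r. - p r) \<and> 0 \<le> e \<and> e + T / 2 \<le> b \<and>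
          entry mu \<eta>1 \<kappa>' (\<lambda>r. - u r) (\<lambda>r. - v r) e" by simp
      from H2[unfolded oscillates_def, rule_format, OF b'(3) this]
      obtain Z where Z: "Z \<subseteq> {e<..<e + T / 2}" "finite Z" "card Z = j" "\<forall>z\<in>Z. - u z = 0"
        by (elim exE conjE)
      have "insert e Z \<subseteq> {s<..<s + T}"
      proof
        fix z assume "z \<in> insert e Z"
        then have "z = e \<or> e < z \<and> z < e + T / 2" using Z(1) by auto
        then show "z \<in> {s<..<s + T}" using e(1,2) Suc.prems by auto
      qed
      moreover have "card (insert e Z) = Suc j" using Z by (subst card_insert_disjoint) auto
      moreover have "\<forall>z\<in>insert e Z. u z = 0" using Z(4) e(3) by simp
      ultimately show "\<exists>Z \<subseteq> {s<..<s + T}. finite Z \<and> card Z = Suc j \<and> (\<forall>z\<in>Z. u z = 0)"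
        using Z(2) by blast
    qed
    then show ?thesis using M1 by (intro exI[of _ "max M1 M2"]) auto
  qed
  with \<eta> show ?case by blast
qed

end

section \<open>The radial profile of the Laplacian\<close>

text \<open>
Inserting a power series in \<open>m * r\<^sup>2\<close> into \<open>w'' + (N - 1) / r * w' + m * w = 0\<close> gives this recursion.
The sum \<open>rad N t\<close> is the Bessel function of order \<open>N / 2 - 1\<close> at \<open>sqrt t\<close>, divided by
\<open>t powr (N / 4 - 1 / 2)\<close> and normalised to \<open>1\<close> at \<open>t = 0\<close>; unlike the Bessel function it is an entire
function of \<open>t\<close>, which makes \<open>rad N (m * norm x ^ 2)\<close> smooth at the origin.
\<close>

primrec rad_coeff :: "nat \<Rightarrow> nat \<Rightarrow> real" where
  "rad_coeff N 0 = 1"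
| "rad_coeff N (Suc k) = - rad_coeff N k / (2 * (real k + 1) * (2 * real k + real N))"

definition rad :: "nat \<Rightarrow> real \<Rightarrow> real" where
  "rad N t = (\<Sum>k. rad_coeff N k * t ^ k)"

definition rad_d :: "nat \<Rightarrow> real \<Rightarrow> real" where
  "rad_d N t = (\<Sum>k. diffs (rad_coeff N) k * t ^ k)"

definition rad_dd :: "nat \<Rightarrow> real \<Rightarrow> real" where
  "rad_dd N t = (\<Sum>k. diffs (diffs (rad_coeff N)) k * t ^ k)"

lemma rad_coeff_bound:
  assumes "1 \<le> N" shows "\<bar>rad_coeff N k\<bar> \<le> inverse (fact k)"
proof (induction k)
  case (Suc k)
  have "real k + 1 \<le> 2 * (real k + 1) * (2 * real k + real N)"
    using mult_mono[of "real k + 1" "2 * (real k + 1)" 1 "2 * real k + real N"] assms by simp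
  then have "\<bar>rad_coeff N (Suc k)\<bar> \<le> inverse (fact k) / (real k + 1)"
    using Suc.IH assms by (auto simp: abs_mult intro!: frac_le)
  also have "\<dots> = inverse (fact (Suc k))" by (simp add: field_simps)
  finally show ?case .
qed simp

lemma rad_summable:
  assumes "1 \<le> N" shows "summable (\<lambda>k. rad_coeff N k * t ^ k)"
proof (rule summable_comparison_test)
  show "summable (\<lambda>k. inverse (fact k) * \<bar>t\<bar> ^ k)" by (rule summable_exp)
  show "\<exists>M. \<forall>k\<ge>M. norm (rad_coeff N k * t ^ k) \<le> inverse (fact k) * \<bar>t\<bar> ^ k"
    using rad_coeff_bound[OF assms] by (auto simp: abs_mult power_abs intro!: mult_right_mono)
qed

lemma rad_d_summable:
  assumes "1 \<le> N" shows "summable (\<lambda>k. diffs (rad_coeff N) k * t ^ k)"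
  using termdiff_converges_all rad_summable[OF assms] by blast

lemma rad_dd_summable:
  assumes "1 \<le> N" shows "summable (\<lambda>k. diffs (diffs (rad_coeff N)) k * t ^ k)"
  using termdiff_converges_all rad_d_summable[OF assms] by blast

lemma rad_deriv:
  assumes "1 \<le> N" shows "(rad N has_real_derivative rad_d N t) (at t)"
  using termdiffs_strong_converges_everywhere[OF rad_summable[OF assms]]
  unfolding rad_def[abs_def] rad_d_def .

lemma rad_d_deriv:
  assumes "1 \<le> N" shows "(rad_d N has_real_derivative rad_dd N t) (at t)"
  using termdiffs_strong_converges_everywhere[OF rad_d_summable[OF assms]]
  unfolding rad_d_def[abs_def] rad_dd_def .

lemma rad_dd_cont: assumes "1 \<le> N" shows "continuous_on S (rad_dd N)"
proof -
  have "(rad_dd N has_real_derivative (\<Sum>k. diffs (diffs (diffs (rad_coeff N))) k * t ^ k)) (at t)" for t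
    using termdiffs_strong_converges_everywhere[OF rad_dd_summable[OF assms]]
    unfolding rad_dd_def[abs_def] .
  then show ?thesis by (intro continuous_at_imp_continuous_on ballI) (blast intro: DERIV_isCont)
qed

lemma rad_0 [simp]: "rad N 0 = 1"
  by (simp add: rad_def powser_zero)

lemma rad_ode:
  assumes "1 \<le> N"
  shows "4 * t * rad_dd N t + 2 * N * rad_d N t + rad N t = 0"
proof -
  have "(\<lambda>k. diffs (diffs (rad_coeff N)) k * t ^ k) sums rad_dd N t"
    unfolding rad_dd_def by (rule summable_sums[OF rad_dd_summable[OF assms]])
  then have "(\<lambda>k. t * (diffs (diffs (rad_coeff N)) k * t ^ k)) sums (t * rad_dd N t)"
    by (rule sums_mult)
  moreover have "(\<lambda>k. t * (diffs (diffs (rad_coeff N)) k * t ^ k))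
      = (\<lambda>k. real (Suc k) * diffs (rad_coeff N) (Suc k) * t ^ Suc k)"
    by (simp add: diffs_def mult_ac)
  ultimately have "(\<lambda>k. real (Suc k) * diffs (rad_coeff N) (Suc k) * t ^ Suc k) sums (t * rad_dd N t)"
    by simp
  then have 1: "(\<lambda>k. real k * diffs (rad_coeff N) k * t ^ k) sums (t * rad_dd N t)"
    using sums_Suc_iff[of "\<lambda>k. real k * diffs (rad_coeff N) k * t ^ k" "t * rad_dd N t"] by simp
  have 2: "(\<lambda>k. diffs (rad_coeff N) k * t ^ k) sums rad_d N t"
    unfolding rad_d_def by (rule summable_sums[OF rad_d_summable[OF assms]])
  have 3: "(\<lambda>k. rad_coeff N k * t ^ k) sums rad N t"
    unfolding rad_def by (rule summable_sums[OF rad_summable[OF assms]])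
  have "(\<lambda>k. 4 * (real k * diffs (rad_coeff N) k * t ^ k) + 2 * N * (diffs (rad_coeff N) k * t ^ k)
      + rad_coeff N k * t ^ k) sums (4 * (t * rad_dd N t) + 2 * N * rad_d N t + rad N t)"
    by (intro sums_add sums_mult 1 2 3)
  moreover have "4 * (real k * diffs (rad_coeff N) k * t ^ k) + 2 * N * (diffs (rad_coeff N) k * t ^ k)
      + rad_coeff N k * t ^ k = 0" for k
  proof -
    define a b where "a = real k + 1" and "b = 2 * real k + real N"
    have ab: "a \<noteq> 0" "b \<noteq> 0" using assms by (auto simp: a_def b_def)
    have "diffs (rad_coeff N) k = a * (- rad_coeff N k / (2 * a * b))"
      by (simp add: diffs_def a_def b_def add.commute)
    also have "\<dots> = - rad_coeff N k / (2 * b)" using ab by simp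
    finally have "2 * b * diffs (rad_coeff N) k = - rad_coeff N k" using ab by simp
    moreover have "2 * b = 4 * real k + 2 * N" by (simp add: b_def)
    ultimately have "(4 * real k + 2 * N) * diffs (rad_coeff N) k = - rad_coeff N k" by simp
    then have "((4 * real k + 2 * N) * diffs (rad_coeff N) k + rad_coeff N k) * t ^ k = 0" by simp
    then show ?thesis by (simp add: algebra_simps)
  qed
  ultimately have "(\<lambda>k. 0) sums (4 * (t * rad_dd N t) + 2 * N * rad_d N t + rad N t)" by simp
  then show ?thesis by (simp add: sums_iff mult_ac)
qed

lemma rad_profile_deriv:
  assumes "1 \<le> N"
  shows "((\<lambda>r. rad N (m * r\<^sup>2)) has_real_derivative 2 * m * r * rad_d N (m * r\<^sup>2)) (at r)"
proof -
  have "((\<lambda>r. m * r\<^sup>2) has_real_derivative 2 * m * r) (at r)" by (auto intro!: derivative_eq_intros)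
  from DERIV_chain2[OF rad_deriv[OF assms] this] show ?thesis by (simp add: mult_ac)
qed

text \<open>
The radial equation \<open>w'' = - m * w - (N - 1) / r * w'\<close> for \<open>w r = rad N (m * r\<^sup>2)\<close>.
\<close>

lemma rad_profile_deriv2:
  assumes "1 \<le> N" "r \<noteq> 0"
  shows "((\<lambda>r. 2 * m * r * rad_d N (m * r\<^sup>2)) has_real_derivative
     (- m * rad N (m * r\<^sup>2) - real (N - 1) / r * (2 * m * r * rad_d N (m * r\<^sup>2)))) (at r)"
proof -
  have sq: "((\<lambda>r. m * r\<^sup>2) has_real_derivative 2 * m * r) (at r)" by (auto intro!: derivative_eq_intros)
  have "((\<lambda>r. 2 * m * r * rad_d N (m * r\<^sup>2)) has_real_derivative
      (2 * m * rad_d N (m * r\<^sup>2) + 2 * m * r * (rad_dd N (m * r\<^sup>2) * (2 * m * r)))) (at r)"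
    using DERIV_mult'[OF DERIV_cmult_Id[of "2 * m"] DERIV_chain2[OF rad_d_deriv[OF assms(1)] sq]]
    by (simp add: add.commute)
  moreover have "2 * m * rad_d N (m * r\<^sup>2) + 2 * m * r * (rad_dd N (m * r\<^sup>2) * (2 * m * r))
      = - m * rad N (m * r\<^sup>2) - real (N - 1) / r * (2 * m * r * rad_d N (m * r\<^sup>2))"
  proof -
    have "real (N - 1) / r * (2 * m * r * rad_d N (m * r\<^sup>2)) = 2 * m * (real N - 1) * rad_d N (m * r\<^sup>2)"
      using assms by (simp add: of_nat_diff)
    moreover have "2 * m * r * (rad_dd N (m * r\<^sup>2) * (2 * m * r)) = m * (4 * (m * r\<^sup>2) * rad_dd N (m * r\<^sup>2))"
      by (simp add: power2_eq_square)
    moreover have "4 * (m * r\<^sup>2) * rad_dd N (m * r\<^sup>2) = - (2 * real N * rad_d N (m * r\<^sup>2) + rad N (m * r\<^sup>2))"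
      using rad_ode[OF assms(1), of "m * r\<^sup>2"] by linarith
    ultimately show ?thesis by (simp only:) (simp add: algebra_simps)
  qed
  ultimately show ?thesis by simp
qed

lemma rad_pos_of_nonpos:
  assumes "1 \<le> N" "t \<le> 0" shows "0 < rad N t"
proof -
  have nn: "0 \<le> rad_coeff N k * t ^ k" for k
  proof (induction k)
    case (Suc k)
    have "rad_coeff N (Suc k) * t ^ Suc k
        = (rad_coeff N k * t ^ k) * (- t / (2 * (real k + 1) * (2 * real k + real N)))" by simp
    moreover have "0 \<le> - t / (2 * (real k + 1) * (2 * real k + real N))"
      using assms by (intro divide_nonneg_nonneg) auto
    ultimately show ?case using Suc.IH by (metis mult_nonneg_nonneg)
  qed simp
  have "(\<Sum>k<1. rad_coeff N k * t ^ k) \<le> rad N t"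
    unfolding rad_def using nn by (intro sum_le_suminf rad_summable assms) auto
  then show ?thesis by simp
qed

text \<open>
The function \<open>P s = s ^ N * (rad_d N s)\<^sup>2 + s ^ (N - 1) * (rad N s)\<^sup>2 / 4\<close> is weighted so that the mixed
terms of its derivative cancel by the differential equation, and what remains is nonnegative. A
double zero would make \<open>P\<close>, and hence \<open>rad N\<close>, vanish between \<open>0\<close> and the zero, contrary to
\<open>rad N 0 = 1\<close>.
\<close>

lemma rad_simple_zero:
  assumes N: "2 \<le> N" and z: "rad N t = 0" shows "rad_d N t \<noteq> 0"
proof
  assume z': "rad_d N t = 0"
  have N1: "1 \<le> N" using N by simp
  have t0: "0 < t" using rad_pos_of_nonpos[OF N1, of t] z by fastforce
  define P where "P s = s ^ N * (rad_d N s)\<^sup>2 + s ^ (N - 1) * (rad N s)\<^sup>2 / 4" for s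
  have der: "(P has_real_derivative real (N - 1) * s ^ (N - 2) * (rad N s)\<^sup>2 / 4) (at s)" for s :: real
  proof -
    define m where "m = N - 2"
    have Nm: "N = Suc (Suc m)" "N - 1 = Suc m" "N - 2 = m" using N by (auto simp: m_def)
    have ode: "4 * s * rad_dd N s = - (2 * N * rad_d N s + rad N s)"
      using rad_ode[OF N1, of s] by linarith
    have d1: "((\<lambda>s. (rad_d N s)\<^sup>2) has_real_derivative 2 * rad_d N s * rad_dd N s) (at s)"
      and d2: "((\<lambda>s. (rad N s)\<^sup>2) has_real_derivative 2 * rad N s * rad_d N s) (at s)"
      by (auto intro!: derivative_eq_intros rad_deriv[OF N1] rad_d_deriv[OF N1])
    have "(P has_real_derivative (real N * s ^ (N - 1) * (rad_d N s)\<^sup>2 + s ^ N * (2 * rad_d N s * rad_dd N s)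
        + (real (N - 1) * s ^ (N - 2) * (rad N s)\<^sup>2 + s ^ (N - 1) * (2 * rad N s * rad_d N s)) / 4)) (at s)"
      unfolding P_def[abs_def]
      using DERIV_add[OF DERIV_mult'[OF DERIV_pow d1] DERIV_cdivide[OF DERIV_mult'[OF DERIV_pow d2]], of N "N - 1" 4]
      by (simp add: Nm add.commute mult.commute)
    moreover have "s ^ N * (2 * rad_d N s * rad_dd N s) = s ^ (N - 1) * rad_d N s * (4 * s * rad_dd N s) / 2"
      by (simp add: Nm)
    moreover have "real N * s ^ (N - 1) * (rad_d N s)\<^sup>2
        + s ^ (N - 1) * rad_d N s * (- (2 * N * rad_d N s + rad N s)) / 2
        + (x + s ^ (N - 1) * (2 * rad N s * rad_d N s)) / 4 = x / 4" for x
      by (simp add: power2_eq_square field_simps)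
    ultimately show ?thesis unfolding ode by (simp only:)
  qed
  have zero: "rad N s = 0" if s: "0 < s" "s \<le> t" for s
  proof -
    have "P s \<le> P t"
    proof (rule DERIV_nonneg_imp_nondecreasing[OF s(2)])
      fix x assume "s \<le> x" "x \<le> t"
      then show "\<exists>y. (P has_real_derivative y) (at x) \<and> 0 \<le> y"
        using s der[of x] by (intro exI conjI) (assumption, simp)
    qed
    also have "P t = 0" using z z' by (simp add: P_def)
    finally have "s ^ N * (rad_d N s)\<^sup>2 + s ^ (N - 1) * (rad N s)\<^sup>2 / 4 \<le> 0" by (simp add: P_def)
    moreover have "0 \<le> s ^ N * (rad_d N s)\<^sup>2" using s by simp
    ultimately have "s ^ (N - 1) * (rad N s)\<^sup>2 \<le> 0" by linarith
    moreover have "0 < s ^ (N - 1)" using s by simp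
    ultimately have "(rad N s)\<^sup>2 \<le> 0" by (simp only: mult_le_0_iff) linarith
    then show ?thesis by simp
  qed
  have "isCont (rad N) 0" by (rule DERIV_isCont[OF rad_deriv[OF N1]])
  then obtain e where e: "e > 0" "\<And>x. \<bar>x\<bar> < e \<Longrightarrow> \<bar>rad N x - 1\<bar> < 1"
    unfolding continuous_at_eps_delta by (metis dist_real_def diff_zero rad_0 zero_less_one)
  define x where "x = min t (e / 2)"
  have "0 < x" "x \<le> t" "\<bar>x\<bar> < e" using e(1) t0 by (auto simp: x_def)
  then show False using zero[of x] e(2)[of x] by simp
qed

text \<open>
Simple zeros cannot accumulate: the finiteness of zeros in a family is applied to a constant family.
\<close>

lemma rad_finite_zeros:
  assumes N: "2 \<le> N" shows "finite {t. t \<le> T \<and> rad N t = 0}"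
proof (cases "0 < T")
  case True
  have N1: "1 \<le> N" using N by simp
  interpret simple_zero_family "{0}" T "\<lambda>d. rad N" "\<lambda>d. rad_d N"
  proof
    show "continuous_on ({0} \<times> {0..T}) (\<lambda>p. rad N (snd p))"
      by (intro continuous_on_compose2[OF _ continuous_on_snd[OF continuous_on_id], of UNIV "rad N"]
          continuous_at_imp_continuous_on ballI DERIV_isCont[OF rad_deriv[OF N1]]) auto
    show "continuous_on ({0} \<times> {0..T}) (\<lambda>p. rad_d N (snd p))"
      by (intro continuous_on_compose2[OF _ continuous_on_snd[OF continuous_on_id], of UNIV "rad_d N"]
          continuous_at_imp_continuous_on ballI DERIV_isCont[OF rad_d_deriv[OF N1]]) auto
  qed (use True rad_simple_zero[OF N] has_field_derivative_at_within[OF rad_deriv[OF N1]] in auto)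
  have "{t. t \<le> T \<and> rad N t = 0} \<subseteq> zeros 0"
  proof
    fix t assume "t \<in> {t. t \<le> T \<and> rad N t = 0}"
    then show "t \<in> zeros 0" using rad_pos_of_nonpos[OF N1, of t] by (cases "t \<le> 0") (auto simp: zeros_def)
  qed
  then show ?thesis using finite_zeros[of 0] finite_subset by blast
next
  case False
  then have "{t. t \<le> T \<and> rad N t = 0} = {}"
  proof (intro equals0I)
    fix t assume "t \<in> {t. t \<le> T \<and> rad N t = 0}"
    with False rad_pos_of_nonpos[of N t] N show False by simp
  qed
  then show ?thesis by (simp only: finite.emptyI)
qed

text \<open>
For \<open>w r = rad N (r\<^sup>2)\<close> the function \<open>y = - w' / w\<close> satisfies \<open>y' = 1 + y\<^sup>2 - (N - 1) / r * y\<close> as long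
as \<open>w\<close> has no zero. For \<open>r \<ge> N\<close> the last term is at most half of the others, so \<open>arctan y\<close> grows at
least at rate \<open>1 / 2\<close>, which a bounded function cannot do over the length \<open>2 * pi\<close>.
\<close>

lemma rad_zeros_unbounded:
  assumes N: "2 \<le> N" shows "\<exists>t>T. rad N t = 0"
proof (rule ccontr)
  assume neg: "\<not> (\<exists>t>T. rad N t = 0)"
  have N1: "1 \<le> N" using N by simp
  define a where "a = max (real N) (\<bar>T\<bar> + 1)"
  have a: "real N \<le> a" "1 \<le> a" "\<bar>T\<bar> < a" using N by (auto simp: a_def)
  have big: "T < r\<^sup>2" if "a \<le> r" for r
  proof -
    have "r * 1 \<le> r * r" using that a by (intro mult_left_mono) auto
    then have "r \<le> r\<^sup>2" by (simp add: power2_eq_square)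
    then show ?thesis using that a by linarith
  qed
  have nz: "rad N (r\<^sup>2) \<noteq> 0" if "a \<le> r" for r using neg big[OF that] by blast
  define w where "w r = rad N (r\<^sup>2)" for r
  define w' where "w' r = 2 * r * rad_d N (r\<^sup>2)" for r
  have wd: "(w has_real_derivative w' r) (at r)" for r
    using rad_profile_deriv[OF N1, of 1 r] by (simp add: w_def[abs_def] w'_def)
  have w'd: "(w' has_real_derivative (- w r - (N - 1) / r * w' r)) (at r)" if "r \<noteq> 0" for r
    using rad_profile_deriv2[OF N1 that, of 1] by (simp add: w_def w'_def[abs_def])
  define z where "z r = arctan (- w' r / w r)" for r
  have "(b - a) / 2 \<le> z b - z a" if "a \<le> b" for b
  proof -
    have "z a - a / 2 \<le> z b - b / 2"
    proof (rule DERIV_nonneg_imp_nondecreasing[OF that])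
      fix r assume "a \<le> r" "r \<le> b"
      then have r: "0 < r" "w r \<noteq> 0" "real N \<le> r" using a nz by (auto simp: w_def)
      define q where "q = - w' r / w r"
      have qd: "((\<lambda>r. - w' r / w r) has_real_derivative (1 + q\<^sup>2 - (N - 1) / r * q)) (at r)"
      proof -
        have "(- (- w r - real (N - 1) / r * w' r) * w r - (- w' r) * w' r) / (w r * w r)
            = 1 + q\<^sup>2 - (N - 1) / r * q"
          using r by (simp add: q_def power2_eq_square field_simps)
        then show ?thesis
          using DERIV_divide[OF DERIV_minus[OF w'd] wd r(2)] r(1) by simp
      qed
      have "((\<lambda>r. z r - r / 2) has_real_derivative
          (inverse (1 + q\<^sup>2) * (1 + q\<^sup>2 - (N - 1) / r * q) - 1 / 2)) (at r)"
        unfolding z_def[abs_def] q_def[symmetric]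
        using DERIV_diff[OF DERIV_chain2[OF DERIV_arctan qd] DERIV_cdivide[OF DERIV_ident, of 2]]
        by (simp only: q_def)
      then have "((\<lambda>r. z r - r / 2) has_real_derivative
          ((1 + q\<^sup>2 - (N - 1) / r * q) / (1 + q\<^sup>2) - 1 / 2)) (at r)"
        by (simp only: divide_inverse mult.commute)
      moreover have "0 \<le> (1 + q\<^sup>2 - (N - 1) / r * q) / (1 + q\<^sup>2) - 1 / 2"
      proof -
        define k where "k = real (N - 1) / r"
        have k: "0 \<le> k" "k \<le> 1" using r N by (simp_all add: k_def of_nat_diff)
        have "k * q \<le> k * \<bar>q\<bar>" using k(1) by (intro mult_left_mono) auto
        also have "\<dots> \<le> \<bar>q\<bar>" using k by (intro mult_left_le_one_le) auto
        finally have "2 * (k * q) \<le> 2 * \<bar>q\<bar>" by simp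
        also have "\<dots> \<le> 1 + q\<^sup>2"
          using zero_le_power2[of "\<bar>q\<bar> - 1"] by (simp add: power2_diff)
        finally have "2 * ((N - 1) / r * q) \<le> 1 + q\<^sup>2" by (simp only: k_def)
        moreover have "0 < 1 + q\<^sup>2" by (simp add: add_pos_nonneg)
        ultimately show ?thesis by (simp add: field_simps)
      qed
      ultimately show "\<exists>y. ((\<lambda>r. z r - r / 2) has_real_derivative y) (at r) \<and> 0 \<le> y" by blast
    qed
    then show ?thesis by (simp add: field_simps)
  qed
  from this[of "a + 2 * pi"] have "pi \<le> z (a + 2 * pi) - z a" by simp
  moreover have "z (a + 2 * pi) < pi / 2" "- (pi / 2) < z a"
    unfolding z_def by (rule arctan_ubound, rule arctan_lbound)
  ultimately show False by linarith
qed

section \<open>Radial Dirichlet eigenvalues\<close>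

lemma inner_along_axis:
  fixes x :: "real^'n"
  shows "(x + t *\<^sub>R axis i 1) \<bullet> (x + t *\<^sub>R axis i 1) = x \<bullet> x + 2 * t * x $ i + t\<^sup>2"
  by (simp add: inner_add_left inner_add_right inner_axis inner_axis' inner_axis_axis power2_eq_square algebra_simps)

lemma partial_eqI:
  assumes "((\<lambda>t. f (x + t *\<^sub>R axis i 1)) has_real_derivative D) (at 0)"
  shows "partial i f x = D" "(\<lambda>t. f (x + t *\<^sub>R axis i 1)) differentiable (at 0)"
  using assms by (auto simp: partial_def DERIV_imp_deriv real_differentiable_def)

lemma line_deriv_quadratic:
  fixes x :: "real^'n"
  assumes "\<And>t. (G has_real_derivative G' t) (at t)"
  shows "((\<lambda>t. G (m * ((x + t *\<^sub>R axis i 1) \<bullet> (x + t *\<^sub>R axis i 1)))) has_real_derivative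
           G' (m * (x \<bullet> x)) * (2 * m * x $ i)) (at 0)"
proof -
  have "((\<lambda>t. m * (x \<bullet> x + 2 * t * x $ i + t\<^sup>2)) has_real_derivative 2 * m * x $ i) (at 0)"
    by (auto intro!: derivative_eq_intros)
  from DERIV_chain2[where f = G and g = "\<lambda>t. m * (x \<bullet> x + 2 * t * x $ i + t\<^sup>2)", OF _ this] assms
  show ?thesis unfolding inner_along_axis by simp
qed

text \<open>
Since \<open>x \<bullet> x\<close> is a polynomial in the coordinates, the partial derivatives of
\<open>x \<mapsto> rad N (m * (x \<bullet> x))\<close> follow from the chain rule, and summing the pure second ones gives the
equation for \<open>rad N\<close>.
\<close>

lemma radial_profile_eigenfunction:
  assumes N: "N = CARD('n::finite)" "2 \<le> N" and R: "0 < R" and z: "rad N (m * R\<^sup>2) = 0"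
  shows "radial_eigenvalue TYPE('n) R m"
proof -
  have N1: "1 \<le> N" using N by simp
  define u :: "real^'n \<Rightarrow> real" where "u x = rad N (m * (x \<bullet> x))" for x
  define u1 :: "'n \<Rightarrow> real^'n \<Rightarrow> real" where "u1 i x = rad_d N (m * (x \<bullet> x)) * (2 * m * x $ i)" for i x
  define u2 :: "'n \<Rightarrow> 'n \<Rightarrow> real^'n \<Rightarrow> real" where
    "u2 i j x = rad_d N (m * (x \<bullet> x)) * (2 * m * (if i = j then 1 else 0))
       + rad_dd N (m * (x \<bullet> x)) * (2 * m * x $ j) * (2 * m * x $ i)" for i j x
  have d1: "((\<lambda>t. u (x + t *\<^sub>R axis i 1)) has_real_derivative u1 i x) (at 0)" for i x
    unfolding u_def u1_def by (rule line_deriv_quadratic[OF rad_deriv[OF N1]])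
  have d2: "((\<lambda>t. u1 i (x + t *\<^sub>R axis j 1)) has_real_derivative u2 i j x) (at 0)" for i j x
  proof -
    have "((\<lambda>t. 2 * m * (x + t *\<^sub>R axis j 1) $ i) has_real_derivative 2 * m * (if i = j then 1 else 0)) (at 0)"
      by (auto intro!: derivative_eq_intros simp: axis_def)
    from DERIV_mult'[OF line_deriv_quadratic[OF rad_d_deriv[OF N1], of m x j] this]
    show ?thesis unfolding u1_def u2_def by simp
  qed
  have p1: "partial i u = u1 i" for i using partial_eqI(1)[OF d1] by blast
  have p2: "partial j (u1 i) = u2 i j" for i j using partial_eqI(1)[OF d2] by blast
  have cF: "continuous_on S (\<lambda>x. f (m * (x \<bullet> x)))" if "continuous_on UNIV f" for f :: "real \<Rightarrow> real" and S :: "(real^'n) set"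
    by (rule continuous_on_compose2[OF that]) (auto intro!: continuous_intros)
  have c0: "continuous_on UNIV (rad N)" "continuous_on UNIV (rad_d N)" "continuous_on UNIV (rad_dd N)"
    using rad_deriv[OF N1] rad_d_deriv[OF N1] rad_dd_cont[OF N1]
    by (auto intro!: continuous_at_imp_continuous_on intro: DERIV_isCont)
  have cu: "continuous_on S u" and cu1: "continuous_on S (u1 i)" and cu2: "continuous_on S (u2 i j)" for S i j
    unfolding u_def[abs_def] u1_def[abs_def] u2_def[abs_def]
    by (intro continuous_intros cF[OF c0(1)] cF[OF c0(2)] cF[OF c0(3)])+
  have C2: "C2_on (ball 0 R) u"
    unfolding C2_on_def C1_on_def p1 p2
    using cu cu1 cu2 partial_eqI(2)[OF d1] partial_eqI(2)[OF d2] by blast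
  have lap: "- laplacian u x = m * u x" for x
  proof -
    have sq: "x \<bullet> x = (\<Sum>i\<in>UNIV. (x $ i)\<^sup>2)" by (simp add: inner_vec_def power2_eq_square)
    have "laplacian u x = (\<Sum>i\<in>UNIV. u2 i i x)" by (simp add: laplacian_def p1 p2)
    also have "\<dots> = (\<Sum>i\<in>UNIV. 2 * m * rad_d N (m * (x \<bullet> x)) + 4 * m * (m * rad_dd N (m * (x \<bullet> x))) * (x $ i)\<^sup>2)"
      by (intro sum.cong refl) (simp add: u2_def power2_eq_square algebra_simps)
    also have "\<dots> = real N * (2 * m * rad_d N (m * (x \<bullet> x))) + 4 * m * (m * rad_dd N (m * (x \<bullet> x))) * (x \<bullet> x)"
      unfolding sum.distrib sum_distrib_left[symmetric] sq[symmetric] N(1) by simp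
    also have "\<dots> = m * (4 * (m * (x \<bullet> x)) * rad_dd N (m * (x \<bullet> x)) + 2 * real N * rad_d N (m * (x \<bullet> x)))"
      by (simp add: algebra_simps)
    also have "\<dots> = m * (- rad N (m * (x \<bullet> x)))"
    proof -
      have "4 * (m * (x \<bullet> x)) * rad_dd N (m * (x \<bullet> x)) + 2 * real N * rad_d N (m * (x \<bullet> x)) = - rad N (m * (x \<bullet> x))"
        using rad_ode[OF N1, of "m * (x \<bullet> x)"] by linarith
      then show ?thesis by simp
    qed
    finally show ?thesis by (simp add: u_def)
  qed
  have "dirichlet_eigenfunction R m u"
    unfolding dirichlet_eigenfunction_def
  proof (intro conjI ballI cu C2 lap)
    fix x :: "real^'n" assume "x \<in> sphere 0 R"
    then have "x \<bullet> x = R\<^sup>2" by (simp add: dot_square_norm)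
    then show "u x = 0" using z by (simp add: u_def)
  next
    show "\<exists>x\<in>ball 0 R. u x \<noteq> 0" using R by (intro bexI[of _ 0]) (auto simp: u_def)
  qed
  moreover have "radial_on (cball 0 R) u"
    by (auto simp: radial_on_def u_def dot_square_norm)
  ultimately show ?thesis unfolding radial_eigenvalue_def by blast
qed

text \<open>
The energy \<open>h\<^sup>2 + y\<^sup>2\<close> starts at \<open>0\<close>, and the singular damping term only decreases it.
\<close>

lemma radial_ode_unique:
  fixes h y :: "real \<Rightarrow> real"
  assumes c: "continuous_on {0..b} h" "continuous_on {0..b} y"
    and h: "\<And>r. 0 < r \<Longrightarrow> r < b \<Longrightarrow> (h has_real_derivative y r) (at r)"
    and y: "\<And>r. 0 < r \<Longrightarrow> r < b \<Longrightarrow> (y has_real_derivative (- m * h r - k / r * y r)) (at r)"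
    and k: "0 \<le> k" and 0: "h 0 = 0" "y 0 = 0" and r: "r \<in> {0..b}"
  shows "h r = 0"
proof -
  define E where "E r = (h r)\<^sup>2 + (y r)\<^sup>2" for r
  define E' where "E' r = 2 * h r * y r + 2 * y r * (- m * h r - k / r * y r)" for r
  have "E r \<le> 0"
  proof (rule gronwall_zero[where E = E and E' = E' and K = "1 + \<bar>m\<bar>" and a = 0])
    show "continuous_on {0..r} E" unfolding E_def[abs_def]
      using r by (intro continuous_intros continuous_on_subset[OF c(1)] continuous_on_subset[OF c(2)]) auto
    fix x assume x: "0 < x" "x < r"
    then have x': "0 < x" "x < b" using r by auto
    show "(E has_real_derivative E' x) (at x)"
      unfolding E_def[abs_def] E'_def by (auto intro!: derivative_eq_intros h[OF x'] y[OF x'])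
    have "E' x = (1 - m) * (2 * h x * y x) - 2 * (k / x) * (y x)\<^sup>2"
      by (simp add: E'_def power2_eq_square algebra_simps)
    also have "\<dots> \<le> (1 - m) * (2 * h x * y x)" using k x by simp
    also have "\<dots> \<le> \<bar>1 - m\<bar> * \<bar>2 * h x * y x\<bar>" by (metis abs_ge_self abs_mult)
    also have "\<dots> \<le> (1 + \<bar>m\<bar>) * E x"
    proof (rule mult_mono)
      have "2 * \<bar>h x\<bar> * \<bar>y x\<bar> \<le> E x"
        using zero_le_power2[of "\<bar>h x\<bar> - \<bar>y x\<bar>"] by (simp add: E_def power2_diff)
      then show "\<bar>2 * h x * y x\<bar> \<le> E x" by (simp add: abs_mult)
    qed auto
    finally show "E' x \<le> (1 + \<bar>m\<bar>) * E x" .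
  qed (use 0 r in \<open>auto simp: E_def\<close>)
  moreover have "0 \<le> (h r)\<^sup>2" "0 \<le> (y r)\<^sup>2" by auto
  ultimately have "(h r)\<^sup>2 = 0" unfolding E_def by linarith
  then show ?thesis by simp
qed

text \<open>
Restrict a radial eigenfunction to a coordinate axis. The restriction \<open>f\<close> is even, so its derivative
vanishes at \<open>0\<close>. The second derivative along the axis is \<open>f''\<close>, and each of the other \<open>N - 1\<close> second
derivatives is \<open>f' / r\<close>, since moving orthogonally to the axis changes the norm only to second
order. Hence \<open>f\<close> solves the radial equation and equals \<open>f 0\<close> times the explicit profile; the
boundary condition makes the profile vanish at \<open>R\<close>.
\<close>

lemma eigenvalue_profile_zero:
  assumes N: "N = CARD('n::finite)" "2 \<le> N" and R: "0 < R" and ev: "radial_eigenvalue TYPE('n) R m"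
  shows "rad N (m * R\<^sup>2) = 0"
proof -
  have N1: "1 \<le> N" using N by simp
  obtain u :: "real^'n \<Rightarrow> real" where u: "dirichlet_eigenfunction R m u" and rd: "radial_on (cball 0 R) u"
    using ev unfolding radial_eigenvalue_def by blast
  have cu: "continuous_on (cball 0 R) u" and C2: "C2_on (ball 0 R) u"
    and lap: "\<And>x. x \<in> ball 0 R \<Longrightarrow> - laplacian u x = m * u x"
    and bd: "\<And>x. x \<in> sphere 0 R \<Longrightarrow> u x = 0" and nz: "\<exists>x\<in>ball 0 R. u x \<noteq> 0"
    using u unfolding dirichlet_eigenfunction_def by blast+
  have rad_eq: "u x = u y" if "norm x = norm y" "norm x \<le> R" for x y
    using rd[unfolded radial_on_def, rule_format, of x y] that by simp
  have diff1: "(\<lambda>t. u (x + t *\<^sub>R axis i 1)) differentiable (at 0)" if "x \<in> ball 0 R" for x i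
    using C2[unfolded C2_on_def C1_on_def] that by simp
  have diff2: "(\<lambda>t. partial i u (x + t *\<^sub>R axis j 1)) differentiable (at 0)" if "x \<in> ball 0 R" for x i j
    using C2[unfolded C2_on_def C1_on_def] that by simp
  define i0 :: 'n where "i0 = undefined"
  define e :: "real^'n" where "e = axis i0 1"
  have ne1 [simp]: "norm e = 1" by (simp add: e_def)
  have ne: "norm (t *\<^sub>R e) = \<bar>t\<bar>" for t by simp
  define f where "f t = u (t *\<^sub>R e)" for t
  define f1 where "f1 t = partial i0 u (t *\<^sub>R e)" for t
  define f2 where "f2 t = partial i0 (partial i0 u) (t *\<^sub>R e)" for t
  have line: "(g has_real_derivative D) (at t)"
    if "((\<lambda>s. g (t + s)) has_real_derivative D) (at 0)" for g :: "real \<Rightarrow> real" and D t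
    using that DERIV_shift[of g D 0 t] by (simp add: add.commute)
  have te: "t *\<^sub>R e + s *\<^sub>R axis i0 1 = (t + s) *\<^sub>R e" for t s by (simp add: e_def algebra_simps)
  have inball: "t *\<^sub>R e \<in> ball 0 R" if "\<bar>t\<bar> < R" for t using that by (simp add: ne)
  have fd: "(f has_real_derivative f1 t) (at t)" if "\<bar>t\<bar> < R" for t
    by (rule line) (use diff1[OF inball[OF that], of i0] in
        \<open>auto simp: f_def f1_def te partial_def DERIV_deriv_iff_real_differentiable\<close>)
  have f1d: "(f1 has_real_derivative f2 t) (at t)" if "\<bar>t\<bar> < R" for t
    by (rule line) (use diff2[OF inball[OF that], of i0 i0] in
        \<open>auto simp: f1_def f2_def te partial_def[of i0 "partial i0 u"] DERIV_deriv_iff_real_differentiable\<close>)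
  have even: "f (- t) = f t" if "\<bar>t\<bar> < R" for t
    unfolding f_def by (rule rad_eq) (use that in \<open>simp_all add: ne del: scaleR_minus_left\<close>)
  have u_f: "u x = f (norm x)" if "norm x \<le> R" for x
    unfolding f_def by (rule rad_eq) (use that in \<open>simp_all add: ne\<close>)
  have f10: "f1 0 = 0"
  proof -
    have "((\<lambda>t. f (- t)) has_real_derivative - f1 0) (at 0)"
      using DERIV_chain2[of f "f1 0" "\<lambda>t. - t" 0 "- 1"] fd[of 0] R
      by (simp add: DERIV_minus[OF DERIV_ident])
    moreover have "\<forall>\<^sub>F t in nhds 0. f (- t) = f t"
    proof -
      have "\<forall>\<^sub>F t in nhds 0. t \<in> ball 0 R" using R by (intro eventually_nhds_in_open) auto
      then show ?thesis by eventually_elim (auto simp: even)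
    qed
    ultimately have "(f has_real_derivative - f1 0) (at 0)" by (rule has_real_derivative_transfer)
    moreover have "(f has_real_derivative f1 0) (at 0)" using fd[of 0] R by simp
    ultimately have "f1 0 = - f1 0" using DERIV_unique by metis
    then show ?thesis by simp
  qed
  have side: "partial i (partial i u) (r *\<^sub>R e) = f1 r / r" if r: "0 < r" "r < R" and i: "i \<noteq> i0" for r i
  proof -
    \<comment> \<open>Norm of the point at distance \<open>s\<close> from \<open>r *\<^sub>R e\<close> in the direction \<open>i\<close>.\<close>
    define \<rho> where "\<rho> s = sqrt (r\<^sup>2 + s\<^sup>2)" for s
    have \<rho>0: "\<rho> 0 = r" using r by (simp add: \<rho>_def)
    have \<rho>pos: "0 < \<rho> s" for s using r by (simp add: \<rho>_def add_pos_nonneg)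
    have \<rho>d: "(\<rho> has_real_derivative s / \<rho> s) (at s)" for s
    proof -
      have p: "0 < r\<^sup>2 + s\<^sup>2" using r by (simp add: add_pos_nonneg)
      have "((\<lambda>s. r\<^sup>2 + s\<^sup>2) has_real_derivative 2 * s) (at s)"
        by (auto intro!: derivative_eq_intros)
      from DERIV_chain2[OF DERIV_real_sqrt[OF p] this]
      have "((\<lambda>s. sqrt (r\<^sup>2 + s\<^sup>2)) has_real_derivative inverse (sqrt (r\<^sup>2 + s\<^sup>2)) / 2 * (2 * s)) (at s)" .
      moreover have "inverse q / 2 * (2 * s) = s / q" for q :: real by (simp only: divide_inverse) algebra
      ultimately show ?thesis unfolding \<rho>_def[abs_def] by (simp only:)
    qed
    have nrm: "norm (r *\<^sub>R e + s *\<^sub>R axis i 1) = \<rho> s" for s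
    proof -
      have "(r *\<^sub>R e + s *\<^sub>R axis i 1) \<bullet> (r *\<^sub>R e + s *\<^sub>R axis i 1) = r\<^sup>2 + s\<^sup>2"
        using i by (simp add: e_def inner_add_left inner_add_right inner_axis_axis power2_eq_square)
      then show ?thesis by (simp add: norm_eq_sqrt_inner \<rho>_def)
    qed
    have op: "open {s. \<rho> s < R}"
      unfolding \<rho>_def by (intro open_Collect_less continuous_intros)
    have near: "\<forall>\<^sub>F s in nhds s0. \<rho> s < R" if "\<rho> s0 < R" for s0
      using eventually_nhds_in_open[OF op, of s0] that by simp
    have u_line: "u (r *\<^sub>R e + s *\<^sub>R axis i 1) = f (\<rho> s)" if "\<rho> s < R" for s
      using u_f[of "r *\<^sub>R e + s *\<^sub>R axis i 1"] that by (simp add: nrm)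
    have p1: "partial i u (r *\<^sub>R e + s *\<^sub>R axis i 1) = f1 (\<rho> s) * (s / \<rho> s)" if s: "\<rho> s < R" for s
    proof (rule partial_eqI(1))
      have "((\<lambda>t. f (\<rho> t)) has_real_derivative f1 (\<rho> s) * (s / \<rho> s)) (at s)"
        by (rule DERIV_chain2[OF fd \<rho>d]) (use s \<rho>pos[of s] in simp)
      then have "((\<lambda>t. u (r *\<^sub>R e + t *\<^sub>R axis i 1)) has_real_derivative f1 (\<rho> s) * (s / \<rho> s)) (at s)"
        by (rule has_real_derivative_transfer)
          (rule eventually_mono[OF near[OF s]], simp add: u_line)
      then show "((\<lambda>t. u (r *\<^sub>R e + s *\<^sub>R axis i 1 + t *\<^sub>R axis i 1)) has_real_derivative f1 (\<rho> s) * (s / \<rho> s)) (at 0)"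
        using DERIV_shift[of "\<lambda>t. u (r *\<^sub>R e + t *\<^sub>R axis i 1)" _ 0 s]
        by (simp add: algebra_simps)
    qed
    have "((\<lambda>s. f1 (\<rho> s) / \<rho> s * s) has_real_derivative f1 r / r) (at 0)"
    proof -
      have "isCont (\<lambda>s. f1 (\<rho> s) / \<rho> s) 0"
      proof (intro continuous_intros)
        have "isCont f1 (\<rho> 0)" using f1d[of r] r by (auto simp: \<rho>0 intro: DERIV_isCont)
        then show "isCont (\<lambda>s. f1 (\<rho> s)) 0"
          using isCont_o2[OF DERIV_isCont[OF \<rho>d]] by blast
        show "isCont \<rho> 0" by (rule DERIV_isCont[OF \<rho>d])
        show "\<rho> 0 \<noteq> 0" using \<rho>pos[of 0] by simp
      qed
      then show ?thesis
        unfolding CARAT_DERIV by (intro exI[of _ "\<lambda>s. f1 (\<rho> s) / \<rho> s"]) (simp add: \<rho>0)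
    qed
    then have "((\<lambda>s. partial i u (r *\<^sub>R e + s *\<^sub>R axis i 1)) has_real_derivative f1 r / r) (at 0)"
    proof (rule has_real_derivative_transfer)
      have "\<rho> 0 < R" using r \<rho>0 by simp
      from near[OF this] show "\<forall>\<^sub>F s in nhds 0. f1 (\<rho> s) / \<rho> s * s = partial i u (r *\<^sub>R e + s *\<^sub>R axis i 1)"
        by (rule eventually_mono) (simp add: p1)
    qed
    then show ?thesis by (rule partial_eqI(1))
  qed
  have ode: "f2 r = - m * f r - real (N - 1) / r * f1 r" if r: "0 < r" "r < R" for r
  proof -
    have "laplacian u (r *\<^sub>R e) = f2 r + (\<Sum>i\<in>UNIV - {i0}. partial i (partial i u) (r *\<^sub>R e))"
      unfolding laplacian_def f2_def by (subst sum.remove[of _ i0]) auto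
    also have "(\<Sum>i\<in>UNIV - {i0}. partial i (partial i u) (r *\<^sub>R e)) = (\<Sum>i\<in>UNIV - {i0}. f1 r / r)"
      by (intro sum.cong refl side r) auto
    also have "\<dots> = real (N - 1) / r * f1 r" by (simp add: N(1) card_Diff_singleton)
    finally show ?thesis using lap[of "r *\<^sub>R e"] inball[of r] r by (simp add: f_def)
  qed
  define w where "w r = rad N (m * r\<^sup>2)" for r
  define w1 where "w1 r = 2 * m * r * rad_d N (m * r\<^sup>2)" for r
  have wd: "(w has_real_derivative w1 r) (at r)" for r
    unfolding w_def[abs_def] w1_def by (rule rad_profile_deriv[OF N1])
  have w1d: "(w1 has_real_derivative (- m * w r - real (N - 1) / r * w1 r)) (at r)" if "r \<noteq> 0" for r
    unfolding w1_def[abs_def] w_def by (rule rad_profile_deriv2[OF N1 that])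
  have f_w: "f r = f 0 * w r" if r: "0 \<le> r" "r < R" for r
  proof -
    have "f r - f 0 * w r = 0"
    proof (rule radial_ode_unique[where h = "\<lambda>r. f r - f 0 * w r" and y = "\<lambda>r. f1 r - f 0 * w1 r"
          and b = r and m = m and k = "real (N - 1)"])
      show "continuous_on {0..r} (\<lambda>r. f r - f 0 * w r)"
        using r by (intro continuous_at_imp_continuous_on ballI continuous_intros
            DERIV_isCont[OF fd] DERIV_isCont[OF wd]) auto
      show "continuous_on {0..r} (\<lambda>r. f1 r - f 0 * w1 r)"
      proof (intro continuous_at_imp_continuous_on ballI continuous_intros)
        fix x assume x: "x \<in> {0..r}"
        show "isCont f1 x" using x r by (intro DERIV_isCont[OF f1d]) auto
        have "isCont (\<lambda>r. rad_d N (m * r\<^sup>2)) x"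
          by (intro isCont_o2[OF _ DERIV_isCont[OF rad_d_deriv[OF N1]]] continuous_intros)
        then show "isCont w1 x" unfolding w1_def[abs_def] by (intro continuous_intros)
      qed
      fix x assume x: "0 < x" "x < r"
      show "((\<lambda>r. f r - f 0 * w r) has_real_derivative (f1 x - f 0 * w1 x)) (at x)"
        using x r by (intro DERIV_diff DERIV_cmult fd wd) auto
      have "((\<lambda>r. f1 r - f 0 * w1 r) has_real_derivative f2 x - f 0 * (- m * w x - real (N - 1) / x * w1 x)) (at x)"
        using x r by (intro DERIV_diff DERIV_cmult f1d w1d) auto
      then show "((\<lambda>r. f1 r - f 0 * w1 r) has_real_derivative - m * (f x - f 0 * w x) - real (N - 1) / x * (f1 x - f 0 * w1 x)) (at x)"
        using ode[of x] x r by (simp add: algebra_simps)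
    qed (use r f10 in \<open>auto simp: w_def w1_def\<close>)
    then show ?thesis by simp
  qed
  have "f 0 \<noteq> 0"
  proof
    assume "f 0 = 0"
    then have "u x = 0" if "x \<in> ball 0 R" for x using u_f[of x] f_w[of "norm x"] that by simp
    then show False using nz by blast
  qed
  moreover have "f 0 * w R = 0"
  proof -
    have "continuous_on {0..R} f" unfolding f_def[abs_def]
      by (rule continuous_on_compose2[OF cu]) (auto intro!: continuous_intros simp: ne)
    moreover have "continuous_on {0..R} w"
      by (intro continuous_at_imp_continuous_on ballI DERIV_isCont[OF wd])
    ultimately have "continuous_on {0..R} (\<lambda>r. f r - f 0 * w r)" by (intro continuous_intros)
    moreover have cl: "closure {0..<R} = {0..R}" using R by simp
    ultimately have "continuous_on (closure {0..<R}) (\<lambda>r. f r - f 0 * w r)" by simp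
    moreover have "f x - f 0 * w x = 0" if "x \<in> {0..<R}" for x using f_w[of x] that by simp
    moreover have "R \<in> closure {0..<R}" using cl R by simp
    ultimately have "f R - f 0 * w R = 0"
      using continuous_constant_on_closure[of "{0..<R}" "\<lambda>r. f r - f 0 * w r" 0 R] by blast
    moreover have "f R = 0" unfolding f_def using R by (intro bd) (simp add: ne)
    ultimately show ?thesis by simp
  qed
  ultimately show ?thesis by (simp add: w_def)
qed

text \<open>
Induction on \<open>k\<close>, passing to the next element of \<open>S\<close>. It starts at \<open>k = 0\<close> with a number
below all of \<open>S\<close>, which need not be an element.
\<close>

lemma counting_enumeration:
  fixes S :: "real set"
  assumes fin: "\<And>T. finite {s \<in> S. s \<le> T}" and unb: "\<And>T. \<exists>s\<in>S. T < s"
  shows "\<exists>m. (k \<noteq> 0 \<longrightarrow> m \<in> S) \<and> card {s \<in> S. s \<le> m} = k"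
proof (induction k)
  case 0
  obtain s where s: "s \<in> S" using unb by blast
  define m where "m = Min {x \<in> S. x \<le> s} - 1"
  have "{x \<in> S. x \<le> m} = {}"
  proof (rule equals0I)
    fix x assume x: "x \<in> {x \<in> S. x \<le> m}"
    have "Min {x \<in> S. x \<le> s} \<le> s" using s by (intro Min_le fin) simp
    then have "x \<in> {x \<in> S. x \<le> s}" using x by (simp add: m_def)
    then have "Min {x \<in> S. x \<le> s} \<le> x" by (intro Min_le fin)
    with x show False by (simp add: m_def)
  qed
  then show ?case by (metis card.empty)
next
  case (Suc k)
  then obtain m where m: "card {s \<in> S. s \<le> m} = k" by blast
  obtain s where s: "s \<in> S" "m < s" using unb by blast
  let ?A = "{x \<in> S. m < x \<and> x \<le> s}"
  have fA: "finite ?A" by (rule finite_subset[OF _ fin[of s]]) auto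
  define m' where "m' = Min ?A"
  have m': "m' \<in> ?A" unfolding m'_def using s by (intro Min_in fA) auto
  have "{x \<in> S. x \<le> m'} = insert m' {x \<in> S. x \<le> m}"
  proof (intro set_eqI iffI)
    fix x assume x: "x \<in> {x \<in> S. x \<le> m'}"
    show "x \<in> insert m' {x \<in> S. x \<le> m}"
    proof (cases "x \<le> m")
      case False
      then have "m' \<le> x" unfolding m'_def using x m' by (intro Min_le fA) auto
      then show ?thesis using x by simp
    qed (use x in simp)
  qed (use m' in auto)
  then have "card {x \<in> S. x \<le> m'} = Suc k" using m fin[of m] m' by simp
  then show ?case using m' by blast
qed

lemma radial_eigenvalue_iff:
  assumes "N = CARD('n::finite)" "2 \<le> N" "0 < R"
  shows "radial_eigenvalue TYPE('n) R m \<longleftrightarrow> rad N (m * R\<^sup>2) = 0"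
  using eigenvalue_profile_zero radial_profile_eigenfunction assms by blast

lemma finite_radial_eigenvalues:
  assumes "2 \<le> N" "0 < R"
  shows "finite {m. rad N (m * R\<^sup>2) = 0 \<and> m \<le> T}"
proof (rule finite_imageD)
  show "finite ((\<lambda>m. m * R\<^sup>2) ` {m. rad N (m * R\<^sup>2) = 0 \<and> m \<le> T})"
    by (rule finite_subset[OF _ rad_finite_zeros[OF assms(1), of "T * R\<^sup>2"]]) (auto simp: mult_right_mono)
  show "inj_on (\<lambda>m. m * R\<^sup>2) {m. rad N (m * R\<^sup>2) = 0 \<and> m \<le> T}" using assms by (intro inj_onI) simp
qed

lemma lambda_rad:
  assumes N: "N = CARD('n::finite)" "2 \<le> N" and R: "0 < R" and k: "k \<noteq> 0"
  shows "rad N (lambda_rad TYPE('n) R k * R\<^sup>2) = 0"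
    and "card {m. rad N (m * R\<^sup>2) = 0 \<and> m \<le> lambda_rad TYPE('n) R k} = k"
proof -
  define S where "S = {m. rad N (m * R\<^sup>2) = 0}"
  have fin: "finite {m \<in> S. m \<le> T}" for T
    using finite_radial_eigenvalues[OF N(2) R] by (simp add: S_def)
  have unb: "\<exists>m\<in>S. T < m" for T
  proof -
    obtain t where "T * R\<^sup>2 < t" "rad N t = 0" using rad_zeros_unbounded[OF N(2)] by blast
    then show ?thesis using R by (intro bexI[of _ "t / R\<^sup>2"]) (auto simp: S_def field_simps)
  qed
  obtain m where m: "m \<in> S" "card {s \<in> S. s \<le> m} = k" using counting_enumeration[OF fin unb, of k] k by blast
  have uniq: "m' = m" if "m' \<in> S" "card {s \<in> S. s \<le> m'} = k" for m'
  proof (rule ccontr)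
    have strict: "card {s \<in> S. s \<le> x} < card {s \<in> S. s \<le> y}" if "x < y" "y \<in> S" for x y
    proof (rule psubset_card_mono[OF fin])
      have "y \<in> {s \<in> S. s \<le> y}" "y \<notin> {s \<in> S. s \<le> x}" "{s \<in> S. s \<le> x} \<subseteq> {s \<in> S. s \<le> y}"
        using that by auto
      then show "{s \<in> S. s \<le> x} \<subset> {s \<in> S. s \<le> y}" by blast
    qed
    assume "m' \<noteq> m"
    then consider "m < m'" | "m' < m" by linarith
    then show False using strict m that by cases fastforce+
  qed
  have "lambda_rad TYPE('n) R k = (THE m. m \<in> S \<and> card {s \<in> S. s \<le> m} = k)"
    using k by (simp add: lambda_rad_def radial_eigenvalue_iff[OF N R] S_def)
  also have "\<dots> = m"
  proof (rule the_equality)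
    show "m \<in> S \<and> card {s \<in> S. s \<le> m} = k" using m by (rule conjI)
    show "m' = m" if "m' \<in> S \<and> card {s \<in> S. s \<le> m'} = k" for m'
      by (rule uniq[OF conjunct1[OF that] conjunct2[OF that]])
  qed
  finally have eq: "lambda_rad TYPE('n) R k = m" .
  show "rad N (lambda_rad TYPE('n) R k * R\<^sup>2) = 0" using m(1) unfolding eq S_def by simp
  show "card {m. rad N (m * R\<^sup>2) = 0 \<and> m \<le> lambda_rad TYPE('n) R k} = k"
    using m(2) unfolding eq S_def by simp
qed

lemma lambda_rad_mono:
  assumes N: "N = CARD('n::finite)" "2 \<le> N" and R: "0 < R" and k: "1 \<le> k" "k < k'"
  shows "lambda_rad TYPE('n) R k < lambda_rad TYPE('n) R k'"
proof (rule ccontr)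
  let ?A = "\<lambda>T. {m. rad N (m * R\<^sup>2) = 0 \<and> m \<le> T}"
  assume "\<not> ?thesis"
  then have "card (?A (lambda_rad TYPE('n) R k')) \<le> card (?A (lambda_rad TYPE('n) R k))"
    by (intro card_mono finite_radial_eigenvalues N R) auto
  then show False using lambda_rad(2)[OF N R, of k] lambda_rad(2)[OF N R, of k'] k by simp
qed

lemma card_eigenvalues_below:
  assumes N: "N = CARD('n::finite)" "2 \<le> N" and R: "0 < R" and lam: "lam < lambda_rad TYPE('n) R (k + 1)"
  shows "card {m. rad N (m * R\<^sup>2) = 0 \<and> m \<le> lam} \<le> k"
proof -
  let ?L = "lambda_rad TYPE('n) R (k + 1)"
  have "card {m. rad N (m * R\<^sup>2) = 0 \<and> m \<le> lam} < card {m. rad N (m * R\<^sup>2) = 0 \<and> m \<le> ?L}"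
  proof (rule psubset_card_mono[OF finite_radial_eigenvalues[OF N(2) R]])
    have "?L \<in> {m. rad N (m * R\<^sup>2) = 0 \<and> m \<le> ?L}" "?L \<notin> {m. rad N (m * R\<^sup>2) = 0 \<and> m \<le> lam}"
      "{m. rad N (m * R\<^sup>2) = 0 \<and> m \<le> lam} \<subseteq> {m. rad N (m * R\<^sup>2) = 0 \<and> m \<le> ?L}"
      using lambda_rad(1)[OF N R, of "k + 1"] lam by auto
    then show "{m. rad N (m * R\<^sup>2) = 0 \<and> m \<le> lam} \<subset> {m. rad N (m * R\<^sup>2) = 0 \<and> m \<le> ?L}" by blast
  qed
  then show ?thesis using lambda_rad(2)[OF N R, of "k + 1"] by simp
qed

section \<open>The shooting family\<close>

locale minkowski_problem =
  fixes N :: nat and R \<delta> \<gamma> C1 C2 q0 :: real and g q :: "real \<Rightarrow> real"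
  assumes N: "2 \<le> N" and R: "0 < R"
    and g1: "\<forall>x. \<exists>e>0. \<exists>L. L-lipschitz_on (ball x e) g"
    and \<delta>: "0 < \<delta>" and \<gamma>: "2 < \<gamma>" and C1: "0 < C1"
    and g2: "\<And>s. s \<in> {-\<delta><..<\<delta>} \<Longrightarrow> C1 * \<bar>s\<bar> powr \<gamma> \<le> g s * s \<and> g s * s \<le> C2 * \<bar>s\<bar> powr \<gamma>"
    and q_cont: "continuous_on {0..R} q" and q_ge: "\<And>r. r \<in> {0..R} \<Longrightarrow> q0 \<le> q r" and q0: "0 < q0"
begin

text \<open>
Profiles start at most at height \<open>R\<close> and have slope less than \<open>1\<close>, so they never leave the range
\<open>\<bar>y\<bar> \<le> 2 * R\<close>; truncating \<open>g\<close> there makes it globally Lipschitz without changing any profile.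
\<close>

definition gc :: "real \<Rightarrow> real" where "gc y = g (max (- (2 * R)) (min (2 * R) y))"
definition qc :: "real \<Rightarrow> real" where "qc r = q (max 0 (min R r))"
text \<open>
The value \<open>0\<close> at the origin is the limit of \<open>g y / y\<close>, by the growth condition with \<open>\<gamma> > 2\<close>.
\<close>

definition ratio :: "real \<Rightarrow> real" where "ratio y = (if y = 0 then 0 else gc y / y)"
text \<open>
The right-hand side of the equation for \<open>u = d * x\<close>, divided by \<open>d\<close>. Writing \<open>g (d * x) / d\<close> as
\<open>x * ratio (d * x)\<close> makes it continuous at \<open>d = 0\<close>, where only the linear term remains.
\<close>

definition rhs :: "real \<Rightarrow> real \<Rightarrow> real \<Rightarrow> real \<Rightarrow> real \<Rightarrow> real" where
  "rhs lam mu d r x = lam * x + mu * qc r * (x * ratio (d * x))"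

lemma gc_eq: "\<bar>y\<bar> \<le> 2 * R \<Longrightarrow> gc y = g y"
  by (simp add: gc_def abs_le_iff max_absorb2 min_absorb2)

lemma qc_eq: "r \<in> {0..R} \<Longrightarrow> qc r = q r"
  by (simp add: qc_def max_absorb2 min_absorb2)

lemma gc_lipschitz: "\<exists>L\<ge>0. \<forall>x y. \<bar>gc x - gc y\<bar> \<le> L * \<bar>x - y\<bar>"
proof -
  obtain L where L: "L-lipschitz_on {- (2 * R)..2 * R} g"
    using locally_lipschitz_imp_lipschitz_on_compact[OF g1 compact_Icc] by blast
  have "\<bar>gc x - gc y\<bar> \<le> L * \<bar>x - y\<bar>" for x y
  proof -
    let ?c = "\<lambda>y. max (- (2 * R)) (min (2 * R) y)"
    have "\<bar>gc x - gc y\<bar> \<le> L * \<bar>?c x - ?c y\<bar>"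
      using lipschitz_onD[OF L, of "?c x" "?c y"] R by (simp add: gc_def dist_real_def)
    also have "\<dots> \<le> L * \<bar>x - y\<bar>"
      using lipschitz_on_nonneg[OF L] by (intro mult_left_mono) auto
    finally show ?thesis .
  qed
  then show ?thesis using lipschitz_on_nonneg[OF L] by blast
qed

lemma gc_cont: "isCont gc y"
proof -
  obtain L where L: "L \<ge> 0" "\<And>x y. \<bar>gc x - gc y\<bar> \<le> L * \<bar>x - y\<bar>" using gc_lipschitz by blast
  then have "L-lipschitz_on UNIV gc" by (intro lipschitz_onI) (auto simp: dist_real_def)
  then show ?thesis using lipschitz_on_continuous_on continuous_on_eq_continuous_at by blast
qed

lemma g_bounds:
  assumes "0 < s" "s < \<delta>"
  shows "C1 * s powr (\<gamma> - 1) \<le> g s" "g s \<le> C2 * s powr (\<gamma> - 1)"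
    "C1 * s powr (\<gamma> - 1) \<le> - g (- s)" "- g (- s) \<le> C2 * s powr (\<gamma> - 1)"
proof -
  have e: "s powr \<gamma> = s powr (\<gamma> - 1) * s" using assms powr_mult_base[of s "\<gamma> - 1"] by (simp add: mult.commute)
  have "(C1 * s powr (\<gamma> - 1)) * s \<le> g s * s" "g s * s \<le> (C2 * s powr (\<gamma> - 1)) * s"
    using g2[of s] assms by (simp_all add: e mult.assoc)
  then show "C1 * s powr (\<gamma> - 1) \<le> g s" "g s \<le> C2 * s powr (\<gamma> - 1)" using assms by simp_all
  have "(C1 * s powr (\<gamma> - 1)) * s \<le> - g (- s) * s" "- g (- s) * s \<le> (C2 * s powr (\<gamma> - 1)) * s"
    using g2[of "- s"] assms by (simp_all add: e mult.assoc)
  then show "C1 * s powr (\<gamma> - 1) \<le> - g (- s)" "- g (- s) \<le> C2 * s powr (\<gamma> - 1)" using assms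
    by (metis mult_le_cancel_right_pos)+
qed

lemma C2_pos: "0 < C2"
proof -
  have "0 < C1 * (\<delta> / 2) powr (\<gamma> - 1)" using C1 \<delta> by simp
  also have "\<dots> \<le> C2 * (\<delta> / 2) powr (\<gamma> - 1)" 
    by (rule order_trans[OF g_bounds(1,2)]) (use \<delta> in auto)
  finally show ?thesis using \<delta> by (simp add: zero_less_mult_iff)
qed

lemma ratio_small:
  assumes "\<bar>y\<bar> < min \<delta> (2 * R)" "y \<noteq> 0"
  shows "\<bar>ratio y\<bar> \<le> C2 * \<bar>y\<bar> powr (\<gamma> - 2)"
proof -
  have p: "0 \<le> C1 * \<bar>y\<bar> powr (\<gamma> - 1)" using C1 by simp
  have "\<bar>g y\<bar> \<le> C2 * \<bar>y\<bar> powr (\<gamma> - 1)"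
    using g_bounds[of "\<bar>y\<bar>"] assms p by (cases "0 < y") auto
  also have "\<bar>y\<bar> powr (\<gamma> - 1) = \<bar>y\<bar> powr (\<gamma> - 2) * \<bar>y\<bar>"
    using powr_mult_base[of "\<bar>y\<bar>" "\<gamma> - 2"] by (simp add: mult.commute)
  finally have "\<bar>g y\<bar> / \<bar>y\<bar> \<le> C2 * \<bar>y\<bar> powr (\<gamma> - 2)" using assms by (simp add: divide_le_eq mult.assoc)
  then show ?thesis using assms by (simp add: ratio_def gc_eq abs_divide)
qed

lemma ratio_cont: "continuous_on UNIV ratio"
proof (intro continuous_at_imp_continuous_on ballI)
  fix y :: real
  show "isCont ratio y"
  proof (cases "y = 0")
    case False
    have "isCont (\<lambda>y. gc y / y) y" using False by (intro continuous_intros gc_cont)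
    moreover have "\<forall>\<^sub>F x in nhds y. gc x / x = ratio x"
      using eventually_nhds_in_open[of "- {0}" y] False
      by (auto elim!: eventually_mono simp: ratio_def open_Compl)
    ultimately show ?thesis using isCont_cong[of "\<lambda>x. gc x / x" ratio y] by blast
  next
    case True
    have "continuous_on UNIV (\<lambda>y::real. C2 * \<bar>y\<bar> powr (\<gamma> - 2))"
      using \<gamma> by (intro continuous_intros continuous_on_powr') auto
    then have "isCont (\<lambda>y::real. C2 * \<bar>y\<bar> powr (\<gamma> - 2)) 0"
      by (simp add: continuous_on_eq_continuous_at)
    then have "((\<lambda>y::real. C2 * \<bar>y\<bar> powr (\<gamma> - 2)) \<longlongrightarrow> C2 * \<bar>0\<bar> powr (\<gamma> - 2)) (at 0)"
      unfolding isCont_def .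
    then have lim: "((\<lambda>y::real. C2 * \<bar>y\<bar> powr (\<gamma> - 2)) \<longlongrightarrow> 0) (at 0)" by simp
    have "\<forall>\<^sub>F y in at 0. norm (ratio y) \<le> C2 * \<bar>y\<bar> powr (\<gamma> - 2)"
      unfolding eventually_at using ratio_small \<delta> R
      by (intro exI[of _ "min \<delta> (2 * R)"]) (auto simp: dist_real_def)
    then have "(ratio \<longlongrightarrow> 0) (at 0)" by (rule Lim_null_comparison[OF _ lim])
    then show ?thesis using True by (simp add: isCont_def ratio_def)
  qed
qed

lemma scaled_ratio: "d * (x * ratio (d * x)) = (if d * x = 0 then 0 else gc (d * x))"
  by (auto simp: ratio_def)

lemma gc_0: "gc 0 = 0"
proof -
  have "isCont ratio 0" using ratio_cont by (simp add: continuous_on_eq_continuous_at)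
  have "((\<lambda>y. y * ratio y) \<longlongrightarrow> 0 * ratio 0) (at 0)"
    using \<open>isCont ratio 0\<close> by (intro tendsto_intros) (auto simp: isCont_def)
  moreover have "\<forall>\<^sub>F y in at 0. y * ratio y = gc y"
    unfolding eventually_at by (intro exI[of _ 1]) (simp add: ratio_def)
  ultimately have "(gc \<longlongrightarrow> 0) (at 0)" using tendsto_cong by fastforce
  moreover have "(gc \<longlongrightarrow> gc 0) (at 0)" using gc_cont[of 0] by (simp add: isCont_def)
  ultimately show ?thesis using LIM_unique by blast
qed

lemma scaled_ratio': "d * (x * ratio (d * x)) = gc (d * x)"
  using gc_0 by (auto simp: scaled_ratio)

lemma qc_cont: "continuous_on UNIV qc"
  unfolding qc_def[abs_def]
  by (rule continuous_on_compose2[OF q_cont]) (use R in \<open>auto intro!: continuous_intros\<close>)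

lemma qc_ge: "q0 \<le> qc r"
  unfolding qc_def using R by (intro q_ge) auto

lemma qc_bounded: "\<exists>Q>0. \<forall>r. qc r \<le> Q"
proof -
  have "bounded (q ` {0..R})" by (intro compact_imp_bounded compact_continuous_image q_cont compact_Icc)
  then obtain Q where "\<forall>x\<in>q ` {0..R}. norm x \<le> Q" unfolding bounded_iff by blast
  then have Q: "\<bar>q r\<bar> \<le> Q" if "r \<in> {0..R}" for r using that by simp
  have "qc r \<le> max Q 1" for r
    using Q[of "max 0 (min R r)"] R by (auto simp: qc_def)
  then show ?thesis by (intro exI[of _ "max Q 1"]) auto
qed

text \<open>
The bound is uniform in \<open>d\<close> because \<open>x \<mapsto> gc (d * x) / d\<close> has the Lipschitz constant of \<open>gc\<close>.
\<close>

lemma rhs_lipschitz: "\<exists>K\<ge>0. \<forall>d r x y. \<bar>rhs lam mu d r x - rhs lam mu d r y\<bar> \<le> K * \<bar>x - y\<bar>"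
proof -
  obtain L where L: "L \<ge> 0" "\<And>x y. \<bar>gc x - gc y\<bar> \<le> L * \<bar>x - y\<bar>" using gc_lipschitz by blast
  obtain Q where Q: "Q > 0" "\<And>r. qc r \<le> Q" using qc_bounded by blast
  have r: "\<bar>x * ratio (d * x) - y * ratio (d * y)\<bar> \<le> L * \<bar>x - y\<bar>" for d x y
  proof (cases "d = 0")
    case True then show ?thesis using L(1) by (simp add: ratio_def)
  next
    case False
    have "\<bar>d\<bar> * \<bar>x * ratio (d * x) - y * ratio (d * y)\<bar> = \<bar>gc (d * x) - gc (d * y)\<bar>"
      by (simp add: scaled_ratio'[symmetric] abs_mult[symmetric] right_diff_distrib)
    also have "\<dots> \<le> L * \<bar>d * x - d * y\<bar>" by (rule L(2))
    also have "\<dots> = \<bar>d\<bar> * (L * \<bar>x - y\<bar>)" by (simp add: right_diff_distrib[symmetric] abs_mult)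
    finally show ?thesis using False by simp
  qed
  have "\<bar>rhs lam mu d r x - rhs lam mu d r y\<bar> \<le> (\<bar>lam\<bar> + \<bar>mu\<bar> * Q * L) * \<bar>x - y\<bar>" for d r x y
  proof -
    have "rhs lam mu d r x - rhs lam mu d r y
        = lam * (x - y) + mu * qc r * (x * ratio (d * x) - y * ratio (d * y))"
      by (simp add: rhs_def algebra_simps)
    then have "\<bar>rhs lam mu d r x - rhs lam mu d r y\<bar>
        \<le> \<bar>lam\<bar> * \<bar>x - y\<bar> + \<bar>mu\<bar> * \<bar>qc r\<bar> * \<bar>x * ratio (d * x) - y * ratio (d * y)\<bar>"
      by (metis abs_mult abs_triangle_ineq)
    also have "\<dots> \<le> \<bar>lam\<bar> * \<bar>x - y\<bar> + \<bar>mu\<bar> * Q * (L * \<bar>x - y\<bar>)"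
      using Q(2)[of r] qc_ge[of r] q0 r[of x d y] L(1)
      by (intro add_left_mono mult_mono) auto
    finally show ?thesis by (simp add: algebra_simps)
  qed
  then show ?thesis using L Q by (intro exI[of _ "\<bar>lam\<bar> + \<bar>mu\<bar> * Q * L"]) auto
qed

lemma rhs_cont: "continuous_on UNIV (\<lambda>p. rhs lam mu (fst p) (fst (snd p)) (snd (snd p)))"
  unfolding rhs_def
  by (intro continuous_intros continuous_on_compose2[OF qc_cont] continuous_on_compose2[OF ratio_cont]) auto

definition family :: "real \<Rightarrow> real \<Rightarrow> (real \<Rightarrow> real \<Rightarrow> real) \<Rightarrow> (real \<Rightarrow> real \<Rightarrow> real) \<Rightarrow> bool" where
  "family lam mu U Y \<longleftrightarrow>
     continuous_on ({0..R} \<times> {0..R}) (\<lambda>p. U (fst p) (snd p)) \<and>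
     continuous_on ({0..R} \<times> {0..R}) (\<lambda>p. Y (fst p) (snd p)) \<and>
     (\<forall>d\<in>{0..R}. U d 0 = 1 \<and> Y d 0 = 0 \<and> (\<forall>r\<in>{0..R}.
       (U d has_real_derivative slope d (Y d r)) (at r within {0..R}) \<and>
       ((\<lambda>s. s ^ (N - 1) * Y d s) has_real_derivative - (r ^ (N - 1) * rhs lam mu d r (U d r))) (at r within {0..R})))"

lemma family_exists: "\<exists>U Y. family lam mu U Y"
proof -
  obtain K where K: "K \<ge> 0" "\<forall>d r x y. \<bar>rhs lam mu d r x - rhs lam mu d r y\<bar> \<le> K * \<bar>x - y\<bar>"
    using rhs_lipschitz by blast
  interpret singular_ivp N R K "rhs lam mu"
    by unfold_locales (use R K rhs_cont in auto)
  obtain U Y where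
    "continuous_on ({0..R} \<times> {0..R}) (\<lambda>p. U (fst p) (snd p))"
    "continuous_on ({0..R} \<times> {0..R}) (\<lambda>p. Y (fst p) (snd p))"
    "\<And>d. d \<in> {0..R} \<Longrightarrow> U d 0 = 1"
    "\<And>d. d \<in> {0..R} \<Longrightarrow> Y d 0 = 0"
    "\<And>d r. d \<in> {0..R} \<Longrightarrow> r \<in> {0..R} \<Longrightarrow>
       (U d has_real_derivative slope d (Y d r)) (at r within {0..R})"
    "\<And>d r. d \<in> {0..R} \<Longrightarrow> r \<in> {0..R} \<Longrightarrow>
       ((\<lambda>s. s ^ (N - 1) * Y d s) has_real_derivative - (r ^ (N - 1) * rhs lam mu d r (U d r))) (at r within {0..R})"
    using solution_family by blast
  then show ?thesis unfolding family_def by blast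
qed

context
  fixes lam mu :: real and U Y :: "real \<Rightarrow> real \<Rightarrow> real"
  assumes fam: "family lam mu U Y"
begin

lemma U_start: "d \<in> {0..R} \<Longrightarrow> U d 0 = 1"
  and Y_start: "d \<in> {0..R} \<Longrightarrow> Y d 0 = 0"
  and U_der: "d \<in> {0..R} \<Longrightarrow> r \<in> {0..R} \<Longrightarrow>
       (U d has_real_derivative slope d (Y d r)) (at r within {0..R})"
  and V_der: "d \<in> {0..R} \<Longrightarrow> r \<in> {0..R} \<Longrightarrow>
       ((\<lambda>s. s ^ (N - 1) * Y d s) has_real_derivative - (r ^ (N - 1) * rhs lam mu d r (U d r))) (at r within {0..R})"
  using fam unfolding family_def by blast+

lemma UY_joint:
  "continuous_on ({0..R} \<times> {0..R}) (\<lambda>p. U (fst p) (snd p))"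
  "continuous_on ({0..R} \<times> {0..R}) (\<lambda>p. Y (fst p) (snd p))"
  using fam unfolding family_def by blast+

lemma U_cont: "d \<in> {0..R} \<Longrightarrow> continuous_on {0..R} (U d)"
  using U_der by (intro continuous_on_eq_continuous_within[THEN iffD2]) (blast intro: DERIV_continuous)

lemma Y_cont:
  assumes "d \<in> {0..R}" shows "continuous_on {0..R} (Y d)"
proof -
  have "continuous_on {0..R} (\<lambda>r. (d, r))" by (intro continuous_intros)
  moreover have "(\<lambda>r. (d, r)) ` {0..R} \<subseteq> {0..R} \<times> {0..R}" using assms by auto
  ultimately have "continuous_on {0..R} (\<lambda>r. Y (fst (d, r)) (snd (d, r)))"
    by (rule continuous_on_compose2[OF UY_joint(2)])
  then show ?thesis by simp
qed

lemma U_der_interior: "d \<in> {0..R} \<Longrightarrow> 0 < r \<Longrightarrow> r < R \<Longrightarrow> (U d has_real_derivative slope d (Y d r)) (at r)"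
  using U_der[of d r] by (simp add: at_within_Icc_at)

lemma V_der_interior: "d \<in> {0..R} \<Longrightarrow> 0 < r \<Longrightarrow> r < R \<Longrightarrow>
    ((\<lambda>s. s ^ (N - 1) * Y d s) has_real_derivative - (r ^ (N - 1) * rhs lam mu d r (U d r))) (at r)"
  using V_der[of d r] by (simp add: at_within_Icc_at)

text \<open>
If \<open>U\<close> and \<open>Y\<close> vanish together at \<open>r\<close>, Gronwall's inequality run backwards shows that \<open>U\<close> vanishes on
all of \<open>(0, r]\<close>, contrary to \<open>U d 0 = 1\<close>. Both functions carry the weight \<open>s ^ n\<close>: for \<open>Y\<close> this is the
quantity whose derivative is known, and for \<open>U\<close> the derivative of the weight contributes with the
favourable sign, so that the constant does not depend on the distance from \<open>0\<close>.
\<close>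

lemma nondegenerate:
  assumes d: "d \<in> {0..R}" and r: "r \<in> {0..R}" and z: "U d r = 0"
  shows "Y d r \<noteq> 0"
proof
  assume z': "Y d r = 0"
  define n where "n = N - 1"
  obtain K where K: "K \<ge> 0" "\<And>d r x y. \<bar>rhs lam mu d r x - rhs lam mu d r y\<bar> \<le> K * \<bar>x - y\<bar>"
    using rhs_lipschitz by blast
  have rhsK: "\<bar>rhs lam mu d s x\<bar> \<le> K * \<bar>x\<bar>" for s x
    using K(2)[of d s x 0] by (simp add: rhs_def)
  have r0: "0 < r" using r z U_start[OF d] by (cases "r = 0") auto
  define P where "P s = (s ^ n * U d s)\<^sup>2 + (s ^ n * Y d s)\<^sup>2" for s :: real
  define P' where "P' s = 2 * (s ^ n * U d s) * (real n * s ^ (n - 1) * U d s + s ^ n * slope d (Y d s))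
      + 2 * (s ^ n * Y d s) * (- (s ^ n * rhs lam mu d s (U d s)))" for s :: real
  have vanish: "U d x = 0" if x: "0 < x" "x \<le> r" for x
  proof -
    have "P x \<le> 0"
    proof (rule gronwall_zero_backward[where E = P and E' = P' and K = "1 + K"])
      show "continuous_on {x..r} P" unfolding P_def[abs_def]
        using x r by (intro continuous_intros continuous_on_subset[OF U_cont[OF d]] continuous_on_subset[OF Y_cont[OF d]]) auto
      fix s assume s: "x < s" "s < r"
      then have s': "0 < s" "s < R" using x r by auto
      have d1: "((\<lambda>s. s ^ n * U d s) has_real_derivative (real n * s ^ (n - 1) * U d s + s ^ n * slope d (Y d s))) (at s)"
        using DERIV_mult'[OF DERIV_pow U_der_interior[OF d s'], of n] by (simp add: add.commute mult.commute)
      have d2: "((\<lambda>s. s ^ n * Y d s) has_real_derivative (- (s ^ n * rhs lam mu d s (U d s)))) (at s)"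
        using V_der_interior[OF d s'] by (simp add: n_def)
      show "(P has_real_derivative P' s) (at s)"
        unfolding P_def[abs_def] P'_def by (rule DERIV_add[OF DERIV_square[OF d1] DERIV_square[OF d2]])
      let ?a = "s ^ n * U d s" and ?b = "s ^ n * Y d s"
      have a1: "0 \<le> 2 * ?a * (real n * s ^ (n - 1) * U d s)"
      proof -
        have "0 \<le> 2 * real n * s ^ n * s ^ (n - 1) * (U d s)\<^sup>2" using s' by simp
        then show ?thesis by (simp add: power2_eq_square mult_ac)
      qed
      have a2: "- (2 * \<bar>?a\<bar> * \<bar>?b\<bar>) \<le> 2 * ?a * (s ^ n * slope d (Y d s))"
      proof -
        have "\<bar>s ^ n * slope d (Y d s)\<bar> \<le> \<bar>?b\<bar>"
          using abs_slope_le[of d "Y d s"] s' by (simp add: abs_mult mult_left_mono)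
        then have "\<bar>2 * ?a * (s ^ n * slope d (Y d s))\<bar> \<le> 2 * \<bar>?a\<bar> * \<bar>?b\<bar>"
          by (simp only: abs_mult) (simp add: mult_left_mono)
        then show ?thesis by (simp only: abs_le_iff) linarith
      qed
      have a3: "- (2 * \<bar>?b\<bar> * (K * \<bar>?a\<bar>)) \<le> 2 * ?b * (- (s ^ n * rhs lam mu d s (U d s)))"
      proof -
        have "\<bar>s ^ n * rhs lam mu d s (U d s)\<bar> \<le> K * \<bar>?a\<bar>"
          using mult_left_mono[OF rhsK[of s "U d s"], of "s ^ n"] s' by (simp add: abs_mult mult_ac)
        then have "2 * \<bar>?b\<bar> * \<bar>s ^ n * rhs lam mu d s (U d s)\<bar> \<le> 2 * \<bar>?b\<bar> * (K * \<bar>?a\<bar>)"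
          by (rule mult_left_mono) simp
        then have "\<bar>2 * ?b * (- (s ^ n * rhs lam mu d s (U d s)))\<bar> \<le> 2 * \<bar>?b\<bar> * (K * \<bar>?a\<bar>)"
          by (simp only: abs_mult abs_minus_cancel abs_numeral)
        then show ?thesis by (simp only: abs_le_iff) linarith
      qed
      have "2 * \<bar>?a\<bar> * \<bar>?b\<bar> \<le> P s"
        using zero_le_power2[of "\<bar>?a\<bar> - \<bar>?b\<bar>"] by (simp add: P_def power2_diff)
      then have "(1 + K) * (2 * \<bar>?a\<bar> * \<bar>?b\<bar>) \<le> (1 + K) * P s" using K(1) by (intro mult_left_mono) auto
      moreover have "P' s = 2 * ?a * (real n * s ^ (n - 1) * U d s) + 2 * ?a * (s ^ n * slope d (Y d s))
          + 2 * ?b * (- (s ^ n * rhs lam mu d s (U d s)))"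
        unfolding P'_def by (simp only: distrib_left)
      moreover have "(1 + K) * (2 * \<bar>?a\<bar> * \<bar>?b\<bar>) = 2 * \<bar>?a\<bar> * \<bar>?b\<bar> + 2 * \<bar>?b\<bar> * (K * \<bar>?a\<bar>)"
        by (simp only: distrib_right mult_1 mult_ac)
      ultimately show "- ((1 + K) * P s) \<le> P' s" using a1 a2 a3 by linarith
    qed (use x z z' in \<open>auto simp: P_def\<close>)
    moreover have "0 \<le> (x ^ n * Y d x)\<^sup>2" by simp
    ultimately have "(x ^ n * U d x)\<^sup>2 \<le> 0" unfolding P_def by linarith
    then show ?thesis using x by simp
  qed
  have "(U d \<longlongrightarrow> U d 0) (at 0 within {0..R})"
    using U_cont[OF d] R by (simp add: continuous_on_def)
  then have "\<forall>\<^sub>F x in at 0 within {0..R}. 1 / 2 < U d x"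
    using U_start[OF d] by (intro order_tendstoD(1)) auto
  then obtain e where e: "e > 0" "\<And>x. x \<in> {0..R} \<Longrightarrow> x \<noteq> 0 \<Longrightarrow> dist x 0 < e \<Longrightarrow> 1 / 2 < U d x"
    unfolding eventually_at by blast
  define x where "x = min r (e / 2)"
  have "0 < x" "x \<le> r" "x < e" using r0 e(1) by (auto simp: x_def)
  then show False using e(2)[of x] vanish[of x] r by auto
qed

lemma slope_joint: "continuous_on ({0..R} \<times> {0..R}) (\<lambda>p. slope (fst p) (Y (fst p) (snd p)))"
  by (intro continuous_intros UY_joint)

lemma simple_zeros: "simple_zero_family {0..R} R U (\<lambda>d r. slope d (Y d r))"
proof
  show "continuous_on ({0..R} \<times> {0..R}) (\<lambda>p. slope (fst p) (Y (fst p) (snd p)))" by (rule slope_joint)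
qed (use R UY_joint U_der U_start nondegenerate in auto)

lemma slope_scale: "d * slope d y = slope 1 (d * y)"
  by (simp add: slope_def)

lemma u_der: "d \<in> {0..R} \<Longrightarrow> r \<in> {0..R} \<Longrightarrow>
    ((\<lambda>r. d * U d r) has_real_derivative slope 1 (d * Y d r)) (at r within {0..R})"
  using DERIV_cmult[OF U_der, of d r d] by (simp add: slope_scale)

lemma u_speed_less:
  assumes d: "d \<in> {0..R}" and st: "0 \<le> s" "s < t" "t \<le> R"
  shows "\<bar>d * U d t - d * U d s\<bar> < t - s"
proof -
  obtain x where "d * U d t - d * U d s = (t - s) * slope 1 (d * Y d x)"
    using mvt_within[OF u_der[OF d], of s t] st by metis
  then have "\<bar>d * U d t - d * U d s\<bar> = (t - s) * \<bar>slope 1 (d * Y d x)\<bar>" using st by (simp add: abs_mult)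
  also have "\<dots> < (t - s) * 1" using st abs_slope_one_less by (intro mult_strict_left_mono) auto
  finally show ?thesis by simp
qed

lemma u_near_start: "d \<in> {0..R} \<Longrightarrow> r \<in> {0..R} \<Longrightarrow> \<bar>d * U d r - d\<bar> \<le> r"
  using u_speed_less[of d 0 r] U_start[of d] by (cases "r = 0") auto

lemma u_bound: "d \<in> {0..R} \<Longrightarrow> r \<in> {0..R} \<Longrightarrow> \<bar>d * U d r\<bar> \<le> 2 * R"
  using u_near_start[of d r] by auto

lemma scaled_rhs:
  assumes "d \<in> {0..R}" "r \<in> {0..R}"
  shows "d * rhs lam mu d r (U d r) = lam * (d * U d r) + mu * q r * g (d * U d r)"
proof -
  have "d * rhs lam mu d r (U d r) = lam * (d * U d r) + mu * qc r * (d * (U d r * ratio (d * U d r)))"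
    by (simp add: rhs_def algebra_simps)
  then show ?thesis unfolding scaled_ratio' using assms by (simp add: qc_eq gc_eq[OF u_bound])
qed

lemma v_der:
  assumes "d \<in> {0..R}" "r \<in> {0..R}"
  shows "((\<lambda>s. s ^ (N - 1) * (d * Y d s)) has_real_derivative
     - (r ^ (N - 1) * (lam * (d * U d r) + mu * q r * g (d * U d r)))) (at r within {0..R})"
proof -
  have "((\<lambda>s. d * (s ^ (N - 1) * Y d s)) has_real_derivative
     d * (- (r ^ (N - 1) * rhs lam mu d r (U d r)))) (at r within {0..R})"
    by (rule DERIV_cmult[OF V_der[OF assms]])
  then show ?thesis unfolding scaled_rhs[OF assms, symmetric] by (simp add: mult_ac)
qed

lemma family_solution:
  assumes d: "d \<in> {0..R}" and end0: "U d R = 0"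
  shows "is_solution N R q g lam mu (\<lambda>r. d * U d r)"
  unfolding is_solution_def
proof (intro exI[of _ "\<lambda>r. slope 1 (d * Y d r)"] conjI ballI)
  fix r assume r: "r \<in> {0..R}"
  show "((\<lambda>r. d * U d r) has_real_derivative slope 1 (d * Y d r)) (at r within {0..R})" by (rule u_der[OF d r])
  show "\<bar>slope 1 (d * Y d r)\<bar> < 1" by (rule abs_slope_one_less)
next
  show "continuous_on {0..R} (\<lambda>r. slope 1 (d * Y d r))" by (intro continuous_intros Y_cont[OF d])
next
  fix r assume r: "r \<in> {0<..<R}"
  have inv: "slope 1 y / sqrt (1 - (slope 1 y)\<^sup>2) = y" for y
  proof -
    have p: "0 < 1 + y\<^sup>2" by (rule one_plus_square_pos)
    have "(slope 1 y)\<^sup>2 = y\<^sup>2 / (1 + y\<^sup>2)" using p by (simp add: slope_def power_divide)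
    then have "1 - (slope 1 y)\<^sup>2 = 1 / (1 + y\<^sup>2)" using p by (simp add: field_simps)
    then show ?thesis using p by (simp add: slope_def real_sqrt_divide)
  qed
  show "((\<lambda>s. s ^ (N - 1) * (slope 1 (d * Y d s) / sqrt (1 - (slope 1 (d * Y d s))\<^sup>2)))
      has_real_derivative - (r ^ (N - 1) * (lam * (d * U d r) + mu * q r * g (d * U d r)))) (at r)"
    unfolding inv using v_der[OF d, of r] r by (simp add: at_within_Icc_at)
next
  show "slope 1 (d * Y d 0) = 0" using Y_start[OF d] by simp
  show "d * U d R = 0" using end0 by simp
qed

text \<open>
Slopes are below \<open>1\<close>, so \<open>u r > R - r\<close> for \<open>r > 0\<close> when \<open>u 0 = R\<close>.
\<close>

lemma no_zeros_at_R:
  assumes "r \<in> {0..R}" shows "U R r \<noteq> 0"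
proof (cases "r = 0")
  case True then show ?thesis using U_start[of R] R by simp
next
  case False
  then show ?thesis using u_speed_less[of R 0 r] U_start[of R] R assms by auto
qed

end

end

section \<open>Small and large shooting heights\<close>

context minkowski_problem
begin

lemma linear_profile:
  assumes fam: "family lam mu U Y" and r: "r \<in> {0..R}"
  shows "U 0 r = rad N (lam * r\<^sup>2)"
proof -
  have N1: "1 \<le> N" using N by simp
  have z: "0 \<in> {0..R}" using R by simp
  let ?w = "\<lambda>r. rad N (lam * r\<^sup>2)" and ?w' = "\<lambda>r. 2 * lam * r * rad_d N (lam * r\<^sup>2)"
  have "U 0 r - ?w r = 0"
  proof (rule radial_ode_unique[where h = "\<lambda>r. U 0 r - ?w r" and y = "\<lambda>r. Y 0 r - ?w' r"
        and b = R and m = lam and k = "real (N - 1)"])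
    have cw: "continuous_on {0..R} (\<lambda>r. rad N (lam * r\<^sup>2))"
      by (intro continuous_at_imp_continuous_on ballI DERIV_isCont[OF rad_profile_deriv[OF N1]])
    have cw': "continuous_on {0..R} (\<lambda>r. rad_d N (lam * r\<^sup>2))"
      by (intro continuous_at_imp_continuous_on ballI isCont_o2[OF _ DERIV_isCont[OF rad_d_deriv[OF N1]]] continuous_intros)
    show "continuous_on {0..R} (\<lambda>r. U 0 r - ?w r)" by (intro continuous_intros cw U_cont[OF fam z])
    show "continuous_on {0..R} (\<lambda>r. Y 0 r - ?w' r)" by (intro continuous_intros cw' Y_cont[OF fam z])
    fix x assume x: "0 < x" "x < R"
    show "((\<lambda>r. U 0 r - ?w r) has_real_derivative Y 0 x - ?w' x) (at x)"
      using DERIV_diff[OF U_der_interior[OF fam z x] rad_profile_deriv[OF N1, of lam x]] by (simp add: slope_def)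
    have "(Y 0 has_real_derivative (- lam * U 0 x - real (N - 1) / x * Y 0 x)) (at x)"
    proof -
      have "((\<lambda>s. (s ^ (N - 1) * Y 0 s) / s ^ (N - 1)) has_real_derivative
          (- (x ^ (N - 1) * rhs lam mu 0 x (U 0 x)) * x ^ (N - 1)
            - (x ^ (N - 1) * Y 0 x) * (real (N - 1) * x ^ (N - 1 - Suc 0))) / (x ^ (N - 1) * x ^ (N - 1))) (at x)"
        using x by (intro DERIV_divide V_der_interior[OF fam z x] DERIV_pow) auto
      moreover have "(- (x ^ (N - 1) * rhs lam mu 0 x (U 0 x)) * x ^ (N - 1)
            - (x ^ (N - 1) * Y 0 x) * (real (N - 1) * x ^ (N - 1 - Suc 0))) / (x ^ (N - 1) * x ^ (N - 1))
          = - lam * U 0 x - real (N - 1) / x * Y 0 x"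
      proof -
        have "x ^ (N - 1) = x * x ^ (N - 1 - Suc 0)" using N by (simp add: power_eq_if)
        moreover have "rhs lam mu 0 x (U 0 x) = lam * U 0 x" by (simp add: rhs_def ratio_def)
        ultimately show ?thesis using x by (simp add: field_simps)
      qed
      ultimately have "((\<lambda>s. (s ^ (N - 1) * Y 0 s) / s ^ (N - 1)) has_real_derivative
          (- lam * U 0 x - real (N - 1) / x * Y 0 x)) (at x)" by simp
      moreover have "\<forall>\<^sub>F s in nhds x. (s ^ (N - 1) * Y 0 s) / s ^ (N - 1) = Y 0 s"
        by (rule eventually_mono[OF eventually_nhds_in_open[of "{0<..}" x]]) (use x in auto)
      ultimately show ?thesis by (rule has_real_derivative_transfer)
    qed
    from DERIV_diff[OF this rad_profile_deriv2[OF N1, of x lam]] x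
    show "((\<lambda>r. Y 0 r - ?w' r) has_real_derivative
        - lam * (U 0 x - ?w x) - real (N - 1) / x * (Y 0 x - ?w' x)) (at x)"
      by (simp add: algebra_simps)
  qed (use r U_start[OF fam z] Y_start[OF fam z] in auto)
  then show ?thesis by simp
qed

text \<open>
If \<open>r\<close> is a zero of the linear profile, then \<open>lam * r\<^sup>2 / R\<^sup>2\<close> is a radial eigenvalue; it is at most
\<open>lam\<close> because \<open>r \<le> R\<close>. The converse correspondence gives the next lemma.
\<close>

lemma linear_zeros_le:
  assumes fam: "family lam mu U Y" and lam: "0 \<le> lam"
    and fin: "finite {m. rad N (m * R\<^sup>2) = 0 \<and> m \<le> lam}"
  shows "card {r \<in> {0..R}. U 0 r = 0} \<le> card {m. rad N (m * R\<^sup>2) = 0 \<and> m \<le> lam}"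
proof (cases "lam = 0")
  case True
  then have "{r \<in> {0..R}. U 0 r = 0} = {}" using linear_profile[OF fam] by simp
  then show ?thesis by (simp only: card.empty)
next
  case False
  then have lam: "0 < lam" using assms by simp
  let ?f = "\<lambda>r. lam * r\<^sup>2 / R\<^sup>2"
  show ?thesis
  proof (rule card_inj_on_le[of ?f, OF _ _ fin])
    show "inj_on ?f {r \<in> {0..R}. U 0 r = 0}"
    proof (rule inj_onI)
      fix x y assume "x \<in> {r \<in> {0..R}. U 0 r = 0}" "y \<in> {r \<in> {0..R}. U 0 r = 0}" "?f x = ?f y"
      then show "x = y" using lam R by (simp add: power2_eq_iff_nonneg)
    qed
    show "?f ` {r \<in> {0..R}. U 0 r = 0} \<subseteq> {m. rad N (m * R\<^sup>2) = 0 \<and> m \<le> lam}"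
    proof (rule image_subsetI)
      fix r assume r: "r \<in> {r \<in> {0..R}. U 0 r = 0}"
      then have "rad N (lam * r\<^sup>2) = 0" using linear_profile[OF fam, of r] by auto
      moreover have "lam * r\<^sup>2 / R\<^sup>2 * R\<^sup>2 = lam * r\<^sup>2" using R by simp
      moreover have "lam * r\<^sup>2 / R\<^sup>2 \<le> lam"
        using r lam R by (simp add: divide_le_eq power_mono)
      ultimately show "?f r \<in> {m. rad N (m * R\<^sup>2) = 0 \<and> m \<le> lam}" by simp
    qed
  qed
qed

lemma linear_zeros_ge:
  assumes fam: "family lam mu U Y" and fin: "finite {r \<in> {0<..<R}. U 0 r = 0}" and "l < lam"
  shows "card {m. rad N (m * R\<^sup>2) = 0 \<and> m \<le> l} \<le> card {r \<in> {0<..<R}. U 0 r = 0}"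
proof -
  have N1: "1 \<le> N" using N by simp
  have mpos: "0 < m" if "rad N (m * R\<^sup>2) = 0" for m
  proof (rule ccontr)
    assume "\<not> 0 < m"
    then have "m * R\<^sup>2 \<le> 0" by (simp add: mult_nonpos_nonneg)
    with rad_pos_of_nonpos[OF N1 this] that show False by simp
  qed
  let ?f = "\<lambda>m. R * sqrt (m / lam)"
  show ?thesis
  proof (rule card_inj_on_le[of ?f, OF _ _ fin])
    show "inj_on ?f {m. rad N (m * R\<^sup>2) = 0 \<and> m \<le> l}"
    proof (rule inj_onI)
      fix x y assume xy: "x \<in> {m. rad N (m * R\<^sup>2) = 0 \<and> m \<le> l}" "y \<in> {m. rad N (m * R\<^sup>2) = 0 \<and> m \<le> l}" "?f x = ?f y"
      have "0 < lam" using mpos[of x] xy \<open>l < lam\<close> by auto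
      then show "x = y" using xy R by simp
    qed
    show "?f ` {m. rad N (m * R\<^sup>2) = 0 \<and> m \<le> l} \<subseteq> {r \<in> {0<..<R}. U 0 r = 0}"
    proof (rule image_subsetI)
      fix m assume "m \<in> {m. rad N (m * R\<^sup>2) = 0 \<and> m \<le> l}"
      then have m: "rad N (m * R\<^sup>2) = 0" "m \<le> l" by auto
      have lam: "0 < m" "0 < lam" "m < lam" using mpos[OF m(1)] m(2) \<open>l < lam\<close> by auto
      have "sqrt (m / lam) < 1" "0 < sqrt (m / lam)" using lam by auto
      then have in1: "?f m \<in> {0<..<R}" using R by simp
      moreover have "lam * (?f m)\<^sup>2 = m * R\<^sup>2" using lam by (simp add: power_mult_distrib)
      moreover have "U 0 (?f m) = rad N (lam * (?f m)\<^sup>2)"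
        by (rule linear_profile[OF fam])
          (meson atLeastAtMost_iff greaterThanLessThan_iff in1 less_imp_le)
      ultimately have "U 0 (?f m) = 0" using m(1) by (simp only:)
      with in1 show "?f m \<in> {r \<in> {0<..<R}. U 0 r = 0}" by blast
    qed
  qed
qed

definition many_nodes :: "real \<Rightarrow> real \<Rightarrow> nat \<Rightarrow> bool" where
  "many_nodes lam mu j \<longleftrightarrow> (\<forall>U Y. family lam mu U Y \<longrightarrow>
     (\<exists>d. 0 < d \<and> d < R \<and> (\<exists>Z \<subseteq> {0<..<R}. finite Z \<and> card Z = j \<and> (\<forall>z\<in>Z. U d z = 0))))"

text \<open>
With a height of at most \<open>\<delta> / 4\<close> and up to the radius \<open>b \<le> \<delta> / 2\<close>, the profile stays below \<open>\<delta>\<close>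
in absolute value because its slope is less than \<open>1\<close>; there the growth condition turns the equation into
a flow to which \<open>many_zeros\<close> applies. Values are also kept below \<open>1\<close>, so that the power
\<open>\<gamma> - 1\<close> of the position is at most the position itself.
\<close>

lemma large_mu_oscillates:
  assumes lam: "0 \<le> lam"
  shows "\<exists>M\<ge>1. \<forall>mu>M. many_nodes lam mu j"
proof -
  obtain Q where Q: "Q > 0" "\<And>r. qc r \<le> Q" using qc_bounded by blast
  define e where "e = min \<delta> 1"
  define b where "b = min (e / 2) R"
  define c where "c = lam + Q * C2"
  define low where "low a = q0 * C1 * a powr (\<gamma> - 1)" for a
  have e: "0 < e" "e \<le> \<delta>" "e \<le> 1" using \<delta> by (simp_all add: e_def)
  have b: "0 < b" "b \<le> R" "b \<le> e / 2" using e R by (auto simp: b_def)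
  have cpos: "0 < c" using lam Q C2_pos by (simp add: c_def add_nonneg_pos)
  interpret osc: oscillation "N - 1" b c low
  proof
    show "low x \<le> low y" if "0 \<le> x" "x \<le> y" for x y
      using that q0 C1 \<gamma> by (auto simp: low_def intro!: mult_left_mono powr_mono2)
    show "0 < low x" if "0 < x" for x using that q0 C1 by (simp add: low_def)
  qed (use N b cpos in auto)
  obtain \<eta> where \<eta>: "0 < \<eta>" and
    H: "\<forall>\<kappa>>0. \<exists>M\<ge>1. \<forall>mu>M. osc.oscillates b \<eta> \<kappa> j mu"
    using osc.many_zeros[OF b(1), of j] by (elim exE conjE)
  define d where "d = min \<eta> (min (e / 4) (R / 2))"
  have d: "0 < d" "d \<le> \<eta>" "d \<le> e / 4" "d < R" using \<eta> e R by (auto simp: d_def min_def)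
  have dR: "d \<in> {0..R}" using d by simp
  from H[rule_format, OF d(1)] obtain M where M: "1 \<le> M" and
    HM: "\<forall>mu>M. osc.oscillates b \<eta> d j mu"
    by (elim exE conjE)
  have zeros: "\<exists>Z \<subseteq> {0<..<R}. finite Z \<and> card Z = j \<and> (\<forall>z\<in>Z. U d z = 0)"
    if mu: "M < mu" and fam: "family lam mu U Y" for mu U Y
  proof -
    have mu1: "1 \<le> mu" using mu M by simp
    define u where "u r = d * U d r" for r
    define v where "v r = r ^ (N - 1) * (d * Y d r)" for r
    define p where "p r = lam * (d * U d r) + mu * q r * g (d * U d r)" for r
    have bounds: "mu * low a \<le> lam * a + mu * q r * G \<and> lam * a + mu * q r * G \<le> c * mu * a"
      if r: "r \<in> {0..R}" and a: "0 < a" "a < e"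
        and G: "C1 * a powr (\<gamma> - 1) \<le> G" "G \<le> C2 * a powr (\<gamma> - 1)" for a G r
    proof
      have qr: "q0 \<le> q r" "q r \<le> Q" using q_ge[OF r] Q(2)[of r] qc_eq[OF r] by auto
      have "q0 * (C1 * a powr (\<gamma> - 1)) \<le> q r * G"
        using qr q0 C1 G by (intro mult_mono) auto
      then have "mu * (q0 * (C1 * a powr (\<gamma> - 1))) \<le> mu * (q r * G)" using mu1 by (intro mult_left_mono) auto
      moreover have "0 \<le> lam * a" using lam a by simp
      ultimately show "mu * low a \<le> lam * a + mu * q r * G" by (simp add: low_def mult.assoc)
      have "a powr (\<gamma> - 1) \<le> a powr 1" using a e \<gamma> by (intro powr_mono') auto
      then have "C2 * a powr (\<gamma> - 1) \<le> C2 * a" using a C2_pos by simp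
      then have "G \<le> C2 * a" using G by simp
      moreover have "0 \<le> G" using G(1) C1 by (meson dual_order.trans mult_nonneg_nonneg less_imp_le powr_ge_zero)
      ultimately have "q r * G \<le> Q * (C2 * a)" using qr q0 Q(1) by (intro mult_mono) auto
      then have "mu * (q r * G) \<le> mu * (Q * (C2 * a))" using mu1 by (intro mult_left_mono) auto
      moreover have "lam * a \<le> mu * (lam * a)" using mult_right_mono[OF mu1, of "lam * a"] lam a by simp
      ultimately show "lam * a + mu * q r * G \<le> c * mu * a" by (simp add: c_def algebra_simps)
    qed
    have "osc.flow mu u v p"
      unfolding osc.flow_def
    proof (intro ballI conjI impI)
      fix r assume rb: "r \<in> {0..b}"
      then have r: "r \<in> {0..R}" using b by auto
      have sub: "{0..b} \<subseteq> {0..R}" using b by auto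
      have sl: "slope 1 (v r / r ^ (N - 1)) = slope 1 (d * Y d r)"
      proof (cases "r = 0")
        case True then show ?thesis using Y_start[OF fam dR] by (simp add: v_def)
      next
        case False then show ?thesis by (simp add: v_def)
      qed
      show "(u has_real_derivative slope 1 (v r / r ^ (N - 1))) (at r within {0..b})"
        unfolding sl u_def[abs_def] by (rule DERIV_subset[OF u_der[OF fam dR r] sub])
      show "(v has_real_derivative - (r ^ (N - 1) * p r)) (at r within {0..b})"
        unfolding v_def[abs_def] p_def by (rule DERIV_subset[OF v_der[OF fam dR r] sub])
      have "\<bar>u r - d\<bar> \<le> r" using u_near_start[OF fam dR r] by (simp add: u_def)
      then have ue: "\<bar>u r\<bar> < e" using d rb b e by auto
      { assume pos: "0 < u r"
        have "mu * low (u r) \<le> lam * u r + mu * q r * g (u r) \<and> lam * u r + mu * q r * g (u r) \<le> c * mu * u r"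
          using pos ue e by (intro bounds r g_bounds) auto
        then show "mu * low (u r) \<le> p r" "p r \<le> c * mu * u r" by (simp_all add: p_def u_def) }
      { assume neg: "u r < 0"
        have "mu * low (- u r) \<le> lam * (- u r) + mu * q r * (- g (- (- u r))) \<and>
            lam * (- u r) + mu * q r * (- g (- (- u r))) \<le> c * mu * (- u r)"
          using neg ue e by (intro bounds r g_bounds) auto
        then show "mu * low (- u r) \<le> - p r" "- p r \<le> - (c * mu * u r)" by (simp_all add: p_def u_def) }
    qed
    moreover have "osc.entry mu \<eta> d u v 0"
      unfolding osc.entry_def u_def v_def
      using U_start[OF fam dR] Y_start[OF fam dR] d \<eta> mu1 by simp
    ultimately have "osc.flow mu u v p \<and> 0 \<le> (0::real) \<and> 0 + b \<le> b \<and> osc.entry mu \<eta> d u v 0" by simp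
    from HM[unfolded osc.oscillates_def, rule_format, OF mu this] obtain Z where
      Z: "Z \<subseteq> {0<..<0 + b}" "finite Z" "card Z = j" "\<forall>z\<in>Z. u z = 0" by (elim exE conjE)
    have "Z \<subseteq> {0<..<R}" using Z(1) b by auto
    moreover have "\<forall>z\<in>Z. U d z = 0" using Z(4) d by (simp add: u_def)
    ultimately show ?thesis using Z by blast
  qed
  show ?thesis
    unfolding many_nodes_def
  proof (rule exI[of _ M], rule conjI[OF M], intro allI impI)
    fix mu U Y assume "M < mu" "family lam mu U Y"
    from zeros[OF this] show "\<exists>d. 0 < d \<and> d < R \<and>
        (\<exists>Z \<subseteq> {0<..<R}. finite Z \<and> card Z = j \<and> (\<forall>z\<in>Z. U d z = 0))"
      using d by (intro exI[of _ d]) simp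
  qed
qed

text \<open>
The linear profile already has \<open>j\<close> interior zeros, and they persist for small heights.
\<close>

lemma many_nodes_above_eigenvalue:
  assumes dim: "N = CARD('n::finite)" and j: "1 \<le> j" and lam: "lambda_rad TYPE('n) R j < lam"
  shows "many_nodes lam mu j"
  unfolding many_nodes_def
proof (intro allI impI)
  fix U Y assume fam: "family lam mu U Y"
  interpret zf: simple_zero_family "{0..R}" R U "\<lambda>d r. slope d (Y d r)" by (rule simple_zeros[OF fam])
  have z0: "0 \<in> {0..R}" using R by simp
  have fin: "finite (zf.inner_zeros 0)" by (rule zf.finite_inner_zeros[OF z0])
  have "j \<le> card (zf.inner_zeros 0)"
    using linear_zeros_ge[OF fam fin[unfolded zf.inner_zeros_def] lam] lambda_rad(2)[OF dim N R, of j] j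
    by (simp add: zf.inner_zeros_def)
  moreover obtain e where e: "e > 0" "\<And>d. d \<in> {0..R} \<Longrightarrow> \<bar>d - 0\<bar> < e \<Longrightarrow> card (zf.inner_zeros 0) \<le> card (zf.inner_zeros d)"
    using zf.inner_zeros_lsc[OF z0] by blast
  define d where "d = min e R / 2"
  have d: "0 < d" "d < R" "d < e" using e(1) R by (auto simp: d_def min_def)
  ultimately have "j \<le> card (zf.inner_zeros d)" using e(2)[of d] by simp
  then obtain Z where "Z \<subseteq> zf.inner_zeros d" "card Z = j" "finite Z"
    by (rule obtain_subset_with_card_n)
  then show "\<exists>d. 0 < d \<and> d < R \<and> (\<exists>Z \<subseteq> {0<..<R}. finite Z \<and> card Z = j \<and> (\<forall>z\<in>Z. U d z = 0))"
    using d by (intro exI[of _ d] conjI exI[of _ Z]) (auto simp: zf.inner_zeros_def)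
qed

end

section \<open>Shape of the solutions\<close>

context minkowski_problem
begin

text \<open>
Since \<open>u R = 0\<close> and slopes are below \<open>1\<close>, the values of \<open>u\<close> stay within \<open>[- R, R]\<close>, where \<open>g\<close> has the
sign of its argument. So the momentum \<open>v\<close> is strictly decreasing where \<open>u > 0\<close> and strictly increasing
where \<open>u < 0\<close>. On the first nodal interval it starts from \<open>0\<close>, so it is negative; on the
others it changes sign exactly once.
\<close>

lemma profile_regular:
  assumes fam: "family lam mu U Y" and d: "0 < d" "d \<le> R" and lam: "0 \<le> lam" and mu: "0 < mu"
    and end0: "U d R = 0" and sign: "\<forall>s. s \<noteq> 0 \<and> \<bar>s\<bar> \<le> R \<longrightarrow> g s * s > 0"
  shows "regular_profile R (\<lambda>r. d * U d r)"
proof -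
  have dR: "d \<in> {0..R}" using d by simp
  interpret zf: simple_zero_family "{0..R}" R U "\<lambda>d r. slope d (Y d r)" by (rule simple_zeros[OF fam])
  define u where "u r = d * U d r" for r
  define u' where "u' r = slope 1 (d * Y d r)" for r
  define v where "v r = r ^ (N - 1) * (d * Y d r)" for r
  define p where "p r = lam * u r + mu * q r * g (u r)" for r
  have uder: "(u has_real_derivative u' r) (at r within {0..R})" if "r \<in> {0..R}" for r
    unfolding u_def[abs_def] u'_def by (rule u_der[OF fam dR that])
  have uder': "(u has_real_derivative u' r) (at r)" if "0 < r" "r < R" for r
    using uder[of r] that by (simp add: at_within_Icc_at)
  have ucont: "continuous_on {0..R} u"
    unfolding u_def[abs_def] by (intro continuous_intros U_cont[OF fam dR])
  have vder: "(v has_real_derivative - (r ^ (N - 1) * p r)) (at r within {0..R})" if "r \<in> {0..R}" for r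
    unfolding v_def[abs_def] p_def u_def by (rule v_der[OF fam dR that])
  have u0: "u 0 = d" using U_start[OF fam dR] by (simp add: u_def)
  have v0: "v 0 = 0" using Y_start[OF fam dR] by (simp add: v_def)
  have sgn: "0 < u' r \<longleftrightarrow> 0 < v r" "u' r = 0 \<longleftrightarrow> v r = 0" "u' r < 0 \<longleftrightarrow> v r < 0" if "0 < r" for r
  proof -
    have s: "0 < slope 1 y \<longleftrightarrow> 0 < y" "slope 1 y < 0 \<longleftrightarrow> y < 0" for y
      using one_plus_square_pos[of y] by (simp_all add: slope_def zero_less_divide_iff divide_less_0_iff)
    define c where "c = r ^ (N - 1)"
    have c: "0 < c" "v r = c * (d * Y d r)" using that by (simp_all add: c_def v_def)
    show "0 < u' r \<longleftrightarrow> 0 < v r" "u' r = 0 \<longleftrightarrow> v r = 0" "u' r < 0 \<longleftrightarrow> v r < 0"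
      unfolding c(2) u'_def s slope_eq_0_iff using c(1) by (simp_all add: zero_less_mult_iff mult_less_0_iff)
  qed
  have ule: "\<bar>u r\<bar> \<le> R" if "0 < r" "r < R" for r
    using u_speed_less[OF fam dR, of r R] that end0 by (simp add: u_def)
  have psign: "0 < u r * p r" if r: "0 < r" "r < R" and nz: "u r \<noteq> 0" for r
  proof -
    have "0 < g (u r) * u r" using sign ule[OF r] nz by blast
    moreover have "0 < mu * q r" using mu q_ge[of r] q0 r by simp
    ultimately have "0 < mu * q r * (g (u r) * u r)" by (rule mult_pos_pos[rotated])
    moreover have "0 \<le> lam * (u r * u r)" using lam by simp
    ultimately show ?thesis by (simp add: p_def algebra_simps)
  qed
  have vdec: "v t < v s" if st: "0 \<le> s" "s < t" "t \<le> R" and pos: "\<And>r. s < r \<Longrightarrow> r < t \<Longrightarrow> 0 < u r" for s t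
  proof -
    obtain x where x: "s < x" "x < t" "v t - v s = (t - s) * - (x ^ (N - 1) * p x)"
      using mvt_within[OF vder, of s t] st by metis
    have "0 < p x" using psign[of x] pos[OF x(1,2)] x st by (simp add: zero_less_mult_iff)
    then have "0 < (t - s) * (x ^ (N - 1) * p x)" using x st by simp
    then show ?thesis using x(3) by simp
  qed
  have vinc: "v s < v t" if st: "0 \<le> s" "s < t" "t \<le> R" and neg: "\<And>r. s < r \<Longrightarrow> r < t \<Longrightarrow> u r < 0" for s t
  proof -
    obtain x where x: "s < x" "x < t" "v t - v s = (t - s) * - (x ^ (N - 1) * p x)"
      using mvt_within[OF vder, of s t] st by metis
    have "p x < 0" using psign[of x] neg[OF x(1,2)] x st by (simp add: zero_less_mult_iff)
    then have "(t - s) * (x ^ (N - 1) * p x) < 0" using x st by (simp add: mult_pos_neg)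
    then show ?thesis using x(3) by simp
  qed
  have zeros: "zeros_on {0..R} u = zf.zeros d" using d by (auto simp: zeros_on_def zf.zeros_def u_def)
  have fin: "finite (zeros_on {0..R} u)" unfolding zeros by (rule zf.finite_zeros[OF dR])
  define z where "z = Min (zeros_on {0..R} u)"
  have "R \<in> zeros_on {0..R} u" using end0 R by (simp add: zeros_on_def u_def)
  then have "z \<in> zeros_on {0..R} u" unfolding z_def by (intro Min_in fin) auto
  then have z: "0 \<le> z" "z \<le> R" "u z = 0" by (auto simp: zeros_on_def)
  have first: "u r \<noteq> 0" if "0 \<le> r" "r < z" for r
  proof
    assume "u r = 0"
    then have "z \<le> r" unfolding z_def using that z by (intro Min_le fin) (auto simp: zeros_on_def)
    with that show False by simp
  qed
  have upos: "0 < u r" if r: "0 < r" "r < z" for r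
  proof (rule ccontr)
    assume "\<not> 0 < u r"
    moreover have "continuous_on {0..r} u" by (rule continuous_on_subset[OF ucont]) (use r z in auto)
    ultimately obtain x where "0 \<le> x" "x \<le> r" "u x = 0" using IVT2'[of u r 0 0] u0 d r by auto
    then show False using first[of x] r by auto
  qed
  have decreasing: "strict_antimono_on {0..z} u"
  proof (rule monotone_onI)
    fix s t assume st: "s \<in> {0..z}" "t \<in> {0..z}" "s < t"
    obtain x where x: "s < x" "x < t" "u t - u s = (t - s) * u' x"
      using mvt_within[OF uder, of s t] st z by auto
    have "v x < v 0" by (rule vdec) (use x st z upos in auto)
    then have "u' x < 0" using sgn(3)[of x] x st v0 by auto
    then have "(t - s) * u' x < 0" using st by (simp add: mult_pos_neg)
    then show "u t < u s" using x(3) by simp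
  qed
  have extremum: "\<exists>!r. r \<in> {a<..<b} \<and> local_extremum_at u r" if ab: "consecutive_zeros R u a b" for a b
  proof -
    have ab': "0 \<le> a" "a < b" "b \<le> R" "u a = 0" "u b = 0" "\<And>r. a < r \<Longrightarrow> r < b \<Longrightarrow> u r \<noteq> 0"
      using ab by (auto simp: consecutive_zeros_def zeros_on_def)
    have c: "continuous_on {a..b} u" by (rule continuous_on_subset[OF ucont]) (use ab' in auto)
    have der: "(u has_real_derivative u' r) (at r)" if "a < r" "r < b" for r
      using that ab' by (intro uder') auto
    have ev: "\<forall>\<^sub>F s in at x. s \<in> {a<..<b}" if "a < x" "x < b" for x
      using that by (intro eventually_at_in_open') auto
    have unique: ?thesis if x: "a < x" "x < b" "local_extremum_at u x"
      and only: "\<And>r. a < r \<Longrightarrow> r < b \<Longrightarrow> u' r = 0 \<longleftrightarrow> r = x" for x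
    proof (rule ex1I[of _ x])
      show "x \<in> {a<..<b} \<and> local_extremum_at u x" using x by simp
      fix r assume "r \<in> {a<..<b} \<and> local_extremum_at u r"
      then have r: "a < r" "r < b" "local_extremum_at u r" by auto
      have "u' r = 0" by (rule local_extremum_deriv_zero[OF r(3) der[OF r(1,2)]])
      then show "r = x" using only r by simp
    qed
    from constant_sign_between_zeros[OF c ab'(6)] show ?thesis
    proof
      assume pos: "\<forall>r. a < r \<longrightarrow> r < b \<longrightarrow> 0 < u r"
      obtain x where x: "a < x" "x < b" "\<And>r. a < r \<Longrightarrow> r < b \<Longrightarrow> u r \<le> u x"
        "\<And>r. a < r \<Longrightarrow> r < b \<Longrightarrow> u' r = 0 \<longleftrightarrow> r = x"
      proof (rule hump_maximum[OF ab'(2) c _ der, where v = v])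
        show "u a = u b" using ab' by simp
        show "v s < v r" if "a < r" "r < s" "s < b" for r s
          by (rule vdec) (use that ab' pos in auto)
      qed (use sgn ab' in auto)
      have "\<forall>\<^sub>F s in at x. u s \<le> u x"
        by (rule eventually_mono[OF ev[OF x(1,2)]]) (use x(3) in auto)
      then have "local_extremum_at u x" unfolding local_extremum_at_def by (rule disjI1)
      then show ?thesis by (rule unique[OF x(1,2) _ x(4)])
    next
      assume neg: "\<forall>r. a < r \<longrightarrow> r < b \<longrightarrow> u r < 0"
      obtain x where x: "a < x" "x < b" "\<And>r. a < r \<Longrightarrow> r < b \<Longrightarrow> - u r \<le> - u x"
        "\<And>r. a < r \<Longrightarrow> r < b \<Longrightarrow> - u' r = 0 \<longleftrightarrow> r = x"
      proof (rule hump_maximum[where u = "\<lambda>r. - u r" and u' = "\<lambda>r. - u' r" and v = "\<lambda>r. - v r", OF ab'(2)])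
        show "continuous_on {a..b} (\<lambda>r. - u r)" by (intro continuous_intros c)
        show "- u a = - u b" using ab' by simp
        show "((\<lambda>r. - u r) has_real_derivative - u' r) (at r)" if "a < r" "r < b" for r
          by (rule DERIV_minus[OF der[OF that]])
        show "- v s < - v r" if "a < r" "r < s" "s < b" for r s
        proof -
          have "v r < v s" by (rule vinc) (use that ab' neg in auto)
          then show ?thesis by simp
        qed
      qed (use sgn ab' in auto)
      have "\<forall>\<^sub>F s in at x. u x \<le> u s"
        by (rule eventually_mono[OF ev[OF x(1,2)]]) (use x(3) in auto)
      then have "local_extremum_at u x" unfolding local_extremum_at_def by (rule disjI2)
      then show ?thesis by (rule unique[OF x(1,2)]) (use x(4) in simp)
    qed
  qed
  have "regular_profile R u"
    unfolding regular_profile_def using decreasing extremum by (simp add: z_def)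
  then show ?thesis by (simp add: u_def[abs_def])
qed

end

section \<open>Nodal solutions\<close>

context minkowski_problem
begin

definition nodal_pairs :: "real \<Rightarrow> real \<Rightarrow> nat \<Rightarrow> nat \<Rightarrow> (nat \<Rightarrow> real \<Rightarrow> real) \<Rightarrow> (nat \<Rightarrow> real \<Rightarrow> real) \<Rightarrow> bool" where
  "nodal_pairs lam mu k j us ul \<longleftrightarrow>
          (\<forall>u \<in> us ` {k+1..j} \<union> ul ` {1..j}. is_solution N R q g lam mu u) \<and>
          card ((\<lambda>u. restrict u {0..R}) ` (us ` {k+1..j} \<union> ul ` {1..j})) = 2 * j - k \<and>
          (\<forall>l\<in>{k+1..j}. 0 < us l 0) \<and> (\<forall>l\<in>{1..j}. 0 < ul l 0) \<and>
          strict_mono_on {k+1..j} (\<lambda>l. us l 0) \<and>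
          (k < j \<longrightarrow> us j 0 < ul j 0) \<and>
          strict_antimono_on {1..j} (\<lambda>l. ul l 0) \<and>
          (\<forall>l\<in>{k+1..j}. has_exactly_zeros_on (l - 1) {0<..<R} (us l)) \<and>
          (\<forall>l\<in>{1..j}. has_exactly_zeros_on (l - 1) {0<..<R} (ul l)) \<and>
          ((\<forall>s. s \<noteq> 0 \<and> \<bar>s\<bar> \<le> R \<longrightarrow> g s * s > 0) \<longrightarrow>
             (\<forall>u \<in> us ` {k+1..j} \<union> ul ` {1..j}. regular_profile R u))"

text \<open>
The heights between \<open>0\<close> and \<open>m\<close> provide the small solutions and those between \<open>m\<close> and \<open>R\<close> the large
ones; different heights give different solutions, which settles their number.
\<close>

theorem nodal_solutions:
  assumes dim: "N = CARD('n::finite)" and lam: "0 \<le> lam" "lam < lambda_rad TYPE('n) R (k + 1)"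
    and mu: "0 < mu" and kj: "k \<le> j" and many: "many_nodes lam mu j"
  shows "\<exists>us ul. nodal_pairs lam mu k j us ul"
proof -
  obtain U Y where fam: "family lam mu U Y" using family_exists by blast
  interpret zf: simple_zero_family "{0..R}" R U "\<lambda>d r. slope d (Y d r)" by (rule simple_zeros[OF fam])
  obtain m Z where m: "0 < m" "m < R" and Z: "Z \<subseteq> {0<..<R}" "finite Z" "card Z = j" "\<forall>z\<in>Z. U m z = 0"
    using many fam unfolding many_nodes_def by blast
  have many': "j \<le> card (zf.inner_zeros m)"
    unfolding Z(3)[symmetric]
    using m Z by (intro card_mono zf.finite_inner_zeros) (auto simp: zf.inner_zeros_def)
  have few: "card (zf.zeros 0) \<le> k"
    using linear_zeros_le[OF fam lam(1) finite_radial_eigenvalues[OF N R]] card_eigenvalues_below[OF dim N R lam(2)]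
    unfolding zf.zeros_def by linarith
  have none: "zf.zeros R = {}" using no_zeros_at_R[OF fam] by (auto simp: zf.zeros_def)
  obtain cs cl where
    cs: "\<And>l. l \<in> {k+1..j} \<Longrightarrow> 0 < cs l \<and> cs l < m \<and> card (zf.inner_zeros (cs l)) = l - 1 \<and> U (cs l) R = 0"
    and cl: "\<And>l. l \<in> {1..j} \<Longrightarrow> m < cl l \<and> cl l < R \<and> card (zf.inner_zeros (cl l)) = l - 1 \<and> U (cl l) R = 0"
    and mono: "strict_mono_on {k+1..j} cs" "strict_antimono_on {1..j} cl"
    using zf.nodal_parameters[OF refl m few none many'] by blast
  define sol where "sol d r = d * U d r" for d r
  let ?D = "cs ` {k+1..j} \<union> cl ` {1..j}"
  have D: "0 < d \<and> d \<le> R \<and> U d R = 0" if "d \<in> ?D" for d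
    using that cs cl m by fastforce
  have at0: "sol d 0 = d" if "0 < d" "d \<le> R" for d
    using U_start[OF fam, of d] that by (simp add: sol_def)
  have csR: "0 < cs l \<and> cs l \<le> R" if "l \<in> {k+1..j}" for l using cs[OF that] m by simp
  have clR: "0 < cl l \<and> cl l \<le> R" if "l \<in> {1..j}" for l using cl[OF that] m by simp
  have nodes: "has_exactly_zeros_on n {0<..<R} (sol d)" if "0 < d" "d \<le> R" "card (zf.inner_zeros d) = n" for d n
  proof -
    have "zeros_on {0<..<R} (sol d) = zf.inner_zeros d"
      using that by (auto simp: zeros_on_def zf.inner_zeros_def sol_def)
    then show ?thesis using that zf.finite_inner_zeros[of d] by (simp add: has_exactly_zeros_on_def)
  qed
  have image: "(\<lambda>l. sol (cs l)) ` {k+1..j} \<union> (\<lambda>l. sol (cl l)) ` {1..j} = sol ` ?D" by (simp add: image_Un image_image)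
  have solutions: "is_solution N R q g lam mu u" if "u \<in> sol ` ?D" for u
  proof -
    from that obtain d where d: "u = sol d" "d \<in> ?D" by (rule imageE)
    then have "d \<in> {0..R}" "U d R = 0" using D[of d] by auto
    then show ?thesis unfolding d(1) sol_def[abs_def] by (rule family_solution[OF fam])
  qed
  have regular: "regular_profile R u" if "\<forall>s. s \<noteq> 0 \<and> \<bar>s\<bar> \<le> R \<longrightarrow> g s * s > 0" "u \<in> sol ` ?D" for u
  proof -
    from that(2) obtain d where d: "u = sol d" "d \<in> ?D" by (rule imageE)
    then have "0 < d" "d \<le> R" "U d R = 0" using D[of d] by auto
    then show ?thesis
      unfolding d(1) sol_def[abs_def] by (intro profile_regular[OF fam _ _ lam(1) mu _ that(1)])
  qed
  have count: "card ((\<lambda>u. restrict u {0..R}) ` (sol ` ?D)) = 2 * j - k"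
  proof -
    have "inj_on (\<lambda>d. restrict (sol d) {0..R}) ?D"
    proof (rule inj_onI)
      fix x y assume xy: "x \<in> ?D" "y \<in> ?D" "restrict (sol x) {0..R} = restrict (sol y) {0..R}"
      have "sol x 0 = sol y 0" using fun_cong[OF xy(3), of 0] R by simp
      then show "x = y" using at0[of x] at0[of y] D[OF xy(1)] D[OF xy(2)] by simp
    qed
    then have "card ((\<lambda>u. restrict u {0..R}) ` (sol ` ?D)) = card ?D"
      by (simp add: image_image card_image)
    also have "\<dots> = card (cs ` {k+1..j}) + card (cl ` {1..j})"
    proof (rule card_Un_disjoint)
      show "cs ` {k+1..j} \<inter> cl ` {1..j} = {}"
      proof (rule equals0I)
        fix d assume "d \<in> cs ` {k+1..j} \<inter> cl ` {1..j}"
        then obtain l l' where "d = cs l" "l \<in> {k+1..j}" "d = cl l'" "l' \<in> {1..j}" by blast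
        then show False using cs[of l] cl[of l'] by simp
      qed
    qed simp_all
    also have "card (cs ` {k+1..j}) = j - k"
      by (subst card_image[OF strict_mono_on_imp_inj_on[OF mono(1)]]) simp
    also have "card (cl ` {1..j}) = j"
    proof -
      have "inj_on cl {1..j}"
      proof (rule inj_onI, rule ccontr)
        fix x y assume "x \<in> {1..j}" "y \<in> {1..j}" "cl x = cl y" "x \<noteq> y"
        then show False using monotone_onD[OF mono(2), of x y] monotone_onD[OF mono(2), of y x]
          by (cases x y rule: linorder_cases) auto
      qed
      then show ?thesis by (simp add: card_image)
    qed
    also have "j - k + j = 2 * j - k" using kj by arith
    finally show ?thesis .
  qed
  show ?thesis
    unfolding nodal_pairs_def
  proof (rule exI[of _ "\<lambda>l. sol (cs l)"], rule exI[of _ "\<lambda>l. sol (cl l)"], unfold image, intro conjI ballI impI)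
    show "is_solution N R q g lam mu u" if "u \<in> sol ` ?D" for u by (rule solutions[OF that])
    show "card ((\<lambda>u. restrict u {0..R}) ` (sol ` ?D)) = 2 * j - k" by (rule count)
    show "0 < sol (cs l) 0" if "l \<in> {k+1..j}" for l using csR[OF that] at0[of "cs l"] by simp
    show "0 < sol (cl l) 0" if "l \<in> {1..j}" for l using clR[OF that] at0[of "cl l"] by simp
    show "strict_mono_on {k+1..j} (\<lambda>l. sol (cs l) 0)"
    proof (rule strict_mono_onI)
      fix x y assume xy: "x \<in> {k+1..j}" "y \<in> {k+1..j}" "x < y"
      show "sol (cs x) 0 < sol (cs y) 0"
        using strict_mono_onD[OF mono(1) xy] at0[of "cs x"] at0[of "cs y"] csR[OF xy(1)] csR[OF xy(2)] by simp
    qed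
    show "strict_antimono_on {1..j} (\<lambda>l. sol (cl l) 0)"
    proof (rule monotone_onI)
      fix x y assume xy: "x \<in> {1..j}" "y \<in> {1..j}" "x < y"
      show "sol (cl x) 0 > sol (cl y) 0"
        using monotone_onD[OF mono(2) xy] at0[of "cl x"] at0[of "cl y"] clR[OF xy(1)] clR[OF xy(2)] by simp
    qed
    show "sol (cs j) 0 < sol (cl j) 0" if "k < j"
      using that cs[of j] cl[of j] csR[of j] clR[of j] at0[of "cs j"] at0[of "cl j"] by simp
    show "has_exactly_zeros_on (l - 1) {0<..<R} (sol (cs l))" if "l \<in> {k+1..j}" for l
      using csR[OF that] cs[OF that] by (intro nodes) auto
    show "has_exactly_zeros_on (l - 1) {0<..<R} (sol (cl l))" if "l \<in> {1..j}" for l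
      using clR[OF that] cl[OF that] by (intro nodes) auto
    show "regular_profile R u" if "\<forall>s. s \<noteq> 0 \<and> \<bar>s\<bar> \<le> R \<longrightarrow> g s * s > 0" "u \<in> sol ` ?D" for u
      by (rule regular[OF that])
  qed
qed

end

theorem theorem3p1:
  fixes N :: nat and R \<delta> \<gamma> C1 C2 q0 :: real
    and g q :: "real \<Rightarrow> real"
  assumes dim: "N = CARD('n::finite)"
    and "N \<ge> 2" and "R > 0"
    and g1: "\<forall>x. \<exists>e>0. \<exists>L. L-lipschitz_on (ball x e) g"
    and g2: "\<delta> > 0" "\<gamma> > 2" "0 < C1" "C1 \<le> C2"
      "\<forall>s\<in>{-\<delta><..<\<delta>}. C1 * \<bar>s\<bar> powr \<gamma> \<le> g s * s \<and> g s * s \<le> C2 * \<bar>s\<bar> powr \<gamma>"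
    and q: "continuous_on {0..R} q"
      "q0 \<in> q ` {0..R}" "\<forall>r\<in>{0..R}. q0 \<le> q r" "q0 > 0"
  shows "\<exists>mu_star :: nat \<Rightarrow> real \<Rightarrow> real.
    (\<forall>j\<ge>1. \<forall>lam\<ge>0. mu_star j lam \<ge> 0) \<and>
    (\<forall>j\<ge>1. \<forall>lam\<ge>0. lam > lambda_rad TYPE('n) R j \<longrightarrow> mu_star j lam = 0) \<and>
    (\<forall>j\<ge>1. \<forall>lam\<ge>0. mu_star j lam \<le> mu_star (j + 1) lam) \<and>
    (\<forall>k j :: nat. \<forall>lam mu :: real.
       lam \<ge> 0 \<and> mu \<ge> 0 \<and>
       lam \<in> {lambda_rad TYPE('n) R k..<lambda_rad TYPE('n) R (k + 1)} \<and>
       j \<ge> max 1 k \<and> mu > mu_star j lam \<longrightarrow>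
       (\<exists>us ul :: nat \<Rightarrow> real \<Rightarrow> real.
          (\<forall>u \<in> us ` {k+1..j} \<union> ul ` {1..j}. is_solution N R q g lam mu u) \<and>
          card ((\<lambda>u. restrict u {0..R}) ` (us ` {k+1..j} \<union> ul ` {1..j})) = 2 * j - k \<and>
          (\<forall>l\<in>{k+1..j}. 0 < us l 0) \<and> (\<forall>l\<in>{1..j}. 0 < ul l 0) \<and>
          strict_mono_on {k+1..j} (\<lambda>l. us l 0) \<and>
          (k < j \<longrightarrow> us j 0 < ul j 0) \<and>
          strict_antimono_on {1..j} (\<lambda>l. ul l 0) \<and>
          (\<forall>l\<in>{k+1..j}. has_exactly_zeros_on (l - 1) {0<..<R} (us l)) \<and>
          (\<forall>l\<in>{1..j}. has_exactly_zeros_on (l - 1) {0<..<R} (ul l)) \<and>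
          ((\<forall>s. s \<noteq> 0 \<and> \<bar>s\<bar> \<le> R \<longrightarrow> g s * s > 0) \<longrightarrow>
             (\<forall>u \<in> us ` {k+1..j} \<union> ul ` {1..j}. regular_profile R u))))"
proof -
  interpret minkowski_problem N R \<delta> \<gamma> C1 C2 q0 g q
    by unfold_locales (use assms in auto)
  let ?L = "lambda_rad TYPE('n) R"
  have "\<forall>j lam. \<exists>M. 0 \<le> lam \<longrightarrow> 1 \<le> M \<and> (\<forall>mu>M. many_nodes lam mu j)"
    using large_mu_oscillates by blast
  then obtain M where M: "\<And>j lam. 0 \<le> lam \<Longrightarrow> 1 \<le> M j lam"
    "\<And>j lam mu. 0 \<le> lam \<Longrightarrow> M j lam < mu \<Longrightarrow> many_nodes lam mu j" by metis
  \<comment> \<open>The maximum over all \<open>i \<le> j\<close> makes the thresholds monotone in \<open>j\<close>.\<close>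
  define mu_star where "mu_star j lam = (if ?L j < lam then 0 else Max ((\<lambda>i. M i lam) ` {..j}))" for j lam
  have Max_ge_M: "M i lam \<le> Max ((\<lambda>i. M i lam) ` {..j})" if "i \<le> j" for i j lam
    using that by (intro Max_ge) auto
  have Max_nn: "0 \<le> Max ((\<lambda>i. M i lam) ` {..j})" if "0 \<le> lam" for j lam
    by (rule order_trans[OF _ Max_ge_M[of 0]]) (use M(1)[OF that, of 0] in auto)
  have many: "many_nodes lam mu j" if "0 \<le> lam" "1 \<le> j" "mu_star j lam < mu" for lam mu j
  proof (cases "?L j < lam")
    case True
    then show ?thesis by (rule many_nodes_above_eigenvalue[OF dim that(2)])
  next
    case False
    then have "M j lam < mu" using that(3) Max_ge_M[of j j lam] by (simp add: mu_star_def)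
    then show ?thesis by (rule M(2)[OF that(1)])
  qed
  have nonneg: "0 \<le> mu_star j lam" if "0 \<le> lam" for j lam
    using Max_nn[OF that] by (simp add: mu_star_def)
  have mono: "mu_star j lam \<le> mu_star (j + 1) lam" if "1 \<le> j" "0 \<le> lam" for j lam
  proof (cases "?L j < lam")
    case True
    then show ?thesis using nonneg[OF that(2), of "j + 1"] by (simp add: mu_star_def)
  next
    case False
    moreover have "?L j < ?L (j + 1)" by (rule lambda_rad_mono[OF dim N R that(1)]) simp
    moreover have "Max ((\<lambda>i. M i lam) ` {..j}) \<le> Max ((\<lambda>i. M i lam) ` {..j + 1})"
      by (intro Max_mono) auto
    ultimately show ?thesis by (simp add: mu_star_def)
  qed
  show ?thesis
    unfolding nodal_pairs_def[symmetric]
  proof (rule exI[of _ mu_star], intro conjI allI impI)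
    fix j :: nat and lam :: real assume j: "1 \<le> j" and lam: "0 \<le> lam"
    show "0 \<le> mu_star j lam" by (rule nonneg[OF lam])
    show "mu_star j lam = 0" if "?L j < lam" using that by (simp add: mu_star_def)
    show "mu_star j lam \<le> mu_star (j + 1) lam" by (rule mono[OF j lam])
  next
    fix k j :: nat and lam mu :: real
    assume a: "0 \<le> lam \<and> 0 \<le> mu \<and> lam \<in> {?L k..<?L (k + 1)} \<and> max 1 k \<le> j \<and> mu_star j lam < mu"
    then have "0 \<le> lam" "lam < ?L (k + 1)" "0 < mu" "k \<le> j" "many_nodes lam mu j"
      using nonneg[of lam j] many[of lam j mu] by auto
    then show "\<exists>us ul. nodal_pairs lam mu k j us ul" by (rule nodal_solutions[OF dim])
  qed
qed

end
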